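(* Let $k\ge0$ be an integer. If $k$ is odd, the space of modes of wavenumber $k$ of $S^3/O^*$ is $\{0\}$. If $k$ is even, put $\tilde k=\lfloor\frac{k/2}{2}\rfloor+\lfloor\frac{k/2}{3}\rfloor+\lfloor\frac{k/2}{4}\rfloor-\frac k2$. For $i=0,\dots,\tilde k$ let $$B_i=(\alpha^8+14\alpha^4\beta^4+\beta^8)^{3i+\mathrm{mod}(k/2,3)}\,(\alpha^{10}\beta^2-2\alpha^6\beta^6+\alpha^2\beta^{10})^{2(\tilde k-i)+(\mathrm{mod}(k/2,4)-\mathrm{mod}(k/2,2))/2}\,(\alpha^{17}\beta-34\alpha^{13}\beta^5+34\alpha^5\beta^{13}-\alpha\beta^{17})^{\mathrm{mod}(k/2,2)}.$$ Then the siblings of $B_0,\dots,B_{\tilde k}$ (restricted to $S^3$) form a basis of the space of modes of wavenumber $k$ of $S^3/O^*$, which therefore has dimension $(\tilde k+1)(k+1)$ (zero when $\tilde k=-1$).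
   Context: Identify $\mathbb R^4$ with $\mathbb C^2$ via $\alpha=x+iy$, $\beta=z+iw$, $S^3=\{|\alpha|^2+|\beta|^2=1\}$. Wirtinger derivatives $\frac{\partial}{\partial\alpha}=\frac12(\partial_x-i\partial_y)$, similarly for $\beta$ with $(z,w)$. $\mathrm{twist}_-=-\bar\beta\frac{\partial}{\partial\alpha}+\bar\alpha\frac{\partial}{\partial\beta}$. For a polynomial $f$ in $\alpha,\beta$ only, homogeneous of degree $k$, its siblings are $\mathrm{twist}_-^j f$, $j=0,\dots,k$. $\gamma\in SU(2)$ acts on $\mathbb C^2$ by $(\alpha,\beta)^T\mapsto\gamma(\alpha,\beta)^T$ and on functions by $(R_\gamma F)(x)=F(\gamma^{-1}x)$. For a finite subgroup $\Gamma\subset SU(2)$, the space of modes of wavenumber $k$ of $S^3/\Gamma$ is the complex vector space of $\Gamma$-invariant $F:S^3\to\mathbb C$ with $\Delta_{S^3}F=-k(k+2)F$. $\mathrm{mod}(m,n)$ is the remainder of $m$ on division by $n$. A matrix $\begin{pmatrix}a&b\\c&d\end{pmatrix}\in SU(2)$ induces $z\mapsto\frac{az+b}{cz+d}$ on $\mathbb C\cup\{\infty\}$. Let $V_O=\{0,\infty,\pm1,\pm i\}$, $O$ the order-24 group of such Möbius maps preserving $V_O$ (octahedral rotation group), and $O^*\subset SU(2)$ (order 48) the matrices inducing elements of $O$. *)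

theory Defs
  imports "HOL-Analysis.Analysis" "HOL-Library.Function_Algebras"
begin

text \<open>Points of C^2 = R^4: p :: complex^2 with alpha = p$1, beta = p$2.
  Functions on S^3 are encoded as functions on C^2 that vanish off S^3.\<close>

type_synonym pt = "complex ^ 2"
type_synonym mat2 = "complex ^ 2 ^ 2"

definition S3 :: "pt set" where
  "S3 = {p. cmod (p$1)^2 + cmod (p$2)^2 = 1}"

definition restrS3 :: "(pt \<Rightarrow> complex) \<Rightarrow> (pt \<Rightarrow> complex)" where
  "restrS3 F = (\<lambda>p. if p \<in> S3 then F p else 0)"

definition pd :: "pt \<Rightarrow> (pt \<Rightarrow> complex) \<Rightarrow> pt \<Rightarrow> complex" where
  "pd v F p = vector_derivative (\<lambda>t::real. F (p + t *\<^sub>R v)) (at 0)"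

definition d_alpha :: "(pt \<Rightarrow> complex) \<Rightarrow> pt \<Rightarrow> complex" where
  "d_alpha F p = (pd (axis 1 1) F p - \<i> * pd (axis 1 \<i>) F p) / 2"

definition d_beta :: "(pt \<Rightarrow> complex) \<Rightarrow> pt \<Rightarrow> complex" where
  "d_beta F p = (pd (axis 2 1) F p - \<i> * pd (axis 2 \<i>) F p) / 2"

definition twist_minus :: "(pt \<Rightarrow> complex) \<Rightarrow> pt \<Rightarrow> complex" where
  "twist_minus F p = - cnj (p$2) * d_alpha F p + cnj (p$1) * d_beta F p"

definition lap4 :: "(pt \<Rightarrow> complex) \<Rightarrow> pt \<Rightarrow> complex" where
  "lap4 F p = (\<Sum>v\<leftarrow>[axis 1 1, axis 1 \<i>, axis 2 1, axis 2 \<i>]. pd v (pd v F) p)"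

definition ext0 :: "(pt \<Rightarrow> complex) \<Rightarrow> pt \<Rightarrow> complex" where
  "ext0 F q = F (q /\<^sub>R norm q)"

definition lapS3 :: "(pt \<Rightarrow> complex) \<Rightarrow> pt \<Rightarrow> complex" where
  "lapS3 F p = lap4 (ext0 F) p"

definition C2_on :: "pt set \<Rightarrow> (pt \<Rightarrow> complex) \<Rightarrow> bool" where
  "C2_on U G \<longleftrightarrow> (\<exists>G' :: pt \<Rightarrow> (pt \<Rightarrow>\<^sub>L complex). \<exists>G'' :: pt \<Rightarrow> (pt \<Rightarrow>\<^sub>L (pt \<Rightarrow>\<^sub>L complex)).
     (\<forall>x\<in>U. (G has_derivative blinfun_apply (G' x)) (at x)) \<and>
     (\<forall>x\<in>U. (G' has_derivative blinfun_apply (G'' x)) (at x)) \<and>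
     continuous_on U G'')"

definition C2_S3 :: "(pt \<Rightarrow> complex) \<Rightarrow> bool" where
  "C2_S3 F \<longleftrightarrow> (\<exists>U. open U \<and> S3 \<subseteq> U \<and> C2_on U (ext0 F))"

definition SU2 :: "mat2 set" where
  "SU2 = {g. (\<chi> i j. cnj (g$j$i)) ** g = mat 1 \<and> det g = 1}"

text \<open>Moebius action on the Riemann sphere C \<union> {\<infinity>}, encoded as complex option (None = \<infinity>).\<close>
definition mobius :: "mat2 \<Rightarrow> complex option \<Rightarrow> complex option" where
  "mobius g z = (let a = g$1$1; b = g$1$2; c = g$2$1; d = g$2$2 in
     (case z of
        None \<Rightarrow> (if c = 0 then None else Some (a / c))
      | Some w \<Rightarrow> (if c * w + d = 0 then None else Some ((a * w + b) / (c * w + d)))))"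

definition V_O :: "complex option set" where
  "V_O = {Some 0, None, Some 1, Some (-1), Some \<i>, Some (-\<i>)}"

definition Ostar :: "mat2 set" where
  "Ostar = {g \<in> SU2. mobius g ` V_O = V_O}"

definition Rg :: "mat2 \<Rightarrow> (pt \<Rightarrow> complex) \<Rightarrow> pt \<Rightarrow> complex" where
  "Rg g F x = F (matrix_inv g *v x)"

definition modes :: "mat2 set \<Rightarrow> nat \<Rightarrow> (pt \<Rightarrow> complex) set" where
  "modes G k = {F. (\<forall>p. p \<notin> S3 \<longrightarrow> F p = 0) \<and> C2_S3 F \<and>
      (\<forall>g\<in>G. \<forall>p\<in>S3. Rg g F p = F p) \<and>
      (\<forall>p\<in>S3. lapS3 F p = - of_nat (k * (k + 2)) * F p)}"

definition cscale :: "complex \<Rightarrow> (pt \<Rightarrow> complex) \<Rightarrow> (pt \<Rightarrow> complex)" where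
  "cscale c F = (\<lambda>x. c * F x)"

abbreviation "cspan \<equiv> module.span cscale"
abbreviation "cindependent S \<equiv> \<not> module.dependent cscale S"
abbreviation "cdim \<equiv> vector_space.dim cscale"

definition homog :: "nat \<Rightarrow> (pt \<Rightarrow> complex) \<Rightarrow> bool" where
  "homog d f \<longleftrightarrow> (\<forall>t::complex. \<forall>p. f (t *s p) = t ^ d * f p)"

definition ktilde :: "nat \<Rightarrow> int" where
  "ktilde k = (let m = int (k div 2) in m div 2 + m div 3 + m div 4 - m)"

definition Bfun :: "nat \<Rightarrow> int \<Rightarrow> pt \<Rightarrow> complex" where
  "Bfun k i p = (let a = p$1; b = p$2; m = int (k div 2); kt = ktilde k in
     (a^8 + 14 * a^4 * b^4 + b^8) ^ nat (3 * i + m mod 3) *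
     (a^10 * b^2 - 2 * a^6 * b^6 + a^2 * b^10) ^ nat (2 * (kt - i) + (m mod 4 - m mod 2) div 2) *
     (a^17 * b - 34 * a^13 * b^5 + 34 * a^5 * b^13 - a * b^17) ^ nat (m mod 2))"

end

theory Submission
  imports Defs
begin

text \<open>A holomorphic form f of degree k has the generating function f(p + t J p) for its siblings, where
  J is multiplication by the quaternion j. Its coefficients are harmonic and homogeneous, which makes all
  siblings eigenfunctions, and on S^3 the span of all siblings is closed under multiplication by the
  coordinates, hence dense. Green's formula on a thin shell around S^3 makes eigenfunctions for different k
  orthogonal, so an eigenfunction minus its projection to the siblings of degree k is orthogonal to a dense
  set and vanishes. Since J commutes with SU(2) and the siblings are independent, a mode is invariant iff
  each of its forms is, which leaves the invariant binary forms of O*. A form that transforms by a sign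
  character and vanishes at one vertex of the octahedron vanishes at all six, so it is divisible by the
  vertex form f6; the eigenvalue of the stabiliser of the vertex controls which forms vanish there.
  Subtracting multiples of forms with value 1 at the vertex and dividing by f6^4 gives the invariants by
  descent.\<close>

section \<open>Generating polynomials of siblings\<close>

text \<open>No measure on S3 is used: functions on the sphere are extended to be constant along
  rays, and integrals become Lebesgue integrals over a shell against a weight depending only on |x|.
  The gradient of such a weight is radial, so it annihilates the extended functions, and integration
  by parts leaves neither boundary terms nor derivatives of the weight. The exponents in
  \<open>Bfun\<close> come from one ratio. If a form of degree k transforms by the sign s, it can be
  nonzero at the vertex only when eps^k / s = 1. Dividing by \<open>f6\<close> lowers k by 6 and
  changes s to -s, which multiplies the ratio by -i. An invariant form of degree 2m starts with
  ratio i^m, so it is divisible by f6^r with r = m mod 4; after that a free vertex value recurs at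
  every fourth division. For odd r the quotient has character -1 and a factor \<open>f12\<close>
  splits off. This explains the residues of k/2 modulo 4 and 2; the residue modulo 3 reflects the
  exchange of f8^3 for f6^4, both of degree 24.\<close>

text \<open>The twist is the derivation with \<alpha> \<mapsto> -cnj \<beta>, \<beta> \<mapsto> cnj \<alpha> that kills cnj \<alpha> and cnj \<beta>, so
  gen a b is exp(t twist) applied to \<alpha>^a \<beta>^b, a polynomial in t.\<close>
definition gen :: "nat \<Rightarrow> nat \<Rightarrow> pt \<Rightarrow> complex poly" where
  "gen a b p = [:p$1, - cnj (p$2):] ^ a * [:p$2, cnj (p$1):] ^ b"

definition sib :: "nat \<Rightarrow> nat \<Rightarrow> nat \<Rightarrow> pt \<Rightarrow> complex" where
  "sib a b j p = coeff (gen a b p) j"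

text \<open>Polynomials in t are differentiated in the point coefficient by coefficient, so that the
  product rule passes through the Cauchy product.\<close>

definition pderivable :: "(pt \<Rightarrow> complex poly) \<Rightarrow> (pt \<Rightarrow> complex poly) \<Rightarrow> pt \<Rightarrow> bool" where
  "pderivable P P' p \<longleftrightarrow>
     (\<forall>j. ((\<lambda>q. coeff (P q) j) has_derivative (\<lambda>v. coeff (P' v) j)) (at p))"

lemma pderivable_mult:
  assumes "pderivable P P' p" "pderivable Q Q' p"
  shows "pderivable (\<lambda>q. P q * Q q) (\<lambda>v. P p * Q' v + P' v * Q p) p"
  unfolding pderivable_def
proof
  fix j
  have "((\<lambda>q. \<Sum>i\<le>j. coeff (P q) i * coeff (Q q) (j - i)) has_derivative
        (\<lambda>v. \<Sum>i\<le>j. coeff (P p) i * coeff (Q' v) (j - i) + coeff (P' v) i * coeff (Q p) (j - i))) (at p)"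
    using assms unfolding pderivable_def
    by (intro has_derivative_sum has_derivative_mult) auto
  then show "((\<lambda>q. coeff (P q * Q q) j) has_derivative
       (\<lambda>v. coeff (P p * Q' v + P' v * Q p) j)) (at p)"
    by (simp add: coeff_mult sum.distrib)
qed

lemma pderivable_power:
  assumes "pderivable P P' p"
  shows "pderivable (\<lambda>q. P q ^ n) (\<lambda>v. of_nat n * P p ^ (n - 1) * P' v) p"
proof (induction n)
  case 0
  then show ?case by (simp add: pderivable_def)
next
  case (Suc n)
  have eq: "P p * (of_nat n * P p ^ (n - 1) * P' v) + P' v * P p ^ n
      = of_nat (Suc n) * P p ^ (Suc n - 1) * P' v" for v
    by (cases n) (auto simp: algebra_simps)
  show ?case
    using pderivable_mult[OF assms Suc.IH] unfolding eq by simp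
qed

lemma pderivable_linear:
  assumes "bounded_linear f" "bounded_linear g"
  shows "pderivable (\<lambda>q. [:f q, g q:]) (\<lambda>v. [:f v, g v:]) p"
  unfolding pderivable_def
proof
  fix j :: nat
  show "((\<lambda>q. coeff [:f q, g q:] j) has_derivative (\<lambda>v. coeff [:f v, g v:] j)) (at p)"
  proof (cases j)
    case 0 then show ?thesis using assms by (simp add: bounded_linear_imp_has_derivative)
  next
    case (Suc i) then show ?thesis using assms
      by (cases i) (auto simp: bounded_linear_imp_has_derivative)
  qed
qed

lemma bounded_linear_pt_nth: "bounded_linear (\<lambda>q::pt. q $ i)"
  by (rule bounded_linear_vec_nth)
lemma bounded_linear_pt_cnj: "bounded_linear (\<lambda>q::pt. cnj (q $ i))"
  by (rule bounded_linear_compose[OF bounded_linear_cnj bounded_linear_vec_nth])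

text \<open>Both linear factors of \<open>gen\<close> are real-linear in the point, so
  differentiating one of them along v just replaces p by v. The exponents a - 1 and b - 1 at 0 are
  harmless because of the factors a and b.\<close>

definition dgen :: "nat \<Rightarrow> nat \<Rightarrow> pt \<Rightarrow> pt \<Rightarrow> complex poly" where
  "dgen a b v p = of_nat a * gen (a-1) b p * [:v$1, - cnj (v$2):]
                + of_nat b * gen a (b-1) p * [:v$2, cnj (v$1):]"

lemma pderivable_gen: "pderivable (gen a b) (\<lambda>v. dgen a b v p) p"
proof -
  have 1: "pderivable (\<lambda>q. [:q$1, - cnj (q$2):] ^ a)
     (\<lambda>v. of_nat a * [:p$1, - cnj (p$2):] ^ (a - 1) * [:v$1, - cnj (v$2):]) p"
    by (intro pderivable_power pderivable_linear bounded_linear_pt_nth bounded_linear_minus bounded_linear_pt_cnj)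
  have 2: "pderivable (\<lambda>q. [:q$2, cnj (q$1):] ^ b)
     (\<lambda>v. of_nat b * [:p$2, cnj (p$1):] ^ (b - 1) * [:v$2, cnj (v$1):]) p"
    by (intro pderivable_power pderivable_linear bounded_linear_pt_nth bounded_linear_pt_cnj)
  show ?thesis
    using pderivable_mult[OF 1 2] unfolding gen_def[abs_def] dgen_def
    by (simp only: mult_ac add_ac)
qed

lemma has_derivative_sib:
  "(sib a b j has_derivative (\<lambda>v. coeff (dgen a b v p) j)) (at p)"
  using pderivable_gen[of a b p] unfolding pderivable_def sib_def[abs_def] by blast

text \<open>Expressing the derivative through siblings of degree one less lets the second
  derivatives follow by differentiating again. The case j = 0 is separate because truncated
  subtraction would pick up the wrong coefficient.\<close>

lemma dgen_eq_sib:
  "coeff (dgen a b v p) j =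
     of_nat a * (v$1 * sib (a-1) b j p - (if j = 0 then 0 else cnj (v$2) * sib (a-1) b (j-1) p))
   + of_nat b * (v$2 * sib a (b-1) j p + (if j = 0 then 0 else cnj (v$1) * sib a (b-1) (j-1) p))"
proof -
  have *: "coeff (of_nat n * Q * [:c, d:]) j = of_nat n * (c * coeff Q j + (if j = 0 then 0 else d * coeff Q (j-1)))"
    for n Q and c d :: complex
    by (cases j) (auto simp: mult.assoc of_nat_poly algebra_simps)
  show ?thesis unfolding dgen_def coeff_add * sib_def by simp
qed

lemma has_vector_derivative_line:
  fixes f :: "pt \<Rightarrow> complex"
  assumes "(f has_derivative f') (at p)"
  shows "((\<lambda>t::real. f (p + t *\<^sub>R v)) has_vector_derivative f' v) (at 0)"
proof -
  have "((\<lambda>t::real. p + t *\<^sub>R v) has_derivative (\<lambda>t. t *\<^sub>R v)) (at 0)"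
    by (auto intro!: derivative_eq_intros)
  then have "((\<lambda>t. f (p + t *\<^sub>R v)) has_derivative (\<lambda>t. f' (t *\<^sub>R v))) (at 0)"
    using assms has_derivative_compose[of "\<lambda>t::real. p + t *\<^sub>R v" "\<lambda>t. t *\<^sub>R v" 0 UNIV f f'] by simp
  moreover have "f' (t *\<^sub>R v) = t *\<^sub>R f' v" for t
    using assms has_derivative_bounded_linear linear_simps(5) by blast
  ultimately show ?thesis by (simp add: has_vector_derivative_def)
qed

lemma pd_eqI:
  assumes "(f has_derivative f') (at p)"
  shows "pd v f p = f' v"
  unfolding pd_def by (rule vector_derivative_at[OF has_vector_derivative_line[OF assms]])

lemma pderiv_gen:
  "pderiv (gen a b p) = smult (- of_nat a * cnj (p$2)) (gen (a-1) b p) + smult (of_nat b * cnj (p$1)) (gen a (b-1) p)"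
  by (simp add: gen_def pderiv_mult pderiv_power pderiv_pCons algebra_simps)

lemma twist_minus_eqI:
  assumes "(f has_derivative f') (at p)"
  shows "twist_minus f p = - cnj (p$2) * ((f' (axis 1 1) - \<i> * f' (axis 1 \<i>)) / 2)
         + cnj (p$1) * ((f' (axis 2 1) - \<i> * f' (axis 2 \<i>)) / 2)"
  unfolding twist_minus_def d_alpha_def d_beta_def pd_eqI[OF assms] ..

lemma axis_simps [simp]:
  "(axis 1 c :: pt) $ 1 = c" "(axis 1 c :: pt) $ 2 = 0" "(axis 2 c :: pt) $ 1 = 0" "(axis 2 c :: pt) $ 2 = c"
  by (auto simp: axis_def)

text \<open>The antiholomorphic terms cancel in f'(e) - i f'(i e), and the remaining terms are the
  t-derivative of \<open>gen\<close>; comparing coefficients of t^j produces the factor j +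
  1.\<close>

lemma twist_sib_sum:
  "twist_minus (\<lambda>p. \<Sum>a\<le>k. d a * sib a (k - a) j p) p = of_nat (Suc j) * (\<Sum>a\<le>k. d a * sib a (k-a) (Suc j) p)"
proof -
  have D: "((\<lambda>p. \<Sum>a\<le>k. d a * sib a (k - a) j p) has_derivative
      (\<lambda>v. \<Sum>a\<le>k. d a * coeff (dgen a (k-a) v p) j)) (at p)"
    by (intro has_derivative_sum has_derivative_mult_right has_derivative_sib)
  have *: "- cnj (p$2) * ((coeff (dgen a b (axis 1 1) p) j - \<i> * coeff (dgen a b (axis 1 \<i>) p) j) / 2)
         + cnj (p$1) * ((coeff (dgen a b (axis 2 1) p) j - \<i> * coeff (dgen a b (axis 2 \<i>) p) j) / 2)
     = of_nat (Suc j) * sib a b (Suc j) p" for a b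
  proof -
    have "of_nat (Suc j) * sib a b (Suc j) p = coeff (pderiv (gen a b p)) j"
      by (simp add: coeff_pderiv sib_def)
    also have "\<dots> = - of_nat a * cnj (p$2) * sib (a-1) b j p + of_nat b * cnj (p$1) * sib a (b-1) j p"
      by (simp add: pderiv_gen sib_def)
    finally show ?thesis
      by (cases j) (simp_all add: dgen_eq_sib algebra_simps)
  qed
  have "of_nat (Suc j) * (\<Sum>a\<le>k. d a * sib a (k-a) (Suc j) p) = (\<Sum>a\<le>k. d a * (of_nat (Suc j) * sib a (k-a) (Suc j) p))"
    by (simp add: sum_distrib_left mult_ac)
  also have "\<dots> = twist_minus (\<lambda>p. \<Sum>a\<le>k. d a * sib a (k - a) j p) p"
    unfolding twist_minus_eqI[OF D] *[symmetric]
    by (simp add: sum_distrib_left sum_distrib_right sum.distrib sum_subtractf sum_divide_distrib algebra_simps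
         diff_divide_distrib sum_negf)
  finally show ?thesis by simp
qed

definition form :: "nat \<Rightarrow> (nat \<Rightarrow> complex) \<Rightarrow> pt \<Rightarrow> complex" where
  "form k d p = (\<Sum>a\<le>k. d a * (p$1)^a * (p$2)^(k-a))"

lemma sib_0: "sib a b 0 p = (p$1)^a * (p$2)^b"
  by (simp add: sib_def gen_def coeff_mult coeff_0_power)

lemma twist_cmult_sib_sum:
  "twist_minus (\<lambda>p. c * (\<Sum>a\<le>k. d a * sib a (k - a) j p)) = (\<lambda>p. c * of_nat (Suc j) * (\<Sum>a\<le>k. d a * sib a (k-a) (Suc j) p))"
  using twist_sib_sum[where d = "\<lambda>a. c * d a" and k = k and j = j]
  by (auto simp: sum_distrib_left mult_ac)

lemma twist_form:
  "(twist_minus ^^ j) (form k d) = (\<lambda>p. fact j * (\<Sum>a\<le>k. d a * sib a (k-a) j p))"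
proof (induction j)
  case 0
  show ?case by (simp add: form_def[abs_def] sib_0 mult_ac)
next
  case (Suc j)
  show ?case unfolding funpow.simps o_def Suc.IH twist_cmult_sib_sum by (simp add: mult_ac)
qed

text \<open>Real scalars only: the factors of \<open>gen\<close> mix coordinates with conjugates, so
  a phase also rescales t, which is the content of \<open>sib_phase\<close>.\<close>

lemma sib_scale: "sib a b j ((of_real c) *s p) = of_real c ^ (a+b) * sib a b j p"
proof -
  have "gen a b ((of_real c) *s p) = smult (of_real c ^ (a+b)) (gen a b p)"
  proof -
    have "[:of_real c * p$1, - (of_real c * cnj (p$2)):] = smult (of_real c) [:p$1, - cnj (p$2):]"
         "[:of_real c * p$2, of_real c * cnj (p$1):] = smult (of_real c) [:p$2, cnj (p$1):]" by auto
    then have "[:of_real c * p$1, - (of_real c * cnj (p$2)):] ^ a = smult (of_real c ^ a) ([:p$1, - cnj (p$2):] ^ a)"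
         "[:of_real c * p$2, of_real c * cnj (p$1):] ^ b = smult (of_real c ^ b) ([:p$2, cnj (p$1):] ^ b)"
      by (simp_all only: smult_power)
    then show ?thesis
      by (simp add: gen_def vector_scalar_mult_def power_add mult_ac)
  qed
  then show ?thesis by (simp add: sib_def)
qed

lemma sib_eq_0: "j > a + b \<Longrightarrow> sib a b j p = 0"
proof -
  assume "j > a + b"
  have "degree (gen a b p) \<le> a + b"
    unfolding gen_def
    by (rule order.trans[OF degree_mult_le add_mono])
       (rule order.trans[OF degree_power_le], simp)+
  with \<open>j > a + b\<close> show ?thesis by (simp add: sib_def coeff_eq_0)
qed

section \<open>Twice differentiable functions and the Laplacian\<close>

text \<open>Derivatives are functions of directions and then of the point, so that products and
  conjugates are computed pointwise instead of with operator-valued maps. In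
  \<open>f'' v w x\<close> the derivative along v is taken first.\<close>

definition C2d :: "pt set \<Rightarrow> (pt \<Rightarrow> complex) \<Rightarrow> (pt \<Rightarrow> pt \<Rightarrow> complex) \<Rightarrow> (pt \<Rightarrow> pt \<Rightarrow> pt \<Rightarrow> complex) \<Rightarrow> bool" where
  "C2d U f f' f'' \<longleftrightarrow>
     (\<forall>x\<in>U. (f has_derivative (\<lambda>v. f' v x)) (at x)) \<and>
     (\<forall>v. \<forall>x\<in>U. (f' v has_derivative (\<lambda>w. f'' v w x)) (at x)) \<and>
     (\<forall>v w. continuous_on U (f'' v w))"

lemma C2dD:
  assumes "C2d U f f' f''"
  shows "x \<in> U \<Longrightarrow> (f has_derivative (\<lambda>v. f' v x)) (at x)"
    "x \<in> U \<Longrightarrow> (f' v has_derivative (\<lambda>w. f'' v w x)) (at x)"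
    "continuous_on U (f'' v w)" "continuous_on U f" "continuous_on U (f' v)"
  using assms unfolding C2d_def
  by (auto intro!: continuous_at_imp_continuous_on has_derivative_continuous)

lemma C2d_imp_C2_on:
  assumes "C2d U f f' f''"
  shows "C2_on U f"
proof -
  note f = C2dD[OF assms]
  \<comment> \<open>The operators are assembled from their values on the real basis: regularity of
    finitely many coordinate functions passes through bounded linear maps.\<close>
  define G' where "G' x = (\<Sum>i\<in>Basis. blinfun_scaleR_left (f' i x) o\<^sub>L blinfun_inner_left i)" for x
  define G'' where "G'' x = (\<Sum>j\<in>Basis. blinfun_scaleR_left
     (\<Sum>i\<in>Basis. blinfun_scaleR_left (f'' i j x) o\<^sub>L blinfun_inner_left i) o\<^sub>L blinfun_inner_left j)" for x
  have rep: "g v = (\<Sum>i\<in>Basis. (v \<bullet> i) *\<^sub>R g i)" if "bounded_linear g"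
    for g :: "pt \<Rightarrow> complex" and v
  proof -
    interpret bounded_linear g by fact
    have "g v = g (\<Sum>i\<in>Basis. (v \<bullet> i) *\<^sub>R i)" by (simp add: euclidean_representation)
    then show ?thesis by (simp add: sum scaleR)
  qed
  have 1: "blinfun_apply (G' x) = (\<lambda>v. f' v x)" if "x \<in> U" for x
  proof
    fix v show "blinfun_apply (G' x) v = f' v x"
      using rep[OF has_derivative_bounded_linear[OF f(1)[OF that]], of v]
      by (simp add: G'_def blinfun.sum_left)
  qed
  have 2: "(G' has_derivative blinfun_apply (G'' x)) (at x)" if "x \<in> U" for x
  proof -
    have "(G' has_derivative (\<lambda>w. \<Sum>i\<in>Basis. blinfun_scaleR_left (f'' i w x) o\<^sub>L blinfun_inner_left i)) (at x)"
      unfolding G'_def[abs_def]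
      by (intro has_derivative_sum
         bounded_linear.has_derivative[OF bounded_linear_compose[OF
            bounded_bilinear.bounded_linear_left[OF bounded_bilinear_blinfun_compose]
            bounded_linear_blinfun_scaleR_left]] f that)
    moreover have "(\<Sum>i\<in>Basis. blinfun_scaleR_left (f'' i w x) o\<^sub>L blinfun_inner_left i) = G'' x w" for w
    proof (rule blinfun_eqI)
      fix v
      have "f'' i w x = (\<Sum>j\<in>Basis. (w \<bullet> j) *\<^sub>R f'' i j x)" for i
        using rep[OF has_derivative_bounded_linear[OF f(2)[OF that]], of i w] .
      then have "(\<Sum>i\<in>Basis. (v \<bullet> i) *\<^sub>R f'' i w x) = (\<Sum>i\<in>Basis. (v \<bullet> i) *\<^sub>R (\<Sum>j\<in>Basis. (w \<bullet> j) *\<^sub>R f'' i j x))"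
        by (simp only:)
      also have "\<dots> = (\<Sum>j\<in>Basis. \<Sum>i\<in>Basis. (w \<bullet> j) *\<^sub>R (v \<bullet> i) *\<^sub>R f'' i j x)"
        unfolding scaleR_right.sum by (subst sum.swap) (simp add: mult.commute)
      finally show "blinfun_apply (\<Sum>i\<in>Basis. blinfun_scaleR_left (f'' i w x) o\<^sub>L blinfun_inner_left i) v
          = blinfun_apply (blinfun_apply (G'' x) w) v"
        by (simp add: G''_def blinfun.sum_left scaleR_right.sum blinfun.scaleR_left)
    qed
    ultimately show ?thesis by simp
  qed
  have 3: "continuous_on U G''"
    unfolding G''_def
    by (intro continuous_intros bounded_bilinear.continuous_on[OF bounded_bilinear_blinfun_compose]
       bounded_linear.continuous_on[OF bounded_linear_blinfun_scaleR_left] f)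
  show ?thesis unfolding C2_on_def
    using f(1) 1 2 3 by (intro exI[of _ G'] exI[of _ G'']) auto
qed

lemma C2_on_imp_C2d:
  assumes "C2_on U f"
  obtains f' f'' where "C2d U f f' f''"
proof -
  obtain G' G'' where G: "\<forall>x\<in>U. (f has_derivative blinfun_apply (G' x)) (at x)"
    "\<forall>x\<in>U. (G' has_derivative blinfun_apply (G'' x)) (at x)" "continuous_on U G''"
    using assms unfolding C2_on_def by blast
  have "C2d U f (\<lambda>v x. G' x v) (\<lambda>v w x. G'' x w v)"
    unfolding C2d_def
  proof (intro conjI allI ballI)
    fix v x assume "x \<in> U"
    then show "((\<lambda>x. blinfun_apply (G' x) v) has_derivative (\<lambda>w. blinfun_apply (blinfun_apply (G'' x) w) v)) (at x)"
      using G(2) by (auto intro!: bounded_linear.has_derivative[OF bounded_linear_apply_blinfun] bounded_linear.has_derivative[OF bounded_bilinear.bounded_linear_left[OF bounded_bilinear_blinfun_apply]])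
  qed (use G in \<open>auto intro!: continuous_intros\<close>)
  then show ?thesis by (rule that)
qed

lemma C2d_add:
  assumes "C2d U f f' f''" "C2d U g g' g''"
  shows "C2d U (\<lambda>x. f x + g x) (\<lambda>v x. f' v x + g' v x) (\<lambda>v w x. f'' v w x + g'' v w x)"
  using C2dD[OF assms(1)] C2dD[OF assms(2)] unfolding C2d_def
  by (auto intro!: has_derivative_add continuous_intros)

lemma C2d_cmult:
  assumes "C2d U f f' f''"
  shows "C2d U (\<lambda>x. c * f x) (\<lambda>v x. c * f' v x) (\<lambda>v w x. c * f'' v w x)"
  using C2dD[OF assms(1)] unfolding C2d_def
  by (auto intro!: has_derivative_mult_right continuous_intros)

lemma C2d_mult:
  assumes "C2d U f f' f''" "C2d U g g' g''"
  shows "C2d U (\<lambda>x. f x * g x) (\<lambda>v x. f x * g' v x + f' v x * g x)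
     (\<lambda>v w x. (f x * g'' v w x + f' w x * g' v x) + (f' v x * g' w x + f'' v w x * g x))"
  using C2dD[OF assms(1)] C2dD[OF assms(2)] unfolding C2d_def
  by (auto intro!: has_derivative_add has_derivative_mult continuous_intros)

lemma C2d_cnj:
  assumes "C2d U f f' f''"
  shows "C2d U (\<lambda>x. cnj (f x)) (\<lambda>v x. cnj (f' v x)) (\<lambda>v w x. cnj (f'' v w x))"
  using C2dD[OF assms(1)] unfolding C2d_def
  by (auto intro!: bounded_linear.has_derivative[OF bounded_linear_cnj] continuous_intros)

lemma C2d_subset: "C2d U f f' f'' \<Longrightarrow> V \<subseteq> U \<Longrightarrow> C2d V f f' f''"
  unfolding C2d_def by (blast intro: continuous_on_subset)

lemma C2d_transform:
  assumes "C2d U f f' f''" "open U" "\<And>x. x \<in> U \<Longrightarrow> f x = g x"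
  shows "C2d U g f' f''"
  using assms unfolding C2d_def
  by (auto intro: has_derivative_transform_within_open[of _ _ _ UNIV U])

abbreviation "real_basis \<equiv> [axis 1 1, axis 1 \<i>, axis 2 1, axis 2 \<i>] :: pt list"

lemma pd_C2d:
  assumes "C2d U f f' f''" "x \<in> U"
  shows "pd v f x = f' v x"
  using C2dD(1)[OF assms] by (rule pd_eqI)

lemma pd_pd_C2d:
  assumes "C2d U f f' f''" "open U" "x \<in> U"
  shows "pd v (pd w f) x = f'' w v x"
proof -
  have "(pd w f has_derivative (\<lambda>v. f'' w v x)) (at x)"
    by (rule has_derivative_transform_within_open[OF C2dD(2)[OF assms(1,3)] assms(2,3)])
       (simp add: pd_C2d[OF assms(1)])
  then show ?thesis by (rule pd_eqI)
qed

lemma lap4_C2d: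
  assumes "C2d U f f' f''" "open U" "x \<in> U"
  shows "lap4 f x = (\<Sum>v\<leftarrow>real_basis. f'' v v x)"
  unfolding lap4_def using pd_pd_C2d[OF assms] by simp

section \<open>Powers of 1/|x| and the extension of siblings along rays\<close>

definition inorm :: "pt \<Rightarrow> complex" where
  "inorm x = of_real (inverse (norm x))"

lemma has_derivative_inorm:
  assumes "x \<noteq> 0"
  shows "(inorm has_derivative (\<lambda>v. - of_real (x \<bullet> v) * inorm x ^ 3)) (at x)"
  unfolding inorm_def[abs_def]
proof -
  have "((\<lambda>x. inverse (norm x)) has_derivative (\<lambda>v. - (inverse (norm x) * (v \<bullet> sgn x) * inverse (norm x)))) (at x)"
    using assms by (auto intro!: derivative_eq_intros has_derivative_norm)
  moreover have "- (inverse (norm x) * (v \<bullet> sgn x) * inverse (norm x)) = - (x \<bullet> v) * inverse (norm x) ^ 3" for v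
    by (simp add: sgn_div_norm power3_eq_cube inner_commute)
  ultimately have "((\<lambda>x. inverse (norm x)) has_derivative (\<lambda>v. - (x \<bullet> v) * inverse (norm x) ^ 3)) (at x)"
    by simp
  then have "((\<lambda>x. complex_of_real (inverse (norm x))) has_derivative (\<lambda>v. complex_of_real (- (x \<bullet> v) * inverse (norm x) ^ 3))) (at x)"
    by (rule has_derivative_of_real)
  then show "((\<lambda>x. complex_of_real (inverse (norm x))) has_derivative (\<lambda>v. - complex_of_real (x \<bullet> v) * complex_of_real (inverse (norm x)) ^ 3)) (at x)"
    by simp
qed

lemma has_derivative_inorm_power:
  assumes "x \<noteq> 0"
  shows "((\<lambda>x. inorm x ^ n) has_derivative (\<lambda>v. - of_nat n * of_real (x \<bullet> v) * inorm x ^ (n+2))) (at x)"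
proof (cases n)
  case (Suc m)
  show ?thesis
    using has_derivative_power[OF has_derivative_inorm[OF assms], of n]
    unfolding Suc by (rule has_derivative_eq_rhs) (simp add: fun_eq_iff power3_eq_cube, algebra)
qed simp

lemma C2d_inorm_power:
  "C2d (-{0}) (\<lambda>x. inorm x ^ n) (\<lambda>v x. - of_nat n * of_real (x \<bullet> v) * inorm x ^ (n+2))
     (\<lambda>v w x. - of_nat n * (of_real (w \<bullet> v) * inorm x ^ (n+2) - of_nat (n+2) * of_real (x \<bullet> v) * of_real (x \<bullet> w) * inorm x ^ (n+4)))"
  unfolding C2d_def
proof (intro conjI allI ballI)
  fix v w x :: pt assume x: "x \<in> -{0}"
  then have "x \<noteq> 0" by simp
  note 1 = has_derivative_inorm_power[OF this, of "n+2"]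
  show "((\<lambda>x. - of_nat n * of_real (x \<bullet> v) * inorm x ^ (n+2)) has_derivative
    (\<lambda>w. - of_nat n * (of_real (w \<bullet> v) * inorm x ^ (n+2) - of_nat (n+2) * of_real (x \<bullet> v) * of_real (x \<bullet> w) * inorm x ^ (n+4)))) (at x)"
  proof -
    have 2: "((\<lambda>x. of_real (x \<bullet> v)) has_derivative (\<lambda>w. complex_of_real (w \<bullet> v))) (at x)"
      by (intro has_derivative_of_real has_derivative_inner_left has_derivative_ident)
    show ?thesis
      unfolding mult.assoc
      by (rule has_derivative_eq_rhs[OF has_derivative_mult_right[OF has_derivative_mult[OF 2 1]]])
         (simp add: algebra_simps eval_nat_numeral)
  qed
next
  fix v w
  show "continuous_on (-{0}) (\<lambda>x. - of_nat n * (of_real (w \<bullet> v) * inorm x ^ (n+2) - of_nat (n+2) * of_real (x \<bullet> v) * of_real (x \<bullet> w) * inorm x ^ (n+4)))"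
    unfolding inorm_def by (auto intro!: continuous_intros)
qed (use has_derivative_inorm_power in auto)

definition d2sib :: "nat \<Rightarrow> nat \<Rightarrow> nat \<Rightarrow> pt \<Rightarrow> pt \<Rightarrow> pt \<Rightarrow> complex" where
  "d2sib a b j v w p = of_nat a * (v$1 * coeff (dgen (a-1) b w p) j - (if j = 0 then 0 else cnj (v$2) * coeff (dgen (a-1) b w p) (j-1)))
   + of_nat b * (v$2 * coeff (dgen a (b-1) w p) j + (if j = 0 then 0 else cnj (v$1) * coeff (dgen a (b-1) w p) (j-1)))"

lemma continuous_on_sib [continuous_intros]: "continuous_on U (sib a b j)"
  by (intro continuous_at_imp_continuous_on ballI has_derivative_continuous[OF has_derivative_sib])

lemma continuous_on_dgen: "continuous_on U (\<lambda>p. coeff (dgen a b v p) j)"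
  unfolding dgen_eq_sib by (cases "j = 0") (auto intro!: continuous_intros)

lemma C2d_sib: "C2d UNIV (sib a b j) (\<lambda>v p. coeff (dgen a b v p) j) (d2sib a b j)"
  unfolding C2d_def
proof (intro conjI allI ballI)
  fix v x
  have if_deriv: "((\<lambda>x. if j = 0 then 0 else g x) has_derivative (\<lambda>w. if j = 0 then 0 else g' w)) (at x)"
    if "(g has_derivative g') (at x)" for g g' :: "pt \<Rightarrow> complex"
    using that by (cases "j = 0") auto
  have *: "((\<lambda>p. of_nat a * (v$1 * sib (a-1) b j p - (if j = 0 then 0 else cnj (v$2) * sib (a-1) b (j-1) p))
   + of_nat b * (v$2 * sib a (b-1) j p + (if j = 0 then 0 else cnj (v$1) * sib a (b-1) (j-1) p))) has_derivative (\<lambda>w. d2sib a b j v w x)) (at x)"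
    unfolding d2sib_def
    by (intro has_derivative_add has_derivative_diff has_derivative_mult_right
        if_deriv[OF has_derivative_mult_right[OF has_derivative_sib]] has_derivative_sib)
  show "((\<lambda>p. coeff (dgen a b v p) j) has_derivative (\<lambda>w. d2sib a b j v w x)) (at x)"
    unfolding dgen_eq_sib by (rule *)
next
  fix v w show "continuous_on UNIV (d2sib a b j v w)"
    unfolding d2sib_def[abs_def]
    by (cases "j = 0") (auto intro!: continuous_intros continuous_on_dgen)
qed (rule has_derivative_sib)

text \<open>The Laplacian is 4 times the sum of the mixed derivatives in alpha, cnj alpha and in
  beta, cnj beta. With u = alpha - t cnj beta and v = beta + t cnj alpha, these send u^a v^b to +ab
  t u^(a-1) v^(b-1) and -ab t u^(a-1) v^(b-1).\<close>

lemma sib_harmonic: "(\<Sum>v\<leftarrow>real_basis. d2sib a b j v v p) = 0"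
  unfolding d2sib_def dgen_eq_sib
  by (cases j; cases "j - 1") (auto simp: algebra_simps)

text \<open>Euler's identity for the real homogeneity of degree a + b.\<close>

lemma dgen_self: "coeff (dgen a b p p) j = of_nat (a + b) * sib a b j p"
proof -
  have "of_nat a * gen (a-1) b p * [:p$1, - cnj (p$2):] = of_nat a * gen a b p"
    by (cases a) (auto simp: gen_def algebra_simps simp del: mult_pCons_left mult_pCons_right)
  moreover have "of_nat b * gen a (b-1) p * [:p$2, cnj (p$1):] = of_nat b * gen a b p"
    by (cases b) (auto simp: gen_def algebra_simps simp del: mult_pCons_left mult_pCons_right)
  ultimately have "dgen a b p p = of_nat (a+b) * gen a b p"
    unfolding dgen_def by (simp only: of_nat_add distrib_right)
  then show ?thesis by (simp add: sib_def of_nat_poly)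
qed

lemma pt_expand: "x = (\<Sum>v\<leftarrow>real_basis. (x \<bullet> v) *\<^sub>R v)"
  by (simp add: vec_eq_iff inner_axis forall_2 complex_eq_iff)

lemma linear_real_basis:
  assumes "bounded_linear (f :: pt \<Rightarrow> complex)"
  shows "f x = (\<Sum>v\<leftarrow>real_basis. (x \<bullet> v) *\<^sub>R f v)"
proof -
  interpret bounded_linear f by fact
  show ?thesis by (subst pt_expand) (simp add: add scaleR)
qed

lemma inner_real_basis: "x \<bullet> x = (\<Sum>v\<leftarrow>real_basis. (x \<bullet> v)\<^sup>2)"
  by (subst (2) pt_expand) (simp add: inner_add_right power2_eq_square)

lemma norm_pt: "(norm (p::pt))\<^sup>2 = (cmod (p$1))\<^sup>2 + (cmod (p$2))\<^sup>2"
  unfolding power2_norm_eq_inner inner_vec_def by (simp add: sum_2 power2_norm_eq_inner)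

lemma S3_norm: "S3 = sphere 0 1"
proof (rule set_eqI)
  fix p :: pt
  have "p \<in> S3 \<longleftrightarrow> (norm p)\<^sup>2 = 1\<^sup>2" by (simp only: S3_def mem_Collect_eq norm_pt one_power2)
  also have "\<dots> \<longleftrightarrow> norm p = 1" by (rule power2_eq_iff_nonneg) auto
  finally show "p \<in> S3 \<longleftrightarrow> p \<in> sphere 0 1" by simp
qed

lemma scaleR_pt: "c *\<^sub>R (p::pt) = of_real c *s p"
  by (simp add: vec_eq_iff) (simp add: scaleR_conv_of_real)

lemma ext0_sib:
  assumes "q \<noteq> 0"
  shows "ext0 (restrS3 (sib a b j)) q = sib a b j q * inorm q ^ (a + b)"
proof -
  have "q /\<^sub>R norm q \<in> S3" using assms by (simp add: S3_norm)
  then show ?thesis using assms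
    by (simp add: ext0_def restrS3_def scaleR_pt sib_scale inorm_def del: of_real_inverse)
qed

text \<open>For h harmonic and homogeneous of degree k on R^4, the Laplacian of h |x|^(-k) is (-4k +
  k(k+2) - 2k^2) h |x|^(-k-2). The first two terms come from |x|^(-k) alone, the third is the cross
  term, evaluated by Euler's identity.\<close>

lemma C2d_ext0_sib:
  fixes a b j
  defines "k \<equiv> a + b"
  obtains f' f'' where "C2d (-{0}) (ext0 (restrS3 (sib a b j))) f' f''"
    "\<And>x. x \<noteq> 0 \<Longrightarrow> (\<Sum>v\<leftarrow>real_basis. f'' v v x) = - of_nat (k * (k+2)) * (sib a b j x * inorm x ^ (k+2))"
proof -
  note C = C2d_mult[OF C2d_subset[OF C2d_sib[of a b j], of "-{0}"] C2d_inorm_power[of k]]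
  let ?f'' = "(\<lambda>v w x. sib a b j x * (- of_nat k * (of_real (w \<bullet> v) * inorm x ^ (k + 2) - of_nat (k + 2) * of_real (x \<bullet> v) * of_real (x \<bullet> w) * inorm x ^ (k + 4))) +
                 coeff (dgen a b w x) j * (- of_nat k * of_real (x \<bullet> v) * inorm x ^ (k + 2)) +
                 (coeff (dgen a b v x) j * (- of_nat k * of_real (x \<bullet> w) * inorm x ^ (k + 2)) + d2sib a b j v w x * inorm x ^ k))"
  have "C2d (-{0}) (ext0 (restrS3 (sib a b j))) (\<lambda>v x. sib a b j x * (- of_nat k * of_real (x \<bullet> v) * inorm x ^ (k + 2)) + coeff (dgen a b v x) j * inorm x ^ k) ?f''"
    by (rule C2d_transform[OF C]) (auto simp: ext0_sib k_def open_Compl)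
  moreover have "(\<Sum>v\<leftarrow>real_basis. ?f'' v v x) = - of_nat (k * (k+2)) * (sib a b j x * inorm x ^ (k+2))" if "x \<noteq> 0" for x
  proof -
    have euler: "(\<Sum>v\<leftarrow>real_basis. of_real (x \<bullet> v) * coeff (dgen a b v x) j) = of_nat k * sib a b j x"
      using linear_real_basis[OF has_derivative_bounded_linear[OF has_derivative_sib[of a b j x]], of x]
      unfolding dgen_self k_def by (simp add: scaleR_conv_of_real)
    have nn: "(\<Sum>v\<leftarrow>real_basis. complex_of_real (x \<bullet> v) * of_real (x \<bullet> v)) * inorm x ^ 2 = 1"
    proof -
      have "(\<Sum>v\<leftarrow>real_basis. complex_of_real (x \<bullet> v) * of_real (x \<bullet> v)) = of_real (x \<bullet> x)"
        unfolding inner_real_basis[of x] by (simp add: power2_eq_square)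
      also have "\<dots> * inorm x ^ 2 = of_real ((norm x)^2 * (inverse (norm x))^2)"
        unfolding inorm_def power2_norm_eq_inner[symmetric] by simp
      also have "\<dots> = 1" using that by (simp add: power_mult_distrib[symmetric])
      finally show ?thesis .
    qed
    have ii: "(\<Sum>v\<leftarrow>real_basis. complex_of_real (v \<bullet> v)) = 4"
      by (simp add: inner_axis)
    let ?S = "sib a b j x" and ?N = "inorm x"
    have "(\<Sum>v\<leftarrow>real_basis. ?f'' v v x) =
       - of_nat k * ?S * ?N^(k+2) * (\<Sum>v\<leftarrow>real_basis. complex_of_real (v \<bullet> v))
       + of_nat k * of_nat (k+2) * ?S * ?N^(k+2) * ((\<Sum>v\<leftarrow>real_basis. complex_of_real (x \<bullet> v) * of_real (x \<bullet> v)) * ?N ^ 2)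
       - 2 * of_nat k * ?N^(k+2) * (\<Sum>v\<leftarrow>real_basis. of_real (x \<bullet> v) * coeff (dgen a b v x) j)
       + ?N^k * (\<Sum>v\<leftarrow>real_basis. d2sib a b j v v x)"
    proof -
      have gen: "(\<Sum>v\<leftarrow>real_basis. S * (- K * (I v * N2 - K2 * X v * X v * (N2 * M))) + D v * (- K * X v * N2) + (D v * (- K * X v * N2) + E v * N))
        = - K * S * N2 * (\<Sum>v\<leftarrow>real_basis. I v) + K * K2 * S * N2 * ((\<Sum>v\<leftarrow>real_basis. X v * X v) * M)
          - 2 * K * N2 * (\<Sum>v\<leftarrow>real_basis. X v * D v) + N * (\<Sum>v\<leftarrow>real_basis. E v)"
        for S K K2 N N2 M :: complex and I X D E :: "pt \<Rightarrow> complex"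
        by (simp add: algebra_simps)
      have N4: "?N^(k+4) = ?N^(k+2) * ?N^2" by (simp add: power_add eval_nat_numeral)
      show ?thesis
        unfolding N4
        by (rule gen[of ?S "of_nat k" "\<lambda>v. of_real (v \<bullet> v)" "?N^(k+2)" "of_nat (k+2)"
              "\<lambda>v. of_real (x \<bullet> v)" "?N^2" "\<lambda>v. coeff (dgen a b v x) j"
              "\<lambda>v. d2sib a b j v v x" "?N^k"])
    qed
    also have "\<dots> = - of_nat (k * (k+2)) * (?S * ?N ^ (k+2))"
      unfolding euler nn ii sib_harmonic by (simp add: algebra_simps)
    finally show ?thesis .
  qed
  ultimately show ?thesis by (rule that)
qed

section \<open>Green's formula on a spherical shell\<close>

lemma integrable_bounded_support:
  fixes f :: "pt \<Rightarrow> complex"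
  assumes "continuous_on UNIV f" "\<And>x. norm x > R \<Longrightarrow> f x = 0"
  shows "integrable lborel f"
proof -
  have "integrable lborel (\<lambda>x. indicator (cball 0 R) x *\<^sub>R f x)"
    by (intro borel_integrable_compact continuous_on_subset[OF assms(1)]) auto
  moreover have "(\<lambda>x. indicator (cball 0 R) x *\<^sub>R f x) = f"
    using assms(2) by (auto simp: indicator_def fun_eq_iff)
  ultimately show ?thesis by simp
qed

lemma integral_translate:
  fixes f :: "pt \<Rightarrow> complex"
  assumes "continuous_on UNIV f"
  shows "integral\<^sup>L lborel (\<lambda>x. f (x + c)) = integral\<^sup>L lborel f"
proof -
  have "integral\<^sup>L lborel f = integral\<^sup>L (distr lborel borel ((+) c)) f"
    by (simp add: lborel_distr_plus)
  also have "\<dots> = integral\<^sup>L lborel (\<lambda>x. f (c + x))"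
    by (rule integral_distr) (auto intro: borel_measurable_continuous_onI assms)
  finally show ?thesis by (simp add: add.commute)
qed

text \<open>By translation invariance all difference quotients have integral 0.\<close>
lemma integral_directional_derivative:
  fixes X X' :: "pt \<Rightarrow> complex"
  assumes D: "\<And>x. ((\<lambda>t. X (x + t *\<^sub>R v)) has_vector_derivative X' x) (at 0)"
    and cX: "continuous_on UNIV X" and cX': "continuous_on UNIV X'"
    and supp: "\<And>x. norm x > R \<Longrightarrow> X x = 0" "\<And>x. norm x > R \<Longrightarrow> X' x = 0"
  shows "integral\<^sup>L lborel X' = 0"
proof -
  have "bounded (X' ` cball 0 R)"
    by (intro compact_imp_bounded compact_continuous_image continuous_on_subset[OF cX']) auto
  then obtain B where B: "\<And>x. x \<in> cball 0 R \<Longrightarrow> norm (X' x) \<le> B" and "B > 0"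
    unfolding bounded_pos by (metis imageI)
  have B': "norm (X' x) \<le> B" for x
    using B[of x] supp(2)[of x] \<open>B > 0\<close> by (cases "norm x > R") auto
  have Dt: "((\<lambda>t. X (x + t *\<^sub>R v)) has_vector_derivative X' (x + t *\<^sub>R v)) (at t)" for x t
  proof -
    have "((\<lambda>s. X ((x + t *\<^sub>R v) + s *\<^sub>R v)) has_vector_derivative X' (x + t *\<^sub>R v)) (at (t - t))"
      using D[of "x + t *\<^sub>R v"] by simp
    moreover have "((\<lambda>s. s - t) has_vector_derivative 1) (at t)"
      by (auto intro!: derivative_eq_intros)
    ultimately have "(((\<lambda>s. X ((x + t *\<^sub>R v) + s *\<^sub>R v)) \<circ> (\<lambda>s. s - t)) has_vector_derivative 1 *\<^sub>R X' (x + t *\<^sub>R v)) (at t)"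
      by (intro vector_diff_chain_at) auto
    then show ?thesis by (simp add: o_def algebra_simps)
  qed
  define h where "h n = inverse (real (Suc n))" for n
  have h: "0 < h n" "h n \<le> 1" for n by (auto simp: h_def field_simps)
  define s where "s n x = (X (x + h n *\<^sub>R v) - X x) /\<^sub>R h n" for n x
  \<comment> \<open>The mean value theorem bounds every difference quotient by B, and since h n
    \<le> 1 all of them vanish outside the ball of radius |R| + |v|. This is the integrable majorant
    for dominated convergence.\<close>
  have sb: "norm (s n x) \<le> B * indicator (cball 0 (\<bar>R\<bar> + norm v)) x" for n x
  proof (cases "x \<in> cball 0 (\<bar>R\<bar> + norm v)")
    case True
    have "norm (X (x + h n *\<^sub>R v) - X (x + 0 *\<^sub>R v)) \<le> B * norm (h n - 0)"
    proof (rule differentiable_bound[of "{0..h n}" "\<lambda>t. X (x + t *\<^sub>R v)" "\<lambda>t y. y *\<^sub>R X' (x + t *\<^sub>R v)"])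
      fix t assume "t \<in> {0..h n}"
      show "((\<lambda>t. X (x + t *\<^sub>R v)) has_derivative (\<lambda>y. y *\<^sub>R X' (x + t *\<^sub>R v))) (at t within {0..h n})"
        using Dt[of x t] unfolding has_vector_derivative_def by (rule has_derivative_at_withinI)
      show "onorm (\<lambda>y. y *\<^sub>R X' (x + t *\<^sub>R v)) \<le> B"
        using B'[of "x + t *\<^sub>R v"] \<open>B > 0\<close> by (intro onorm_bound) (auto simp: mult.commute[of B] mult_left_mono)
    qed (use h[of n] in auto)
    then have "norm (X (x + h n *\<^sub>R v) - X x) / h n \<le> B"
      using h[of n] by (simp add: divide_le_eq)
    then show ?thesis using True h[of n] by (simp add: s_def divide_inverse mult.commute)
  next
    case False
    have "norm (h n *\<^sub>R v) \<le> norm v" using h[of n] by (simp add: mult_left_le_one_le)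
    then have "norm (x + h n *\<^sub>R v) > R" "norm x > R"
      using False norm_triangle_ineq2[of x "- (h n *\<^sub>R v)"] norm_ge_zero[of v]
      unfolding mem_cball_0 norm_minus_cancel diff_minus_eq_add by linarith+
    then show ?thesis using supp False by (simp add: s_def)
  qed
  have meas: "f \<in> borel_measurable lborel" if "continuous_on UNIV f" for f :: "pt \<Rightarrow> complex"
    using borel_measurable_continuous_onI[OF that] by simp
  have cs: "continuous_on UNIV (\<lambda>x. X (x + c))" for c
    by (intro continuous_on_compose2[OF cX] continuous_intros) auto
  have lim: "(\<lambda>n. integral\<^sup>L lborel (s n)) \<longlonglongrightarrow> integral\<^sup>L lborel X'"
  proof (rule integral_dominated_convergence[where w = "\<lambda>x. B * indicator (cball 0 (\<bar>R\<bar> + norm v)) x"])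
    show "X' \<in> borel_measurable lborel" by (rule meas[OF cX'])
    show "s n \<in> borel_measurable lborel" for n
      unfolding s_def[abs_def] by (intro meas continuous_intros cX cs)
    show "integrable lborel (\<lambda>x. B * indicator (cball 0 (\<bar>R\<bar> + norm v)) x)"
      by (intro integrable_mult_right integrable_real_indicator) (auto simp: emeasure_bounded_finite[unfolded infinity_ennreal_def])
    show "AE x in lborel. (\<lambda>n. s n x) \<longlonglongrightarrow> X' x"
    proof (intro AE_I2)
      fix x
      have "((\<lambda>t. (X (x + t *\<^sub>R v) - X x) /\<^sub>R t) \<longlongrightarrow> X' x) (at 0)"
      proof -
        have lim1: "((\<lambda>t. norm (X (x + t *\<^sub>R v) - X (x + 0 *\<^sub>R v) - (t - 0) *\<^sub>R X' x) / norm (t - 0)) \<longlongrightarrow> 0) (at 0)"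
          using D[of x] unfolding has_vector_derivative_def has_derivative_iff_norm by blast
        have "norm (X (x + t *\<^sub>R v) - X (x + 0 *\<^sub>R v) - (t - 0) *\<^sub>R X' x) / norm (t - 0)
            = norm ((X (x + t *\<^sub>R v) - X x) /\<^sub>R t - X' x)" if "t \<noteq> 0" for t
        proof -
          have "(X (x + t *\<^sub>R v) - X x) /\<^sub>R t - X' x = (X (x + t *\<^sub>R v) - X x - t *\<^sub>R X' x) /\<^sub>R t"
            using that by (simp add: scaleR_diff_right)
          then show ?thesis by (simp add: divide_inverse mult.commute)
        qed
        then have ev: "\<forall>\<^sub>F t in at 0. norm (X (x + t *\<^sub>R v) - X (x + 0 *\<^sub>R v) - (t - 0) *\<^sub>R X' x) / norm (t - 0)
            = norm ((X (x + t *\<^sub>R v) - X x) /\<^sub>R t - X' x)"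
          unfolding eventually_at_filter by (intro always_eventually) blast
        show ?thesis
          by (rule iffD2[OF Lim_null tendsto_norm_zero_cancel[OF Lim_transform_eventually[OF lim1 ev]]])
      qed
      moreover have "filterlim h (at 0) sequentially"
        unfolding filterlim_at h_def using LIMSEQ_inverse_real_of_nat by auto
      ultimately show "(\<lambda>n. s n x) \<longlonglongrightarrow> X' x"
        unfolding s_def by (rule filterlim_compose)
    qed
  qed (use sb in auto)
  have "integral\<^sup>L lborel (s n) = 0" for n
  proof -
    have "integral\<^sup>L lborel (s n) = (integral\<^sup>L lborel (\<lambda>x. X (x + h n *\<^sub>R v)) - integral\<^sup>L lborel X) /\<^sub>R h n"
      unfolding s_def
    proof (subst integral_scaleR_right, subst Bochner_Integration.integral_diff)
      show "integrable lborel X" by (rule integrable_bounded_support[OF cX supp(1)])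
      show "integrable lborel (\<lambda>x. X (x + h n *\<^sub>R v))"
      proof (rule integrable_bounded_support[OF cs])
        fix x :: pt assume "norm x > \<bar>R\<bar> + norm (h n *\<^sub>R v)"
        then have "norm (x + h n *\<^sub>R v) > R"
          using norm_triangle_ineq2[of x "- (h n *\<^sub>R v)"] by auto
        then show "X (x + h n *\<^sub>R v) = 0" by (rule supp)
      qed
    qed auto
    also have "\<dots> = 0" by (simp add: integral_translate[OF cX])
    finally show ?thesis .
  qed
  with lim show ?thesis by (simp add: LIMSEQ_const_iff)
qed

text \<open>A function of |x|^2 alone, so that its gradient at x is the multiple
  \<open>dbump\<close> of x. Squaring the positive part makes it continuously differentiable across
  the boundary of \<open>annulus\<close>.\<close>

definition bump :: "real \<Rightarrow> pt \<Rightarrow> real" where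
  "bump \<delta> x = (max 0 (\<delta> - (x \<bullet> x - 1)\<^sup>2))\<^sup>2"

definition dbump :: "real \<Rightarrow> pt \<Rightarrow> real" where
  "dbump \<delta> x = - 8 * max 0 (\<delta> - (x \<bullet> x - 1)\<^sup>2) * (x \<bullet> x - 1)"

definition annulus :: "real \<Rightarrow> pt set" where
  "annulus \<delta> = {x. (x \<bullet> x - 1)\<^sup>2 \<le> \<delta>}"

lemma has_real_derivative_pos_part_square:
  "((\<lambda>s. (max 0 s)\<^sup>2) has_real_derivative 2 * max 0 s) (at (s::real))"
proof -
  consider "s > 0" | "s < 0" | "s = 0" by linarith
  then show ?thesis
  proof cases
    case 1
    have "((\<lambda>s. s\<^sup>2) has_real_derivative 2 * max 0 s) (at s)"
      using 1 by (auto intro!: derivative_eq_intros)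
    then show ?thesis
      by (rule has_field_derivative_transform_within_open[of _ _ _ "{0<..}"]) (use 1 in auto)
  next
    case 2
    have "((\<lambda>s. 0) has_real_derivative 2 * max 0 s) (at s)"
      using 2 by (auto intro!: derivative_eq_intros)
    then show ?thesis
      by (rule has_field_derivative_transform_within_open[of _ _ _ "{..<0}"]) (use 2 in auto)
  next
    case 3
    have "((\<lambda>y. (max 0 y)\<^sup>2 / y) \<longlongrightarrow> 0) (at (0::real))"
    proof (rule tendsto_sandwich[of "\<lambda>y. - \<bar>y\<bar>" _ _ "\<lambda>y. \<bar>y\<bar>"])
      show "\<forall>\<^sub>F y in at (0::real). - \<bar>y\<bar> \<le> (max 0 y)\<^sup>2 / y" "\<forall>\<^sub>F y in at (0::real). (max 0 y)\<^sup>2 / y \<le> \<bar>y\<bar>"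
        by (auto simp: max_def power2_eq_square intro!: always_eventually)
      show "((\<lambda>y. - \<bar>y\<bar>) \<longlongrightarrow> 0) (at (0::real))" "((\<lambda>y. \<bar>y\<bar>) \<longlongrightarrow> 0) (at (0::real))"
        by (auto intro!: tendsto_eq_intros)
    qed
    then show ?thesis using 3 by (simp add: has_field_derivative_iff)
  qed
qed

lemma has_derivative_bump:
  "(bump \<delta> has_derivative (\<lambda>v. dbump \<delta> x * (x \<bullet> v))) (at x)"
proof -
  have "((\<lambda>x. \<delta> - (x \<bullet> x - 1)\<^sup>2) has_derivative (\<lambda>v. - 4 * (x \<bullet> x - 1) * (x \<bullet> v))) (at x)"
    by (auto intro!: derivative_eq_intros simp: inner_commute fun_eq_iff algebra_simps)
  from has_derivative_compose[OF this has_real_derivative_pos_part_square[unfolded has_field_derivative_def]]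
  show ?thesis unfolding bump_def[abs_def] dbump_def
    by (rule has_derivative_eq_rhs) (auto simp: fun_eq_iff algebra_simps)
qed

lemma bump_0: "x \<notin> annulus \<delta> \<Longrightarrow> bump \<delta> x = 0" "x \<notin> annulus \<delta> \<Longrightarrow> dbump \<delta> x = 0"
  by (auto simp: annulus_def bump_def dbump_def max_def)

lemma closed_annulus: "closed (annulus \<delta>)"
  unfolding annulus_def by (intro closed_Collect_le continuous_intros)

lemma annulus_norm:
  assumes "\<delta> < 1" "x \<in> annulus \<delta>" shows "norm x \<le> 2" "x \<noteq> 0"
proof -
  have *: "(x \<bullet> x - 1)\<^sup>2 < 1" using assms by (simp add: annulus_def)
  then have "\<bar>x \<bullet> x - 1\<bar> < 1" by (simp add: abs_square_less_1)
  then have "(norm x)\<^sup>2 \<le> 2\<^sup>2" by (simp add: power2_norm_eq_inner)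
  then show "norm x \<le> 2" by (rule power2_le_imp_le) simp
  show "x \<noteq> 0" using * by auto
qed

lemma continuous_bump: "continuous_on U (bump \<delta>)" "continuous_on U (dbump \<delta>)"
  unfolding bump_def[abs_def] dbump_def[abs_def] by (intro continuous_intros)+

text \<open>The factors multiplied by the weight are controlled on U only, but the product vanishes
  off the closed annulus inside U, so continuity glues over the open sets U and the complement of
  the annulus.\<close>

lemma continuous_on_glue:
  fixes f :: "pt \<Rightarrow> complex"
  assumes "open U" "annulus \<delta> \<subseteq> U" "continuous_on U f" "\<And>x. x \<notin> annulus \<delta> \<Longrightarrow> f x = 0"
  shows "continuous_on UNIV f"
proof -
  have "continuous_on (- annulus \<delta>) f"
    by (rule continuous_on_eq[OF continuous_on_const[of _ 0]]) (use assms in auto)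
  then have "continuous_on (U \<union> - annulus \<delta>) f"
    using assms closed_annulus[of \<delta>] by (intro continuous_on_open_Un) (auto simp: open_Compl)
  moreover have "U \<union> - annulus \<delta> = UNIV" using assms by auto
  ultimately show ?thesis by simp
qed

lemma integrable_bump:
  fixes f :: "pt \<Rightarrow> complex"
  assumes "open U" "annulus \<delta> \<subseteq> U" "\<delta> < 1" "continuous_on U f" "\<And>x. x \<notin> annulus \<delta> \<Longrightarrow> f x = 0"
  shows "integrable lborel f"
  using annulus_norm(1)[OF assms(3)] assms(5)
  by (intro integrable_bounded_support[of _ 2] continuous_on_glue[OF assms(1,2,4,5)]) force+

text \<open>The integrand is the divergence of bump * (g grad u - u grad g). The products of first
  derivatives of u and g cancel, and the terms with the gradient of \<open>bump\<close> contain only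
  radial derivatives of u and g, which vanish.\<close>

lemma green:
  assumes U: "open U" "annulus \<delta> \<subseteq> U" "\<delta> < 1"
    and u: "C2d U u u' u''" "\<And>x. x \<in> U \<Longrightarrow> u' x x = 0"
    and g: "C2d U g g' g''" "\<And>x. x \<in> U \<Longrightarrow> g' x x = 0"
  shows "integral\<^sup>L lborel (\<lambda>x. of_real (bump \<delta> x) *
     (g x * (\<Sum>v\<leftarrow>real_basis. u'' v v x) - u x * (\<Sum>v\<leftarrow>real_basis. g'' v v x))) = 0"
proof -
  define X where "X v x = of_real (bump \<delta> x) * (g x * u' v x - u x * g' v x)" for v x
  define Y where "Y v x = of_real (dbump \<delta> x * (x \<bullet> v)) * (g x * u' v x - u x * g' v x) +
      of_real (bump \<delta> x) * (g x * u'' v v x - u x * g'' v v x)" for v x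
  have zX: "X v x = 0" "Y v x = 0" if "x \<notin> annulus \<delta>" for v x
    using bump_0[OF that] by (auto simp: X_def Y_def)
  note cu = C2dD(3-5)[OF u(1)] and cg = C2dD(3-5)[OF g(1)]
  have cX: "continuous_on U (X v)" for v
    unfolding X_def[abs_def] by (intro continuous_intros continuous_bump cu cg)
  have cY: "continuous_on U (Y v)" for v
    unfolding Y_def[abs_def] by (intro continuous_intros continuous_bump cu cg)
  have R: "x \<notin> annulus \<delta>" if "norm x > 2" for x
    using annulus_norm(1)[OF U(3), of x] that by auto
  have D: "((\<lambda>t. X v (x + t *\<^sub>R v)) has_vector_derivative Y v x) (at 0)" for v x
  proof -
    have "\<exists>X'. (X v has_derivative X') (at x) \<and> X' v = Y v x"
    proof (cases "x \<in> U")
      case True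
      have b: "((\<lambda>x. complex_of_real (bump \<delta> x)) has_derivative (\<lambda>w. complex_of_real (dbump \<delta> x * (x \<bullet> w)))) (at x)"
        by (rule has_derivative_of_real[OF has_derivative_bump])
      note d = has_derivative_mult[OF b has_derivative_diff[OF
         has_derivative_mult[OF C2dD(1)[OF g(1) True] C2dD(2)[OF u(1) True, of v]]
         has_derivative_mult[OF C2dD(1)[OF u(1) True] C2dD(2)[OF g(1) True, of v]]]]
      have "X v = (\<lambda>x. of_real (bump \<delta> x) * (g x * u' v x - u x * g' v x))"
        by (simp add: X_def fun_eq_iff)
      then show ?thesis
        using d by (intro exI conjI, simp) (simp add: Y_def algebra_simps)
    next
      case False
      then have xa: "x \<in> - annulus \<delta>" using U by auto
      have "(X v has_derivative (\<lambda>w. 0)) (at x)"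
        by (rule has_derivative_transform_within_open[OF has_derivative_const[of 0] _ xa])
           (use closed_annulus[of \<delta>] zX in \<open>auto simp: open_Compl\<close>)
      then show ?thesis using zX xa by (intro exI[of _ "\<lambda>w. 0"]) auto
    qed
    then obtain X' where X': "(X v has_derivative X') (at x)" "X' v = Y v x" by blast
    show ?thesis using X'(2) has_vector_derivative_line[OF X'(1), of v] by simp
  qed
  have "integral\<^sup>L lborel (Y v) = 0" for v
    by (rule integral_directional_derivative[of "X v" v "Y v" 2])
       (use D zX R in \<open>auto intro!: continuous_on_glue[OF U(1,2)] cX cY\<close>)
  moreover have "integrable lborel (Y v)" for v
    by (rule integrable_bump[OF U cY zX(2)])
  ultimately have 0: "integral\<^sup>L lborel (\<lambda>x. \<Sum>v\<leftarrow>real_basis. Y v x) = 0"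
    by simp
  have "(\<Sum>v\<leftarrow>real_basis. Y v x) = of_real (bump \<delta> x) *
     (g x * (\<Sum>v\<leftarrow>real_basis. u'' v v x) - u x * (\<Sum>v\<leftarrow>real_basis. g'' v v x))" for x
  proof (cases "x \<in> U")
    case True
    have r: "(\<Sum>v\<leftarrow>real_basis. (x \<bullet> v) *\<^sub>R u' v x) = 0" "(\<Sum>v\<leftarrow>real_basis. (x \<bullet> v) *\<^sub>R g' v x) = 0"
      using linear_real_basis[OF has_derivative_bounded_linear[OF C2dD(1)[OF u(1) True]], of x] u(2)[OF True]
        linear_real_basis[OF has_derivative_bounded_linear[OF C2dD(1)[OF g(1) True]], of x] g(2)[OF True] by auto
    have gen: "(\<Sum>v\<leftarrow>real_basis. c * I v * (G * A v - H * B v) + d * (G * AA v - H * BB v))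
      = c * (G * (\<Sum>v\<leftarrow>real_basis. I v * A v) - H * (\<Sum>v\<leftarrow>real_basis. I v * B v))
        + d * (G * (\<Sum>v\<leftarrow>real_basis. AA v) - H * (\<Sum>v\<leftarrow>real_basis. BB v))"
      for c d G H :: complex and I A B AA BB
      by (simp add: algebra_simps)
    show ?thesis
      using r unfolding Y_def of_real_mult gen scaleR_conv_of_real by simp
  next
    case False
    then have "x \<notin> annulus \<delta>" using U by auto
    then show ?thesis using zX(2) bump_0 by simp
  qed
  with 0 show ?thesis by simp
qed

section \<open>Density of the siblings\<close>

lemma gen_Suc1: "gen (Suc a) b p = [:p$1, - cnj (p$2):] * gen a b p"
  and gen_Suc2: "gen a (Suc b) p = [:p$2, cnj (p$1):] * gen a b p"
  by (simp_all add: gen_def mult_ac del: mult_pCons_left mult_pCons_right)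

lemma S3_iff: "q \<in> S3 \<longleftrightarrow> q$1 * cnj (q$1) + q$2 * cnj (q$2) = 1"
proof -
  have "q$1 * cnj (q$1) + q$2 * cnj (q$2) = of_real ((cmod (q$1))\<^sup>2 + (cmod (q$2))\<^sup>2)"
    by (simp only: complex_norm_square of_real_add)
  then show ?thesis unfolding S3_def mem_Collect_eq by (simp only: of_real_eq_1_iff)
qed

text \<open>Substituting this relation into the t-derivatives of u^(a+1) v^b and u^a v^(b+1), where u and v are
  the two linear factors of gen, gives the recurrences cnj2_sib and cnj1_sib.\<close>
lemma gen_linear_relation:
  assumes "p \<in> S3"
  shows "smult (cnj (p$1)) (gen (Suc a) b p) + smult (cnj (p$2)) (gen a (Suc b) p) = gen a b p"
proof -
  have "smult (cnj (p$1)) [:p$1, - cnj (p$2):] + smult (cnj (p$2)) [:p$2, cnj (p$1):] = 1"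
    using assms unfolding S3_iff by (simp add: algebra_simps one_pCons)
  then have "(smult (cnj (p$1)) [:p$1, - cnj (p$2):] + smult (cnj (p$2)) [:p$2, cnj (p$1):]) * gen a b p = gen a b p"
    by simp
  then show ?thesis
    unfolding gen_Suc1 gen_Suc2 distrib_right mult_smult_left .
qed

text \<open>The two terms have degrees a + b - 1 and a + b + 1: a coordinate times a spherical
  harmonic splits into the adjacent degrees.\<close>

lemma cnj2_sib:
  assumes "p \<in> S3"
  shows "of_nat (a+b+1) * (cnj (p$2) * sib a b j p) = of_nat b * sib a (b-1) j p - of_nat (Suc j) * sib (Suc a) b (Suc j) p"
proof -
  have "of_nat (Suc j) * sib (Suc a) b (Suc j) p = coeff (pderiv (gen (Suc a) b p)) j"
    by (simp add: coeff_pderiv sib_def)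
  also have "\<dots> = - of_nat (Suc a) * cnj (p$2) * sib a b j p + of_nat b * cnj (p$1) * sib (Suc a) (b-1) j p"
    by (simp add: pderiv_gen sib_def)
  also have "of_nat b * cnj (p$1) * sib (Suc a) (b-1) j p = of_nat b * (sib a (b-1) j p - cnj (p$2) * sib a b j p)"
  proof (cases b)
    case (Suc b')
    have "cnj (p$1) * sib (Suc a) b' j p = sib a b' j p - cnj (p$2) * sib a (Suc b') j p"
      using arg_cong[OF gen_linear_relation[OF assms, of a b'], of "\<lambda>q. coeff q j"]
      by (simp add: sib_def algebra_simps)
    then show ?thesis by (simp add: Suc mult.assoc)
  qed simp
  finally show ?thesis by (simp add: algebra_simps)
qed

lemma cnj1_sib:
  assumes "p \<in> S3"
  shows "of_nat (a+b+1) * (cnj (p$1) * sib a b j p) = of_nat a * sib (a-1) b j p + of_nat (Suc j) * sib a (Suc b) (Suc j) p"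
proof -
  have "of_nat (Suc j) * sib a (Suc b) (Suc j) p = coeff (pderiv (gen a (Suc b) p)) j"
    by (simp add: coeff_pderiv sib_def)
  also have "\<dots> = - of_nat a * cnj (p$2) * sib (a-1) (Suc b) j p + of_nat (Suc b) * cnj (p$1) * sib a b j p"
    by (simp add: pderiv_gen sib_def)
  also have "- of_nat a * cnj (p$2) * sib (a-1) (Suc b) j p = - of_nat a * (sib (a-1) b j p - cnj (p$1) * sib a b j p)"
  proof (cases a)
    case (Suc a')
    have "cnj (p$2) * sib a' (Suc b) j p = sib a' b j p - cnj (p$1) * sib (Suc a') b j p"
      using arg_cong[OF gen_linear_relation[OF assms, of a' b], of "\<lambda>q. coeff q j"]
      by (simp add: sib_def algebra_simps)
    then show ?thesis by (simp only: Suc mult.assoc minus_mult_left[symmetric] diff_Suc_1)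
  qed simp
  finally show ?thesis by (simp add: algebra_simps)
qed

text \<open>The span of the siblings of all degrees, seen as functions on S3. The rule
  \<open>cong\<close> is essential, since the recurrences for the conjugate coordinates hold on S3
  only.\<close>

inductive sibspan :: "(pt \<Rightarrow> complex) \<Rightarrow> bool" where
  base: "sibspan (\<lambda>p. c * sib a b j p)"
| add: "sibspan f \<Longrightarrow> sibspan g \<Longrightarrow> sibspan (\<lambda>p. f p + g p)"
| cong: "sibspan f \<Longrightarrow> (\<And>p. p \<in> S3 \<Longrightarrow> f p = g p) \<Longrightarrow> sibspan g"

lemma sibspan_cmult: "sibspan f \<Longrightarrow> sibspan (\<lambda>p. c * f p)"
proof (induction rule: sibspan.induct)
  case (base d a b j)
  show ?case using sibspan.base[of "c * d" a b j] by (simp add: mult.assoc)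
next
  case (add f g)
  show ?case using sibspan.add[OF add.IH] by (simp add: distrib_left)
next
  case (cong f g)
  show ?case by (rule sibspan.cong[OF cong.IH]) (simp add: cong.hyps)
qed

lemma sibspan_mult_gen:
  assumes "\<And>a b j. sibspan (\<lambda>p. m p * sib a b j p)" "sibspan f"
  shows "sibspan (\<lambda>p. m p * f p)"
  using assms(2)
proof (induction rule: sibspan.induct)
  case (base c a b j)
  show ?case using sibspan_cmult[OF assms(1)[of a b j], of c] by (simp add: mult_ac)
next
  case (add f g)
  show ?case using sibspan.add[OF add.IH] by (simp add: distrib_left)
next
  case (cong f g)
  show ?case by (rule sibspan.cong[OF cong.IH]) (simp add: cong.hyps)
qed

lemma sibspan_cnj2: "sibspan f \<Longrightarrow> sibspan (\<lambda>p. cnj (p$2) * f p)"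
proof (rule sibspan_mult_gen)
  fix a b j
  have "sibspan (\<lambda>p. inverse (of_nat (a+b+1)) * (of_nat b * sib a (b-1) j p + (- of_nat (Suc j)) * sib (Suc a) b (Suc j) p))"
    by (intro sibspan_cmult sibspan.add sibspan.base)
  then show "sibspan (\<lambda>p. cnj (p$2) * sib a b j p)"
  proof (rule sibspan.cong)
    fix p assume "p \<in> S3"
    have "of_nat b * sib a (b-1) j p + (- of_nat (Suc j)) * sib (Suc a) b (Suc j) p = of_nat (a+b+1) * (cnj (p$2) * sib a b j p)"
      unfolding cnj2_sib[OF \<open>p \<in> S3\<close>] by (simp only: minus_mult_left[symmetric] diff_conv_add_uminus)
    then show "inverse (of_nat (a+b+1)) * (of_nat b * sib a (b-1) j p + (- of_nat (Suc j)) * sib (Suc a) b (Suc j) p) = cnj (p$2) * sib a b j p"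
      by (simp only: mult.assoc[symmetric]) (simp del: of_nat_add of_nat_Suc)
  qed
qed

lemma sibspan_cnj1: "sibspan f \<Longrightarrow> sibspan (\<lambda>p. cnj (p$1) * f p)"
proof (rule sibspan_mult_gen)
  fix a b j
  have "sibspan (\<lambda>p. inverse (of_nat (a+b+1)) * (of_nat a * sib (a-1) b j p + of_nat (Suc j) * sib a (Suc b) (Suc j) p))"
    by (intro sibspan_cmult sibspan.add sibspan.base)
  then show "sibspan (\<lambda>p. cnj (p$1) * sib a b j p)"
  proof (rule sibspan.cong)
    fix p assume "p \<in> S3"
    then show "inverse (of_nat (a+b+1)) * (of_nat a * sib (a-1) b j p + of_nat (Suc j) * sib a (Suc b) (Suc j) p) = cnj (p$1) * sib a b j p"
      unfolding cnj1_sib[OF \<open>p \<in> S3\<close>, symmetric] by (simp add: field_simps del: of_nat_add of_nat_Suc)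
  qed
qed

lemma coeff_linear_mult:
  "coeff ([:c, d:] * Q) j = c * coeff Q j + (if j = 0 then 0 else d * coeff Q (j - 1))" for c d :: complex
  by (cases j) auto

text \<open>The coefficient of t^j in \<open>gen_Suc1\<close> gives alpha * sib a b j = sib (Suc a)
  b j + cnj beta * sib a b (j - 1), which reduces the claim to multiplication by cnj beta.\<close>

lemma sibspan_1: "sibspan f \<Longrightarrow> sibspan (\<lambda>p. p$1 * f p)"
proof (rule sibspan_mult_gen)
  fix a b j
  have "sibspan (\<lambda>p. 1 * sib (Suc a) b j p + (if j = 0 then 0 else 1) * (cnj (p$2) * (1 * sib a b (j-1) p)))"
    by (intro sibspan_cmult sibspan.add sibspan.base sibspan_cnj2)
  then show "sibspan (\<lambda>p. p$1 * sib a b j p)"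
    by (rule sibspan.cong) (auto simp: sib_def gen_Suc1 coeff_linear_mult simp del: mult_pCons_left)
qed

lemma sibspan_2: "sibspan f \<Longrightarrow> sibspan (\<lambda>p. p$2 * f p)"
proof (rule sibspan_mult_gen)
  fix a b j
  have "sibspan (\<lambda>p. 1 * sib a (Suc b) j p + (if j = 0 then 0 else -1) * (cnj (p$1) * (1 * sib a b (j-1) p)))"
    by (intro sibspan_cmult sibspan.add sibspan.base sibspan_cnj1)
  then show "sibspan (\<lambda>p. p$2 * sib a b j p)"
    by (rule sibspan.cong) (auto simp: sib_def gen_Suc2 coeff_linear_mult simp del: mult_pCons_left)
qed

lemma sibspan_real_polynomial:
  "real_polynomial_function g \<Longrightarrow> sibspan f \<Longrightarrow> sibspan (\<lambda>p. of_real (g p) * f p)"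
proof (induction arbitrary: f rule: real_polynomial_function.induct)
  case (linear g)
  interpret bounded_linear g by fact
  \<comment> \<open>These are the coefficients of the real-linear g after substituting x = (alpha +
    cnj alpha)/2 and y = (alpha - cnj alpha)/(2i), and likewise for beta.\<close>
  let ?A = "of_real (g (axis 1 1)) / 2 :: complex" and ?B = "of_real (g (axis 1 \<i>)) / 2 :: complex"
    and ?C = "of_real (g (axis 2 1)) / 2 :: complex" and ?D = "of_real (g (axis 2 \<i>)) / 2 :: complex"
  have "sibspan (\<lambda>p. ((?A - \<i> * ?B) * (p$1 * f p) + (?A + \<i> * ?B) * (cnj (p$1) * f p))
      + ((?C - \<i> * ?D) * (p$2 * f p) + (?C + \<i> * ?D) * (cnj (p$2) * f p)))"
    by (intro sibspan.add sibspan_cmult sibspan_1 sibspan_2 sibspan_cnj1 sibspan_cnj2 linear.prems)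
  moreover have "((?A - \<i> * ?B) * (p$1 * f p) + (?A + \<i> * ?B) * (cnj (p$1) * f p))
      + ((?C - \<i> * ?D) * (p$2 * f p) + (?C + \<i> * ?D) * (cnj (p$2) * f p)) = of_real (g p) * f p" for p
  proof -
    have e: "g p = Re (p$1) * g (axis 1 1) + Im (p$1) * g (axis 1 \<i>) + Re (p$2) * g (axis 2 1) + Im (p$2) * g (axis 2 \<i>)"
      by (subst pt_expand) (simp add: add scaleR inner_axis)
    have "((?A - \<i> * ?B) * p$1 + (?A + \<i> * ?B) * cnj (p$1)) + ((?C - \<i> * ?D) * p$2 + (?C + \<i> * ?D) * cnj (p$2)) = of_real (g p)"
      unfolding e by (simp add: complex_eq_iff algebra_simps)
    then show ?thesis by (simp only: mult.assoc[symmetric] distrib_right[symmetric])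
  qed
  ultimately show ?case by simp
next
  case (const c)
  then show ?case by (rule sibspan_cmult)
next
  case (add g h)
  show ?case using sibspan.add[OF add.IH(1)[OF add.prems] add.IH(2)[OF add.prems]] by (simp add: distrib_right)
next
  case (mult g h)
  show ?case using mult.IH(1)[OF mult.IH(2)[OF mult.prems]] by (simp add: mult.assoc)
qed

lemma sibspan_dense:
  assumes "continuous_on S3 F" "e > 0"
  obtains f where "sibspan f" "\<And>p. p \<in> S3 \<Longrightarrow> cmod (F p - f p) \<le> e"
proof -
  have S3: "compact S3" by (simp add: S3_norm)
  obtain g where g: "real_polynomial_function g" "\<And>p. p \<in> S3 \<Longrightarrow> \<bar>Re (F p) - g p\<bar> < e/2"
    using Stone_Weierstrass_real_polynomial_function[OF S3, of "\<lambda>p. Re (F p)" "e/2"] assms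
    by (auto intro: continuous_intros)
  obtain h where h: "real_polynomial_function h" "\<And>p. p \<in> S3 \<Longrightarrow> \<bar>Im (F p) - h p\<bar> < e/2"
    using Stone_Weierstrass_real_polynomial_function[OF S3, of "\<lambda>p. Im (F p)" "e/2"] assms
    by (auto intro: continuous_intros)
  show ?thesis
  proof (rule that)
    \<comment> \<open>\<open>sib 0 0 0\<close> is the constant 1, from which multiplication reaches
      every polynomial.\<close>
    show "sibspan (\<lambda>p. of_real (g p) * (1 * sib 0 0 0 p) + \<i> * (of_real (h p) * (1 * sib 0 0 0 p)))"
      by (intro sibspan.add sibspan_cmult sibspan_real_polynomial g h sibspan.base)
    fix p assume "p \<in> S3"
    have "cmod (F p - (of_real (g p) + \<i> * of_real (h p))) \<le> \<bar>Re (F p) - g p\<bar> + \<bar>Im (F p) - h p\<bar>"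
      using cmod_le[of "F p - (of_real (g p) + \<i> * of_real (h p))"] by simp
    also have "\<dots> \<le> e" using g(2)[OF \<open>p \<in> S3\<close>] h(2)[OF \<open>p \<in> S3\<close>] by simp
    finally show "cmod (F p - (of_real (g p) * (1 * sib 0 0 0 p) + \<i> * (of_real (h p) * (1 * sib 0 0 0 p)))) \<le> e"
      by (simp add: sib_0)
  qed
qed

section \<open>Eigenfunctions are combinations of siblings\<close>

text \<open>Vanishing radial derivative stands for constancy along rays and makes sense on any open
  U. The Laplacian of a function constant along rays scales like |x|^(-2), whence the factor
  \<open>inorm x ^ 2\<close>.\<close>

definition eigen :: "pt set \<Rightarrow> nat \<Rightarrow> (pt \<Rightarrow> complex) \<Rightarrow> bool" where
  "eigen U k u \<longleftrightarrow> (\<exists>u' u''. C2d U u u' u'' \<and> (\<forall>x\<in>U. u' x x = 0) \<and>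
     (\<forall>x\<in>U. (\<Sum>v\<leftarrow>real_basis. u'' v v x) = - of_nat (k * (k + 2)) * (u x * inorm x ^ 2)))"

lemma eigen_subset: "eigen U k u \<Longrightarrow> V \<subseteq> U \<Longrightarrow> eigen V k u"
  unfolding eigen_def by (meson C2d_subset subsetD)

lemma eigen_continuous: "eigen U k u \<Longrightarrow> continuous_on U u"
  unfolding eigen_def by (auto dest: C2dD(4))

lemma eigen_cnj: assumes "eigen U k u" shows "eigen U k (\<lambda>x. cnj (u x))"
proof -
  obtain u' u'' where u: "C2d U u u' u''" "\<forall>x\<in>U. u' x x = 0"
     "\<forall>x\<in>U. (\<Sum>v\<leftarrow>real_basis. u'' v v x) = - of_nat (k * (k + 2)) * (u x * inorm x ^ 2)"
    using assms unfolding eigen_def by blast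
  have "(\<Sum>v\<leftarrow>real_basis. cnj (u'' v v x)) = - of_nat (k * (k + 2)) * (cnj (u x) * inorm x ^ 2)" if "x \<in> U" for x
  proof -
    have "(\<Sum>v\<leftarrow>real_basis. cnj (u'' v v x)) = cnj (\<Sum>v\<leftarrow>real_basis. u'' v v x)" by simp
    also have "\<dots> = cnj (- of_nat (k * (k + 2)) * (u x * inorm x ^ 2))" using u(3) that by (simp only:)
    finally show ?thesis by (simp add: inorm_def)
  qed
  then show ?thesis unfolding eigen_def using C2d_cnj[OF u(1)] u(2)
    by (intro exI[of _ "\<lambda>v x. cnj (u' v x)"] exI[of _ "\<lambda>v w x. cnj (u'' v w x)"]) auto
qed

lemma ext0_scale: "c > 0 \<Longrightarrow> ext0 F (c *\<^sub>R x) = ext0 F x"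
  by (simp add: ext0_def field_simps)

text \<open>The eigenvalue equation is given on S3 only. Dilation by c = |x| fixes
  \<open>ext0 F\<close> and multiplies second derivatives by c^2, which moves the equation from x /
  c to x.\<close>

lemma eigen_ext0:
  assumes U: "open U" "S3 \<subseteq> U" "0 \<notin> U" and F: "C2_on U (ext0 F)"
    and lap: "\<And>p. p \<in> S3 \<Longrightarrow> lapS3 F p = - of_nat (k * (k + 2)) * F p"
  shows "eigen U k (ext0 F)"
proof -
  obtain u' u'' where u: "C2d U (ext0 F) u' u''"
    using C2_on_imp_C2d[OF F] .
  have rad: "u' x x = 0" if "x \<in> U" for x
  proof -
    have "((\<lambda>t::real. ext0 F x) has_vector_derivative 0) (at 0)" by simp
    then have "((\<lambda>t::real. ext0 F (x + t *\<^sub>R x)) has_vector_derivative 0) (at 0)"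
    proof (rule has_vector_derivative_transform_within_open[of _ _ _ "{-1<..}"])
      fix t :: real assume "t \<in> {-1<..}"
      then show "ext0 F x = ext0 F (x + t *\<^sub>R x)"
        using ext0_scale[of "1 + t" F x] by (simp add: algebra_simps)
    qed auto
    then have "pd x (ext0 F) x = 0" unfolding pd_def by (rule vector_derivative_at)
    then show ?thesis using pd_C2d[OF u that] by simp
  qed
  have "(\<Sum>v\<leftarrow>real_basis. u'' v v x) = - of_nat (k * (k + 2)) * (ext0 F x * inorm x ^ 2)" if x: "x \<in> U" for x
  proof -
    define c where "c = norm x"
    define p where "p = x /\<^sub>R c"
    have c: "c > 0" using x U by (auto simp: c_def)
    have p: "p \<in> S3" using c by (simp add: p_def S3_norm c_def)
    have xp: "x = c *\<^sub>R p" using c by (simp add: p_def)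
    \<comment> \<open>On V both y and c y lie in U, so the extension and its dilate can be
      differentiated together near p.\<close>
    define V where "V = U \<inter> (\<lambda>y. c *\<^sub>R y) -` U"
    have V: "open V" unfolding V_def
      using U by (intro open_Int open_vimage continuous_intros)
    have pV: "p \<in> V" using U p x xp by (auto simp: V_def)
    have sc: "((\<lambda>y. c *\<^sub>R y) has_derivative (\<lambda>w. c *\<^sub>R w)) (at y)" for y :: pt
      by (auto intro!: derivative_eq_intros)
    have lin: "bounded_linear (\<lambda>w. u' w y)" "bounded_linear (\<lambda>w. u'' v w y)" if "y \<in> U" for v y
      using C2dD(1,2)[OF u that] by (auto dest: has_derivative_bounded_linear)
    have C: "C2d V (\<lambda>y. ext0 F (c *\<^sub>R y)) (\<lambda>v y. c *\<^sub>R u' v (c *\<^sub>R y)) (\<lambda>v w y. c *\<^sub>R c *\<^sub>R u'' v w (c *\<^sub>R y))"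
      unfolding C2d_def
    proof (intro conjI allI ballI)
      fix y assume y: "y \<in> V"
      then have cy: "c *\<^sub>R y \<in> U" by (auto simp: V_def)
      show "((\<lambda>y. ext0 F (c *\<^sub>R y)) has_derivative (\<lambda>v. c *\<^sub>R u' v (c *\<^sub>R y))) (at y)"
        using has_derivative_compose[OF sc C2dD(1)[OF u cy]] linear_simps(5)[OF lin(1)[OF cy]] by simp
      fix v
      show "((\<lambda>y. c *\<^sub>R u' v (c *\<^sub>R y)) has_derivative (\<lambda>w. c *\<^sub>R c *\<^sub>R u'' v w (c *\<^sub>R y))) (at y)"
        using has_derivative_scaleR_right[OF has_derivative_compose[OF sc C2dD(2)[OF u cy, of v]], of c] linear_simps(5)[OF lin(2)[OF cy]] by simp
    next
      fix v w
      show "continuous_on V (\<lambda>y. c *\<^sub>R c *\<^sub>R u'' v w (c *\<^sub>R y))"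
        by (intro continuous_intros continuous_on_compose2[OF C2dD(3)[OF u, of v w]]) (auto simp: V_def)
    qed
    have "(\<lambda>y. ext0 F (c *\<^sub>R y)) = ext0 F" using ext0_scale[OF c] by auto
    then have "lap4 (ext0 F) p = (\<Sum>v\<leftarrow>real_basis. c *\<^sub>R c *\<^sub>R u'' v v x)"
      using lap4_C2d[OF C V pV] by (simp add: xp)
    also have "\<dots> = of_real (c^2) * (\<Sum>v\<leftarrow>real_basis. u'' v v x)"
      by (simp add: scaleR_conv_of_real power2_eq_square algebra_simps)
    finally have "of_real (c^2) * (\<Sum>v\<leftarrow>real_basis. u'' v v x) = - of_nat (k * (k + 2)) * F p"
      using lap[OF p] unfolding lapS3_def by (simp only:)
    moreover have "F p = ext0 F x" by (simp add: ext0_def p_def c_def)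
    moreover have "of_real (c^2) * inorm x ^ 2 = 1"
      using c unfolding inorm_def c_def[symmetric] by (simp flip: power_mult_distrib)
    moreover have "S = - L * (f * I)" if "C * S = - L * f" "C * I = 1" for C S L f I :: complex
    proof -
      have "S = (C * I) * S" using that(2) by simp
      also have "\<dots> = I * (C * S)" by (simp only: mult_ac)
      finally show ?thesis unfolding that(1) by (simp only: mult_ac minus_mult_left[symmetric] minus_mult_right[symmetric])
    qed
    ultimately show ?thesis by (simp only:)
  qed
  then show ?thesis unfolding eigen_def using u rad by blast
qed

lemma eigen_sib: "eigen (-{0}) (a+b) (ext0 (restrS3 (sib a b j)))"
  and C2_S3_sib: "C2_S3 (restrS3 (sib a b j))"
  and lapS3_sib: "p \<in> S3 \<Longrightarrow> lapS3 (restrS3 (sib a b j)) p = - of_nat ((a+b) * (a+b+2)) * restrS3 (sib a b j) p"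
proof -
  obtain f' f'' where f: "C2d (-{0}) (ext0 (restrS3 (sib a b j))) f' f''"
    "\<And>x. x \<noteq> 0 \<Longrightarrow> (\<Sum>v\<leftarrow>real_basis. f'' v v x) = - of_nat ((a+b) * ((a+b)+2)) * (sib a b j x * inorm x ^ ((a+b)+2))"
    using C2d_ext0_sib[of a b j] by blast
  have op: "open (-{0::pt})" by (simp add: open_Compl)
  have S: "S3 \<subseteq> -{0}" by (auto simp: S3_norm)
  show 1: "lapS3 (restrS3 (sib a b j)) p = - of_nat ((a+b) * (a+b+2)) * restrS3 (sib a b j) p" if p: "p \<in> S3" for p
  proof -
    have "p \<noteq> 0" "inorm p = 1" using p S by (auto simp: inorm_def S3_norm)
    then show ?thesis unfolding lapS3_def using lap4_C2d[OF f(1) op, of p] f(2)[of p] p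
      by (simp add: restrS3_def)
  qed
  have C: "C2_on (-{0}) (ext0 (restrS3 (sib a b j)))" by (rule C2d_imp_C2_on[OF f(1)])
  then show "C2_S3 (restrS3 (sib a b j))" unfolding C2_S3_def using op S by blast
  show "eigen (-{0}) (a+b) (ext0 (restrS3 (sib a b j)))"
    by (rule eigen_ext0[OF op S _ C 1]) auto
qed

text \<open>The factor |x|^(-2) absorbs the one in \<open>eigen\<close>, so that Green's formula
  becomes symmetry of the Laplacian for this weight.\<close>

definition wt :: "real \<Rightarrow> pt \<Rightarrow> real" where
  "wt \<delta> x = bump \<delta> x * inverse (norm x) ^ 2"

definition ip :: "real \<Rightarrow> (pt \<Rightarrow> complex) \<Rightarrow> (pt \<Rightarrow> complex) \<Rightarrow> complex" where
  "ip \<delta> u g = integral\<^sup>L lborel (\<lambda>x. of_real (wt \<delta> x) * (u x * cnj (g x)))"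

lemma wt_nonneg: "wt \<delta> x \<ge> 0"
  by (simp add: wt_def bump_def)

lemma wt_0: "x \<notin> annulus \<delta> \<Longrightarrow> wt \<delta> x = 0"
  by (simp add: wt_def bump_0)

text \<open>By compactness (|x|^2 - 1)^2 has a positive minimum on the part of the ball of radius 2
  outside U, and every annulus with \<delta> < 1 lies in that ball.\<close>

lemma exists_annulus:
  assumes "open U" "S3 \<subseteq> U"
  obtains \<delta> where "0 < \<delta>" "\<delta> < 1" "annulus \<delta> \<subseteq> U"
proof (cases "cball 0 2 - U = {}")
  case True
  have "annulus (1/2) \<subseteq> U"
    using annulus_norm(1)[of "1/2"] True by fastforce
  then show ?thesis using that[of "1/2"] by simp
next
  case False
  have "compact (cball 0 2 - U)" using assms by (intro compact_diff) auto
  moreover have "continuous_on (cball 0 2 - U) (\<lambda>x. (x \<bullet> x - 1)\<^sup>2)"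
    by (intro continuous_intros)
  ultimately obtain y where y: "y \<in> cball 0 2 - U" "\<And>x. x \<in> cball 0 2 - U \<Longrightarrow> (y \<bullet> y - 1)\<^sup>2 \<le> (x \<bullet> x - 1)\<^sup>2"
    using continuous_attains_inf[OF _ False] by blast
  define m where "m = (y \<bullet> y - 1)\<^sup>2"
  have "m > 0"
  proof (rule ccontr)
    assume "\<not> m > 0"
    then have "y \<bullet> y = 1" by (simp add: m_def)
    then have "norm y = 1" by (simp add: norm_eq_1)
    then show False using y assms by (auto simp: S3_norm)
  qed
  define d where "d = min (1/2) (m/2)"
  have d: "0 < d" "d < 1" "d < m" using \<open>m > 0\<close> by (auto simp: d_def)
  have "annulus d \<subseteq> U"
  proof
    fix x assume x: "x \<in> annulus d"
    then have "(x \<bullet> x - 1)\<^sup>2 < m" using d by (simp add: annulus_def)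
    then have "x \<notin> cball 0 2 - U" using y(2)[of x] by (auto simp: m_def)
    then show "x \<in> U" using annulus_norm(1)[OF d(2) x] by auto
  qed
  then show ?thesis using that d by blast
qed

locale shell =
  fixes U :: "pt set" and \<delta> :: real
  assumes U: "open U" "annulus \<delta> \<subseteq> U" "0 \<notin> U" and \<delta>: "0 < \<delta>" "\<delta> < 1"
begin

lemma wt_integrable:
  assumes "continuous_on U f"
  shows "integrable lborel (\<lambda>x. of_real (wt \<delta> x) * f x :: complex)"
  by (rule integrable_bump[OF U(1,2) \<delta>(2)])
     (use U(3) assms in \<open>auto simp: wt_0, auto simp: wt_def intro!: continuous_intros continuous_bump\<close>)

text \<open>Green's formula for u and cnj g leaves the difference of the eigenvalues times the inner
  product, and l(l+2) = (l+1)^2 - 1 is injective in l.\<close>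

lemma eigen_orth:
  assumes u: "eigen U k u" and g: "eigen U l g" and "k \<noteq> l"
  shows "ip \<delta> u g = 0"
proof -
  obtain u' u'' where u: "C2d U u u' u''" "\<And>x. x \<in> U \<Longrightarrow> u' x x = 0"
     "\<And>x. x \<in> U \<Longrightarrow> (\<Sum>v\<leftarrow>real_basis. u'' v v x) = - of_nat (k * (k + 2)) * (u x * inorm x ^ 2)"
    using u unfolding eigen_def by blast
  define h where "h x = cnj (g x)" for x
  obtain h' h'' where h: "C2d U h h' h''" "\<And>x. x \<in> U \<Longrightarrow> h' x x = 0"
     "\<And>x. x \<in> U \<Longrightarrow> (\<Sum>v\<leftarrow>real_basis. h'' v v x) = - of_nat (l * (l + 2)) * (h x * inorm x ^ 2)"
    using eigen_cnj[OF g] unfolding eigen_def h_def[abs_def] by blast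
  have "of_real (bump \<delta> x) * (h x * (\<Sum>v\<leftarrow>real_basis. u'' v v x) - u x * (\<Sum>v\<leftarrow>real_basis. h'' v v x))
     = (of_nat (l * (l+2)) - of_nat (k * (k+2))) * (of_real (wt \<delta> x) * (u x * h x))" for x
  proof (cases "x \<in> U")
    case True
    show ?thesis unfolding u(3)[OF True] h(3)[OF True]
      by (simp add: wt_def inorm_def algebra_simps)
  next
    case False
    then have "x \<notin> annulus \<delta>" using U by auto
    then show ?thesis by (simp add: wt_0 bump_0)
  qed
  then have "(of_nat (l * (l+2)) - of_nat (k * (k+2))) * ip \<delta> u g = 0"
    using green[OF U(1,2) \<delta>(2) u(1,2) h(1,2)]
    unfolding ip_def by (simp add: h_def integral_mult_right_zero del: sum_list.Cons sum_list.Nil of_nat_mult)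
  moreover have "l * (l+2) \<noteq> k * (k+2)"
  proof
    assume "l * (l+2) = k * (k+2)"
    then have "(l+1)^2 = (k+1)^2" by (simp add: power2_eq_square)
    then show False using \<open>k \<noteq> l\<close> by (simp only: power2_eq_iff_nonneg)
  qed
  then have "(of_nat (l * (l+2)) - of_nat (k * (k+2)) :: complex) \<noteq> 0"
    by (metis of_nat_eq_iff right_minus_eq)
  ultimately show ?thesis by (meson mult_eq_0_iff)
qed

lemma ip_diff_left:
  assumes "continuous_on U u" "continuous_on U v" "continuous_on U g"
  shows "ip \<delta> (\<lambda>x. u x - v x) g = ip \<delta> u g - ip \<delta> v g"
  unfolding ip_def left_diff_distrib right_diff_distrib
  by (rule Bochner_Integration.integral_diff) (intro wt_integrable continuous_intros assms)+

lemma ip_cnj: "ip \<delta> g u = cnj (ip \<delta> u g)"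
proof -
  have "integral\<^sup>L lborel (\<lambda>x. cnj (of_real (wt \<delta> x) * (u x * cnj (g x)))) = cnj (ip \<delta> u g)"
    unfolding ip_def by (rule Bochner_Integration.integral_cnj)
  then show ?thesis unfolding ip_def by (simp add: mult.commute)
qed

lemma ip_cmult_left: "ip \<delta> (\<lambda>x. c * u x) g = c * ip \<delta> u g"
  unfolding ip_def by (subst integral_mult_right_zero[symmetric]) (simp add: mult_ac)

lemma ip_sum_left:
  assumes "finite A" "\<And>i. i \<in> A \<Longrightarrow> continuous_on U (u i)" "continuous_on U g"
  shows "ip \<delta> (\<lambda>x. \<Sum>i\<in>A. c i * u i x) g = (\<Sum>i\<in>A. c i * ip \<delta> (u i) g)"
proof -
  have "ip \<delta> (\<lambda>x. \<Sum>i\<in>A. c i * u i x) g = (\<Sum>i\<in>A. ip \<delta> (\<lambda>x. c i * u i x) g)"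
    unfolding ip_def sum_distrib_left sum_distrib_right
    by (rule Bochner_Integration.integral_sum) (intro wt_integrable continuous_intros assms)
  then show ?thesis by (simp add: ip_cmult_left)
qed

lemma ip_diff_right:
  assumes "continuous_on U u" "continuous_on U v" "continuous_on U g"
  shows "ip \<delta> g (\<lambda>x. u x - v x) = ip \<delta> g u - ip \<delta> g v"
  by (subst (1 2 3) ip_cnj) (simp add: ip_diff_left[OF assms])

lemma ip_add_right:
  assumes "continuous_on U u" "continuous_on U v" "continuous_on U g"
  shows "ip \<delta> g (\<lambda>x. u x + v x) = ip \<delta> g u + ip \<delta> g v"
proof -
  have "ip \<delta> (\<lambda>x. u x + v x) g = ip \<delta> u g + ip \<delta> v g"
    unfolding ip_def distrib_left distrib_right
    by (rule Bochner_Integration.integral_add) (intro wt_integrable continuous_intros assms)+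
  then show ?thesis by (subst (1 2 3) ip_cnj) simp
qed

lemma ip_cmult_right: "ip \<delta> g (\<lambda>x. c * u x) = cnj c * ip \<delta> g u"
  by (subst (1 2) ip_cnj) (simp add: ip_cmult_left)

text \<open>Vanishing almost everywhere becomes vanishing everywhere: the set where the continuous
  integrand is nonzero is open, and a nonempty open set is not negligible.\<close>

lemma ip_self_eq_0:
  assumes "continuous_on U u" "ip \<delta> u u = 0"
  shows "of_real (wt \<delta> x) * u x = 0"
proof -
  define q where "q x = wt \<delta> x * (cmod (u x))\<^sup>2" for x
  have qc: "of_real (q x) = of_real (wt \<delta> x) * (u x * cnj (u x))" for x
    by (simp add: q_def complex_norm_square[symmetric])
  have cont: "continuous_on UNIV (\<lambda>x. complex_of_real (q x))"
    unfolding qc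
    by (rule continuous_on_glue[OF U(1,2)])
       (use U(3) assms(1) in \<open>auto simp: wt_0, auto simp: wt_def intro!: continuous_intros continuous_bump\<close>)
  then have contq: "continuous_on UNIV q"
    using continuous_on_Re[OF cont] by simp
  have opn: "open {x. q x \<noteq> 0}"
    by (intro open_Collect_neq contq continuous_intros)
  have "integrable lborel (\<lambda>x. complex_of_real (q x))"
    unfolding qc by (intro wt_integrable continuous_intros assms)
  then have int: "integrable lborel q" using integrable_Re by fastforce
  have "complex_of_real (integral\<^sup>L lborel q) = 0"
    using assms(2) unfolding ip_def qc[symmetric] by (simp add: integral_of_real)
  then have "AE x in lborel. q x = 0"
    using integral_nonneg_eq_0_iff_AE[OF int] wt_nonneg by (simp add: q_def)
  then have "{x. q x \<noteq> 0} \<in> null_sets lborel"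
    using AE_iff_null_sets[of "{x. q x \<noteq> 0}" lborel] borel_open[OF opn] by simp
  then have "negligible {x. q x \<noteq> 0}"
    by (simp add: negligible_iff_null_sets null_sets_completionI)
  with opn have "{x. q x \<noteq> 0} = {}" using open_not_negligible by blast
  then have "q x = 0" by blast
  then show ?thesis by (simp add: q_def)
qed

text \<open>Gram-Schmidt for a family that may be dependent. The induction is over all f, so its
  hypothesis applies both to f and to the new vector \<open>b s\<close>.\<close>

lemma ip_projection:
  assumes "finite A" "\<And>i. i \<in> A \<Longrightarrow> continuous_on U (b i)" "continuous_on U f"
  shows "\<exists>c. \<forall>i\<in>A. ip \<delta> (\<lambda>x. f x - (\<Sum>j\<in>A. c j * b j x)) (b i) = 0"
  using assms
proof (induction A arbitrary: f rule: finite_induct)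
  case (insert s A)
  have cb: "continuous_on U (b i)" if "i \<in> A" for i using insert.prems(1) that by blast
  have cs: "continuous_on U (b s)" using insert.prems(1) by blast
  obtain c where c: "\<forall>i\<in>A. ip \<delta> (\<lambda>x. f x - (\<Sum>j\<in>A. c j * b j x)) (b i) = 0"
    using insert.IH[OF cb insert.prems(2)] by blast
  obtain d where d: "\<forall>i\<in>A. ip \<delta> (\<lambda>x. b s x - (\<Sum>j\<in>A. d j * b j x)) (b i) = 0"
    using insert.IH[OF cb cs] by blast
  define f1 where "f1 x = f x - (\<Sum>j\<in>A. c j * b j x)" for x
  define s1 where "s1 x = b s x - (\<Sum>j\<in>A. d j * b j x)" for x
  have cf1: "continuous_on U f1" and cs1: "continuous_on U s1"
    unfolding f1_def[abs_def] s1_def[abs_def] by (intro continuous_intros insert.prems(2) cb cs; simp)+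
  have c1: "\<forall>i\<in>A. ip \<delta> f1 (b i) = 0" and d1: "\<forall>i\<in>A. ip \<delta> s1 (b i) = 0"
    using c d unfolding f1_def[abs_def] s1_def[abs_def] by blast+
  have orth: "ip \<delta> g (b s) = ip \<delta> g s1" if g: "continuous_on U g" "\<forall>i\<in>A. ip \<delta> g (b i) = 0" for g
  proof -
    have "ip \<delta> g s1 = ip \<delta> g (b s) - ip \<delta> g (\<lambda>x. \<Sum>j\<in>A. d j * b j x)"
      unfolding s1_def[abs_def] by (intro ip_diff_right continuous_intros cs cb g; simp)
    also have "ip \<delta> g (\<lambda>x. \<Sum>j\<in>A. d j * b j x) = cnj (\<Sum>j\<in>A. d j * ip \<delta> (b j) g)"
      by (subst ip_cnj) (simp add: ip_sum_left[OF insert.hyps(1) cb g(1)])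
    also have "\<dots> = 0"
      using g(2) by (subst ip_cnj) simp
    finally show ?thesis by simp
  qed
  \<comment> \<open>If s1 has norm 0 the quotient is 0 by convention; then s1 vanishes wherever the
    weight does not, and the inner product with f1 is 0 as well.\<close>
  define t where "t = ip \<delta> f1 s1 / ip \<delta> s1 s1"
  have t: "ip \<delta> f1 s1 = t * ip \<delta> s1 s1"
  proof (cases "ip \<delta> s1 s1 = 0")
    case True
    have "of_real (wt \<delta> x) * s1 x = 0" for x by (rule ip_self_eq_0[OF cs1 True])
    then have "of_real (wt \<delta> x) * (f1 x * cnj (s1 x)) = 0" for x
      using arg_cong[where f=cnj] by fastforce
    then have "ip \<delta> f1 s1 = 0" by (simp only: ip_def integral_zero)
    then show ?thesis using True by simp
  qed (simp add: t_def)
  define e where "e j = (if j = s then t else c j - t * d j)" for j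
  have e: "(\<lambda>x. f x - (\<Sum>j\<in>insert s A. e j * b j x)) = (\<lambda>x. f1 x - t * s1 x)"
  proof
    fix x
    have "(\<Sum>j\<in>insert s A. e j * b j x) = t * b s x + (\<Sum>j\<in>A. e j * b j x)"
      using insert.hyps by (simp add: e_def)
    also have "(\<Sum>j\<in>A. e j * b j x) = (\<Sum>j\<in>A. (c j - t * d j) * b j x)"
      using insert.hyps by (intro sum.cong) (auto simp: e_def)
    finally show "f x - (\<Sum>j\<in>insert s A. e j * b j x) = f1 x - t * s1 x"
      by (simp add: f1_def s1_def algebra_simps sum_subtractf sum_distrib_left)
  qed
  have lin: "ip \<delta> (\<lambda>x. f1 x - t * s1 x) g = ip \<delta> f1 g - t * ip \<delta> s1 g" if "continuous_on U g" for g
    by (subst ip_diff_left) (auto intro!: continuous_intros cf1 cs1 that simp: ip_cmult_left)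
  have "ip \<delta> (\<lambda>x. f1 x - t * s1 x) (b i) = 0" if "i \<in> insert s A" for i
  proof (cases "i \<in> A")
    case True
    then show ?thesis using c1 d1 by (simp add: lin cb)
  next
    case False
    then have "i = s" using that by blast
    then show ?thesis
      using orth[OF cf1 c1] orth[OF cs1 d1] t by (simp add: lin cs)
  qed
  then show ?case unfolding e[symmetric] by blast
qed simp

lemma ip_approx_bound:
  assumes "continuous_on U r" "continuous_on U h" "\<And>x. x \<in> U \<Longrightarrow> cmod (h x) \<le> e"
  shows "cmod (ip \<delta> r h) \<le> e * integral\<^sup>L lborel (\<lambda>x. wt \<delta> x * cmod (r x))"
proof -
  have i1: "integrable lborel (\<lambda>x. of_real (wt \<delta> x) * (r x * cnj (h x)))"
    by (intro wt_integrable continuous_intros assms)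
  have "integrable lborel (\<lambda>x. norm (of_real (wt \<delta> x) * r x))"
    by (intro integrable_norm wt_integrable assms)
  then have i2: "integrable lborel (\<lambda>x. wt \<delta> x * cmod (r x))"
    using wt_nonneg by (simp add: norm_mult)
  have "cmod (ip \<delta> r h) \<le> integral\<^sup>L lborel (\<lambda>x. norm (of_real (wt \<delta> x) * (r x * cnj (h x))))"
    unfolding ip_def by (rule integral_norm_bound)
  also have "\<dots> \<le> integral\<^sup>L lborel (\<lambda>x. e * (wt \<delta> x * cmod (r x)))"
  proof (rule integral_mono)
    fix x
    show "norm (of_real (wt \<delta> x) * (r x * cnj (h x))) \<le> e * (wt \<delta> x * cmod (r x))"
    proof (cases "x \<in> U")
      case True
      then have "wt \<delta> x * cmod (r x) * cmod (h x) \<le> wt \<delta> x * cmod (r x) * e"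
        using assms(3) wt_nonneg by (intro mult_left_mono) auto
      then show ?thesis using wt_nonneg by (simp add: norm_mult mult_ac)
    next
      case False
      then have "wt \<delta> x = 0" using U wt_0 by blast
      then show ?thesis by simp
    qed
  qed (use i1 i2 in auto)
  finally show ?thesis by simp
qed

text \<open>Continuity is carried along in the induction because additivity of \<open>ip\<close>
  needs integrable products.\<close>

lemma sibspan_orth:
  assumes r: "continuous_on U r" "\<And>a b j. ip \<delta> r (ext0 (restrS3 (sib a b j))) = 0"
    and "sibspan f"
  shows "continuous_on U (ext0 (restrS3 f)) \<and> ip \<delta> r (ext0 (restrS3 f)) = 0"
  using assms(3)
proof (induction rule: sibspan.induct)
  case (base c a b j)
  have c: "continuous_on U (ext0 (restrS3 (sib a b j)))"
    using eigen_continuous[OF eigen_subset[OF eigen_sib]] U(3) by auto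
  have "ext0 (restrS3 (\<lambda>p. c * sib a b j p)) = (\<lambda>x. c * ext0 (restrS3 (sib a b j)) x)"
    by (auto simp: ext0_def restrS3_def fun_eq_iff)
  then show ?case using c r(2) by (auto simp: ip_cmult_right intro!: continuous_intros)
next
  case (add f g)
  have "ext0 (restrS3 (\<lambda>p. f p + g p)) = (\<lambda>x. ext0 (restrS3 f) x + ext0 (restrS3 g) x)"
    by (auto simp: ext0_def restrS3_def fun_eq_iff)
  then show ?case using add.IH r(1) by (auto simp: ip_add_right intro!: continuous_intros)
next
  case (cong f g)
  have "restrS3 f = restrS3 g" using cong.hyps by (auto simp: restrS3_def fun_eq_iff)
  then show ?case using cong.IH by simp
qed

end

lemma eigenfunction_eq_sib_sum:
  assumes C: "C2_S3 F" and lap: "\<And>p. p \<in> S3 \<Longrightarrow> lapS3 F p = - of_nat (k * (k + 2)) * F p"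
  obtains c where "\<And>p. p \<in> S3 \<Longrightarrow> F p = (\<Sum>j\<le>k. \<Sum>a\<le>k. c j a * sib a (k-a) j p)"
proof -
  obtain W where W: "open W" "S3 \<subseteq> W" "C2_on W (ext0 F)"
    using C unfolding C2_S3_def by blast
  \<comment> \<open>Removing 0 keeps a neighbourhood of S3 and makes 1/|x| smooth on it.\<close>
  define U where "U = W - {0}"
  have U: "open U" "S3 \<subseteq> U" "0 \<notin> U" using W by (auto simp: U_def S3_norm)
  have "C2_on U (ext0 F)"
    using C2_on_imp_C2d[OF W(3)] C2d_imp_C2_on C2d_subset unfolding U_def by (metis Diff_subset)
  then have eF: "eigen U k (ext0 F)" using eigen_ext0[OF U _ lap] by blast
  obtain \<delta> where \<delta>: "0 < \<delta>" "\<delta> < 1" "annulus \<delta> \<subseteq> U" using exists_annulus[OF U(1,2)] .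
  interpret shell U \<delta> using U \<delta> by unfold_locales
  define e where "e a b j = ext0 (restrS3 (sib a b j))" for a b j
  have ee: "eigen U (a+b) (e a b j)" for a b j
    unfolding e_def using eigen_subset[OF eigen_sib] U(3) by blast
  have ce: "continuous_on U (e a b j)" for a b j by (rule eigen_continuous[OF ee])
  have cF: "continuous_on U (ext0 F)" by (rule eigen_continuous[OF eF])
  define A where "A = {..k} \<times> {..k}"
  define b where "b = (\<lambda>(j,a). e a (k-a) j)"
  have cb: "continuous_on U (b i)" for i using ce by (cases i) (simp add: b_def)
  obtain c where c: "\<forall>i\<in>A. ip \<delta> (\<lambda>x. ext0 F x - (\<Sum>i\<in>A. c i * b i x)) (b i) = 0"
    using ip_projection[of A b "ext0 F"] cb cF by (auto simp: A_def)
  define r where "r x = ext0 F x - (\<Sum>i\<in>A. c i * b i x)" for x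
  have cr: "continuous_on U r"
    unfolding r_def[abs_def] by (intro continuous_intros cF cb)
  \<comment> \<open>In degree k orthogonality holds by the choice of c, and siblings with j > k
    vanish identically. In any other degree F and every \<open>b i\<close> are orthogonal to the
    sibling by \<open>eigen_orth\<close>.\<close>
  have ro: "ip \<delta> r (e a m j) = 0" for a m j
  proof (cases "a + m = k")
    case True
    show ?thesis
    proof (cases "j \<le> k")
      case j: True
      have "(j, a) \<in> A" "b (j, a) = e a m j" using True j by (auto simp: A_def b_def)
      then show ?thesis using bspec[OF c, of "(j, a)"] unfolding r_def[abs_def] by simp
    next
      case False
      then have "e a m j = (\<lambda>x. 0)" using True
        by (auto simp: e_def ext0_def restrS3_def sib_eq_0 fun_eq_iff)
      then show ?thesis by (simp add: ip_def)
    qed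
  next
    case False
    have "ip \<delta> (b i) (e a m j) = 0" if i: "i \<in> A" for i
    proof (cases i)
      case (Pair j' a')
      then have "a' + (k - a') = k" using i by (simp add: A_def)
      then have "eigen U k (b i)" using ee[of a' "k-a'" j'] Pair by (simp add: b_def)
      then show ?thesis using eigen_orth[OF _ ee] False by metis
    qed
    moreover have "ip \<delta> (ext0 F) (e a m j) = 0"
      using eigen_orth[OF eF ee] False by metis
    moreover have "ip \<delta> r (e a m j) = ip \<delta> (ext0 F) (e a m j) - (\<Sum>i\<in>A. c i * ip \<delta> (b i) (e a m j))"
      unfolding r_def[abs_def]
      by (subst ip_diff_left) (auto intro!: continuous_intros cF cb ce ip_sum_left simp: A_def)
    ultimately show ?thesis by simp
  qed
  define R where "R p = F p - (\<Sum>i\<in>A. c i * sib (snd i) (k - snd i) (fst i) p)" for p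
  have rR: "r x = R (x /\<^sub>R norm x)" if "x \<noteq> 0" for x
  proof -
    have "x /\<^sub>R norm x \<in> S3" using that by (simp add: S3_norm)
    then show ?thesis
      by (simp add: r_def R_def b_def e_def ext0_def restrS3_def case_prod_unfold)
  qed
  have rS: "r p = R p" if "p \<in> S3" for p
  proof -
    have "norm p = 1" using that by (simp add: S3_norm)
    then show ?thesis using rR[of p] by (cases "p = 0") auto
  qed
  have cR: "continuous_on S3 R"
    using continuous_on_cong[of S3 S3 r R] rS continuous_on_subset[OF cr, of S3] \<open>S3 \<subseteq> U\<close> by blast
  define M where "M = integral\<^sup>L lborel (\<lambda>x. wt \<delta> x * cmod (r x))"
  have M: "M \<ge> 0" unfolding M_def using wt_nonneg by (intro Bochner_Integration.integral_nonneg) auto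
  have bound: "cmod (ip \<delta> r r) \<le> t * M" if t: "t > 0" for t
  proof -
    obtain f where f: "sibspan f" "\<And>p. p \<in> S3 \<Longrightarrow> cmod (R p - f p) \<le> t"
      using sibspan_dense[OF cR t] by blast
    have f0: "continuous_on U (ext0 (restrS3 f))" "ip \<delta> r (ext0 (restrS3 f)) = 0"
      using sibspan_orth[OF cr ro[unfolded e_def] f(1)] by auto
    have "ip \<delta> r r = ip \<delta> r (\<lambda>x. r x - ext0 (restrS3 f) x)"
      using ip_diff_right[OF cr f0(1) cr] f0(2) by simp
    also have "cmod \<dots> \<le> t * M"
      unfolding M_def
    proof (rule ip_approx_bound)
      fix x assume "x \<in> U"
      then have x: "x \<noteq> 0" using U by auto
      then have "x /\<^sub>R norm x \<in> S3" by (simp add: S3_norm)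
      then show "cmod (r x - ext0 (restrS3 f) x) \<le> t"
        using f(2) by (simp add: rR[OF x] ext0_def restrS3_def)
    qed (intro continuous_intros cr f0)+
    finally show ?thesis .
  qed
  have "ip \<delta> r r = 0"
  proof (rule ccontr)
    assume nz: "ip \<delta> r r \<noteq> 0"
    then have "cmod (ip \<delta> r r) > 0" by simp
    \<comment> \<open>With error |ip r r| / (2(M + 1)) the bound falls below |ip r r| itself; M + 1
      instead of M covers M = 0.\<close>
    then have "cmod (ip \<delta> r r) \<le> cmod (ip \<delta> r r) / (2 * (M + 1)) * M"
      using bound[of "cmod (ip \<delta> r r) / (2 * (M+1))"] M by simp
    also have "\<dots> < cmod (ip \<delta> r r)" using M nz by (simp add: field_simps add_nonneg_pos)
    finally show False by simp
  qed
  have "F p = (\<Sum>j\<le>k. \<Sum>a\<le>k. c (j, a) * sib a (k-a) j p)" if p: "p \<in> S3" for p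
  proof -
    have "norm p = 1" using p by (simp add: S3_norm)
    then have "p \<bullet> p = 1" "p \<noteq> 0" by (auto simp: norm_eq_1)
    then have "wt \<delta> p \<noteq> 0" using \<delta> by (simp add: wt_def bump_def)
    then have "r p = 0" using ip_self_eq_0[OF cr \<open>ip \<delta> r r = 0\<close>, of p] by simp
    then have "F p = (\<Sum>i\<in>A. c i * sib (snd i) (k - snd i) (fst i) p)" using rS[OF p] by (simp add: R_def)
    then show ?thesis by (simp add: A_def sum.cartesian_product case_prod_unfold)
  qed
  then show ?thesis by (rule that[of "\<lambda>j a. c (j, a)"])
qed

section \<open>Linear independence of siblings\<close>

definition isform :: "nat \<Rightarrow> (pt \<Rightarrow> complex) \<Rightarrow> bool" where
  "isform k f \<longleftrightarrow> (\<exists>d. f = form k d)"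

lemma isform_form [simp]: "isform k (form k d)"
  unfolding isform_def by blast

lemma isform_add: "isform k f \<Longrightarrow> isform k g \<Longrightarrow> isform k (\<lambda>p. f p + g p)"
proof -
  assume "isform k f" "isform k g"
  then obtain c d where "f = form k c" "g = form k d" unfolding isform_def by blast
  then have "(\<lambda>p. f p + g p) = form k (\<lambda>a. c a + d a)"
    by (simp add: form_def fun_eq_iff distrib_right sum.distrib)
  then show ?thesis by simp
qed

lemma isform_cmult: "isform k f \<Longrightarrow> isform k (\<lambda>p. c * f p)"
proof -
  assume "isform k f"
  then obtain d where "f = form k d" unfolding isform_def by blast
  then have "(\<lambda>p. c * f p) = form k (\<lambda>a. c * d a)"
    by (simp add: form_def fun_eq_iff sum_distrib_left mult.assoc)
  then show ?thesis by simp
qed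

lemma isform_0: "isform k (\<lambda>p. 0)"
  using isform_cmult[OF isform_form[of k undefined], of 0] by simp

lemma isform_diff: "isform k f \<Longrightarrow> isform k g \<Longrightarrow> isform k (\<lambda>p. f p - g p)"
  using isform_add[OF _ isform_cmult[of k g "-1"], of f] by simp

lemma isform_sum:
  "(\<And>i. i \<in> A \<Longrightarrow> isform k (f i)) \<Longrightarrow> isform k (\<lambda>p. \<Sum>i\<in>A. f i p)"
  by (induction A rule: infinite_finite_induct) (auto intro: isform_add isform_0)

lemma isform_monom: "isform (a + b) (\<lambda>p. (p$1)^a * (p$2)^b)"
proof -
  have "(\<lambda>p. (p$1)^a * (p$2)^b) = form (a + b) (\<lambda>i. if i = a then 1 else 0)"
    by (simp add: form_def fun_eq_iff if_distrib[of "\<lambda>x. x * _"] sum.delta cong: if_cong)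
  then show ?thesis by simp
qed

lemma isform_mult:
  assumes "isform k f" "isform l g" shows "isform (k + l) (\<lambda>p. f p * g p)"
proof -
  obtain c d where fg: "f = form k c" "g = form l d" using assms unfolding isform_def by blast
  have "(\<lambda>p. f p * g p) = (\<lambda>p. \<Sum>a\<le>k. \<Sum>b\<le>l. (c a * d b) * ((p$1)^(a+b) * (p$2)^((k-a)+(l-b))))"
    unfolding fg form_def sum_product by (simp only: power_add mult_ac)
  moreover have "isform (k+l) (\<lambda>p. (p$1)^(a+b) * (p$2)^((k-a)+(l-b)))" if "a \<le> k" "b \<le> l" for a b
    using isform_monom[of "a+b" "(k-a)+(l-b)"] that by simp
  ultimately show ?thesis
    by (simp only:) (intro isform_sum isform_cmult, auto)
qed

lemma isform_power: "isform k f \<Longrightarrow> isform (n * k) (\<lambda>p. f p ^ n)"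
proof (induction n)
  case 0 then show ?case using isform_monom[of 0 0] by simp
next
  case (Suc n) then show ?case using isform_mult[of k f "n * k"] by simp
qed

lemma isform_linear: "isform 1 (\<lambda>p. c * p$1 + d * p$2)"
proof -
  have "isform 1 (\<lambda>p. p$1)" "isform 1 (\<lambda>p. p$2)"
    using isform_monom[of 1 0] isform_monom[of 0 1] by simp_all
  then show ?thesis by (intro isform_add isform_cmult)
qed

lemma mat2_vec: "((g::mat2) *v p)$1 = g$1$1 * p$1 + g$1$2 * p$2" "(g *v p)$2 = g$2$1 * p$1 + g$2$2 * p$2"
  by (simp_all add: matrix_vector_mult_def sum_2)

lemma isform_compose: assumes "isform k f" shows "isform k (\<lambda>p. f ((g::mat2) *v p))"
proof -
  obtain d where "f = form k d" using assms unfolding isform_def by blast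
  then have "(\<lambda>p. f (g *v p)) = (\<lambda>p. \<Sum>a\<le>k. d a * ((g$1$1 * p$1 + g$1$2 * p$2)^a * (g$2$1 * p$1 + g$2$2 * p$2)^(k-a)))"
    by (simp add: form_def mat2_vec mult.assoc)
  moreover have "isform k (\<lambda>p. (g$1$1 * p$1 + g$1$2 * p$2)^a * (g$2$1 * p$1 + g$2$2 * p$2)^(k-a))" if "a \<le> k" for a
    using isform_mult[OF isform_power[OF isform_linear, of a] isform_power[OF isform_linear, of "k-a"]] that by simp
  ultimately show ?thesis by (simp only:) (intro isform_sum isform_cmult, auto)
qed

lemma form_homog: "form k d (t *s p) = t ^ k * form k d p"
  unfolding form_def sum_distrib_left
proof (rule sum.cong[OF refl])
  fix a assume "a \<in> {..k}"
  then have "t ^ k = t ^ a * t ^ (k - a)" by (simp flip: power_add)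
  then show "d a * (t *s p) $ 1 ^ a * (t *s p) $ 2 ^ (k - a) = t ^ k * (d a * p $ 1 ^ a * p $ 2 ^ (k - a))"
    by (simp add: power_mult_distrib mult_ac)
qed

lemma isform_homog: "isform k f \<Longrightarrow> f (t *s p) = t ^ k * f p"
  unfolding isform_def using form_homog by blast

section \<open>Separating coefficients by real points and by phases\<close>

lemma poly_zero_on_reals:
  assumes "infinite A" "\<And>x. x \<in> A \<Longrightarrow> poly Q (of_real x) = 0" shows "Q = (0 :: complex poly)"
proof (rule ccontr)
  assume "Q \<noteq> 0"
  then have "finite (complex_of_real ` A)"
    using assms(2) by (intro finite_subset[OF _ poly_roots_finite]) auto
  then show False using assms(1) by (auto dest: finite_imageD simp: inj_on_def)
qed

lemma circle_poly_zero:
  assumes "\<And>z. cmod z = 1 \<Longrightarrow> poly Q z = 0" shows "Q = (0 :: complex poly)"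
proof (rule ccontr)
  assume "Q \<noteq> 0"
  then have "finite {z. poly Q z = 0}" by (rule poly_roots_finite)
  moreover have "(\<lambda>x. Complex x (sqrt (1 - x\<^sup>2))) ` {0..1} \<subseteq> {z. poly Q z = 0}"
    using assms by (auto simp: cmod_def power_le_one)
  ultimately have "finite ((\<lambda>x. Complex x (sqrt (1 - x\<^sup>2))) ` {0..1::real})" by (rule rev_finite_subset)
  then have "finite {0..1::real}" by (rule finite_imageD) (auto simp: inj_on_def)
  then show False using infinite_Icc[of 0 "1::real"] by simp
qed

text \<open>The phase identities below produce powers of w^2; since \<open>csqrt\<close> preserves
  modulus 1, w^2 runs over the whole unit circle.\<close>

lemma circle_power_sum_zero:
  assumes "\<And>w. cmod w = 1 \<Longrightarrow> (\<Sum>j\<le>k. h j * (w\<^sup>2) ^ j) = (0::complex)" "j \<le> k" shows "h j = 0"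
proof -
  define Q where "Q = (\<Sum>j\<le>k. monom (h j) j)"
  have "Q = 0"
  proof (rule circle_poly_zero)
    fix z :: complex assume "cmod z = 1"
    then have "cmod (csqrt z) = 1" by simp
    from assms(1)[OF this] show "poly Q z = 0" by (simp add: Q_def poly_sum poly_monom)
  qed
  moreover have "coeff Q j = h j" using assms(2) by (simp add: Q_def coeff_sum sum.delta')
  ultimately show ?thesis by simp
qed

lemma pcompose_power: "pcompose (p ^ n) r = pcompose p r ^ n" for p :: "complex poly"
  by (induction n) (auto simp: pcompose_mult pcompose_1)

text \<open>Multiplying p by w multiplies \<open>gen\<close> by w^(a+b) and substitutes (cnj w)^2 t
  for t, so siblings with different j have different weights under phases.\<close>

lemma sib_phase:
  assumes "cmod w = 1"
  shows "sib a b j (w *s p) = w ^ (a + b) * ((cnj w)\<^sup>2) ^ j * sib a b j p"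
proof -
  have w: "w * (cnj w)\<^sup>2 = cnj w"
    using assms complex_norm_square[of w] by (simp add: power2_eq_square flip: mult.assoc)
  define r where "r = [:0, (cnj w)\<^sup>2:]"
  have "[:(w *s p)$1, - cnj ((w *s p)$2):] = smult w (pcompose [:p$1, - cnj (p$2):] r)"
    "[:(w *s p)$2, cnj ((w *s p)$1):] = smult w (pcompose [:p$2, cnj (p$1):] r)"
    using w by (auto simp: r_def pcompose_pCons mult.assoc[symmetric])
  then have "gen a b (w *s p) = smult (w ^ (a+b)) (pcompose (gen a b p) r)"
    by (simp only: gen_def smult_power pcompose_power[symmetric] pcompose_mult power_add
        mult_smult_left mult_smult_right smult_smult mult.commute[of "w ^ b"])
  then show ?thesis by (simp add: sib_def r_def coeff_pcompose_linear)
qed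

text \<open>At p = (w, y cnj w) with |w| = 1 and y real, \<open>gen\<close> is a scalar multiple of
  this product. Its coefficients are polynomials in y, so an identity valid for real y may be
  evaluated at complex y.\<close>

lemma shear_coeff_poly:
  "\<exists>e. \<forall>y. coeff ([:1, -y:] ^ a * [:y, 1:] ^ b) j = poly e (y::complex)"
proof (induction a arbitrary: j)
  case 0
  show ?case
  proof (induction b arbitrary: j)
    case 0
    show ?case by (intro exI[of _ "[:coeff 1 j:]"]) simp
  next
    case (Suc b)
    have "\<forall>j. \<exists>e. \<forall>y. coeff ([:1, -y:] ^ 0 * [:y, 1:] ^ b) j = poly e (y::complex)" using Suc.IH by blast
    then obtain e where e: "\<And>j y. coeff ([:1, -y:] ^ 0 * [:y, 1:] ^ b) j = poly (e j) (y::complex)"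
      unfolding choice_iff by blast
    have "coeff ([:1, -y:] ^ 0 * [:y, 1:] ^ Suc b) j = poly ([:0,1:] * e j + (if j = 0 then 0 else e (j-1))) y" for y
      using e[of y] coeff_linear_mult[of y 1 "[:y,1:]^b" j] by (simp del: mult_pCons_left)
    then show ?case by blast
  qed
next
  case (Suc a)
  have "\<forall>j. \<exists>e. \<forall>y. coeff ([:1, -y:] ^ a * [:y, 1:] ^ b) j = poly e (y::complex)" using Suc.IH by blast
  then obtain e where e: "\<And>j y. coeff ([:1, -y:] ^ a * [:y, 1:] ^ b) j = poly (e j) (y::complex)"
    unfolding choice_iff by blast
  have "coeff ([:1, -y:] ^ Suc a * [:y, 1:] ^ b) j = poly (e j + (if j = 0 then 0 else - [:0,1:] * e (j-1))) y" for y
    using e[of y] coeff_linear_mult[of 1 "-y" "[:1, -y:] ^ a * [:y, 1:] ^ b" j]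
    by (simp add: mult.assoc del: mult_pCons_left)
  then show ?case by blast
qed

text \<open>On the points (w, y cnj w) the sum is a polynomial in y that vanishes for real y, hence
  also at y = i. There it is a nonzero constant times a power sum in w^2 with coefficients
  \<open>d a\<close> up to powers of i, and varying w isolates them.\<close>

lemma form_coeffs_zero:
  assumes j: "j \<le> k" and z: "\<And>p. p \<in> S3 \<Longrightarrow> (\<Sum>a\<le>k. d a * sib a (k-a) j p) = 0" and a: "a \<le> k"
  shows "d a = 0"
proof -
  \<comment> \<open>The test points (w, y cnj w) usually lie off S3, so the hypothesis is first
    extended by homogeneity.\<close>
  have all: "(\<Sum>a\<le>k. d a * sib a (k-a) j p) = 0" if "p \<noteq> 0" for p
  proof -
    define q where "q = p /\<^sub>R norm p"
    have q: "q \<in> S3" using that by (simp add: q_def S3_norm)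
    have p: "p = of_real (norm p) *s q" using that by (simp add: q_def flip: scaleR_pt)
    have "sib a (k-a) j p = of_real (norm p) ^ k * sib a (k-a) j q" if "a \<le> k" for a
      using sib_scale[of a "k-a" j "norm p" q] p that by simp
    then have "(\<Sum>a\<le>k. d a * sib a (k-a) j p) = of_real (norm p) ^ k * (\<Sum>a\<le>k. d a * sib a (k-a) j q)"
      by (simp add: sum_distrib_left mult_ac)
    then show ?thesis using z[OF q] by simp
  qed
  have "\<forall>a b. \<exists>e. \<forall>y. coeff ([:1, -y:] ^ a * [:y, 1:] ^ b) j = poly e (y::complex)"
    using shear_coeff_poly by blast
  then obtain e where e: "\<And>a b y. coeff ([:1, -y:] ^ a * [:y, 1:] ^ b) j = poly (e a b) (y::complex)"
    unfolding choice_iff by blast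
  have key: "(\<Sum>a\<le>k. (d a * \<i> ^ (k-a)) * (w\<^sup>2) ^ a) = 0" if w: "cmod w = 1" for w
  proof -
    have ww: "w * cnj w = 1" using w complex_norm_square[of w] by simp
    define Q where "Q = (\<Sum>a\<le>k. smult (d a * (w^a * cnj w ^ (k-a))) (e a (k-a)))"
    have Qy: "poly Q (of_real y) = 0" for y
    proof -
      define p :: pt where "p = (\<chi> i. if i = 1 then w else of_real y * cnj w)"
      have p12: "p$1 = w" "p$2 = of_real y * cnj w" by (auto simp: p_def)
      have "p \<noteq> 0" using p12(1) w by auto
      have "sib a b j p = (w^a * cnj w ^ b) * poly (e a b) (of_real y)" for a b
      proof -
        have "[:p$1, - cnj (p$2):] = smult w [:1, - of_real y:]" "[:p$2, cnj (p$1):] = smult (cnj w) [:of_real y, 1:]"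
          by (auto simp: p12)
        then have "gen a b p = smult (w^a * cnj w ^ b) ([:1, - of_real y:]^a * [:of_real y, 1:]^b)"
          by (simp only: gen_def smult_power mult_smult_left mult_smult_right smult_smult mult.commute[of "cnj w ^ b"])
        then show ?thesis using e by (simp add: sib_def)
      qed
      then show ?thesis using all[OF \<open>p \<noteq> 0\<close>] by (simp add: Q_def poly_sum mult.assoc)
    qed
    \<comment> \<open>At y = i both linear factors of gen become proportional, so gen collapses to a k-th power.\<close>
    have "Q = 0" by (rule poly_zero_on_reals[of UNIV]) (simp_all add: Qy infinite_UNIV_char_0)
    then have "poly Q \<i> = 0" by simp
    \<comment> \<open>C is the coefficient of t^j in (1 - i t)^k, nonzero because j \<le> k.\<close>
    define C where "C = of_nat (k choose j) * (-\<i>) ^ j"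
    have C: "C \<noteq> 0" using j by (simp add: C_def)
    have ei: "poly (e a (k-a)) \<i> = \<i> ^ (k-a) * C" if "a \<le> k" for a
    proof -
      have "[:\<i>, 1:] = smult \<i> [:1, -\<i>:]" by simp
      then have "[:1, -\<i>:] ^ a * [:\<i>, 1:] ^ (k-a) = smult (\<i>^(k-a)) ([:1, -\<i>:] ^ a * [:1, -\<i>:] ^ (k-a))"
        by (simp only: smult_power mult_smult_right)
      also have "\<dots> = smult (\<i>^(k-a)) ([:1, -\<i>:] ^ k)" using that by (simp flip: power_add)
      finally show ?thesis using coeff_linear_poly_power[OF j, of 1 "-\<i>"]
        by (simp add: e[symmetric] C_def)
    qed
    have "0 = w ^ k * poly Q \<i>" using \<open>poly Q \<i> = 0\<close> by simp
    also have "\<dots> = (\<Sum>a\<le>k. d a * \<i>^(k-a) * (w\<^sup>2)^a * C)"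
      unfolding Q_def poly_sum sum_distrib_left
    proof (rule sum.cong[OF refl])
      fix a assume "a \<in> {..k}"
      then have a: "a \<le> k" by simp
      have "w ^ k * (w^a * cnj w ^ (k-a)) = w ^ a * w ^ (k - a) * (w^a * cnj w ^ (k-a))"
        using a by (simp flip: power_add)
      also have "\<dots> = w^a * w^a * (w * cnj w) ^ (k-a)" by (simp add: power_mult_distrib mult_ac)
      also have "\<dots> = (w\<^sup>2)^a" by (simp add: ww power2_eq_square power_mult_distrib)
      finally show "w ^ k * poly (smult (d a * (w ^ a * cnj w ^ (k - a))) (e a (k - a))) \<i> = d a * \<i> ^ (k - a) * (w\<^sup>2) ^ a * C"
        using ei[OF a] by (simp add: mult_ac)
    qed
    also have "\<dots> = (\<Sum>a\<le>k. d a * \<i>^(k-a) * (w\<^sup>2)^a) * C" by (simp add: sum_distrib_right)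
    finally show ?thesis using C by simp
  qed
  have "d a * \<i> ^ (k-a) = 0" by (rule circle_power_sum_zero[OF key a])
  then show ?thesis by simp
qed

text \<open>Phases separate the indices j by weight, after which \<open>form_coeffs_zero\<close>
  treats a single j.\<close>

lemma sib_independent:
  assumes "\<And>p. p \<in> S3 \<Longrightarrow> (\<Sum>j\<le>k. \<Sum>a\<le>k. c j a * sib a (k-a) j p) = 0" "j \<le> k" "a \<le> k"
  shows "c j a = 0"
proof (rule form_coeffs_zero[OF assms(2) _ assms(3)])
  fix p assume p: "p \<in> S3"
  define h where "h j = (\<Sum>a\<le>k. c j a * sib a (k-a) j p)" for j
  have "(\<Sum>j\<le>k. h j * (w\<^sup>2) ^ j) = 0" if w: "cmod w = 1" for w
  proof -
    \<comment> \<open>The conjugate phase is used so that the weights of \<open>sib_phase\<close>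
      become powers of w^2.\<close>
    have "cnj w *s p \<in> S3" using p w by (simp add: S3_def norm_mult)
    then have "0 = (\<Sum>j\<le>k. \<Sum>a\<le>k. c j a * sib a (k-a) j (cnj w *s p))" using assms(1) by simp
    also have "\<dots> = (\<Sum>j\<le>k. cnj w ^ k * (h j * (w\<^sup>2)^j))"
      unfolding h_def sum_distrib_right sum_distrib_left
      by (intro sum.cong refl) (use w in \<open>simp add: sib_phase mult_ac\<close>)
    also have "\<dots> = cnj w ^ k * (\<Sum>j\<le>k. h j * (w\<^sup>2) ^ j)" by (simp add: sum_distrib_left)
    finally show ?thesis using w by auto
  qed
  from circle_power_sum_zero[OF this assms(2)] show "(\<Sum>a\<le>k. c j a * sib a (k-a) j p) = 0" by (simp add: h_def)
qed

section \<open>The binary octahedral group\<close>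

definition vec2 :: "complex \<Rightarrow> complex \<Rightarrow> pt" where "vec2 a b = vector [a, b]"

lemma vec2_simps [simp]: "vec2 a b $ 1 = a" "vec2 a b $ 2 = b"
  by (simp_all add: vec2_def)

definition su :: "complex \<Rightarrow> complex \<Rightarrow> mat2" where
  "su a b = vector [vector [a, b], vector [- cnj b, cnj a]]"

lemma su_simps [simp]: "su a b $ 1 $ 1 = a" "su a b $ 1 $ 2 = b" "su a b $ 2 $ 1 = - cnj b" "su a b $ 2 $ 2 = cnj a"
  by (simp_all add: su_def)

lemma su_vec: "su a b *v p = vec2 (a * p$1 + b * p$2) (- cnj b * p$1 + cnj a * p$2)"
  by (simp add: vec_eq_iff forall_2 mat2_vec)

lemma SU2_eq: "g \<in> SU2 \<longleftrightarrow>
   cnj (g$1$1) * g$1$1 + cnj (g$2$1) * g$2$1 = 1 \<and> cnj (g$1$1) * g$1$2 + cnj (g$2$1) * g$2$2 = 0 \<and>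
   cnj (g$1$2) * g$1$1 + cnj (g$2$2) * g$2$1 = 0 \<and> cnj (g$1$2) * g$1$2 + cnj (g$2$2) * g$2$2 = 1 \<and>
   g$1$1 * g$2$2 - g$1$2 * g$2$1 = 1"
  by (auto simp: SU2_def matrix_matrix_mult_def mat_def vec_eq_iff forall_2 sum_2 det_2)

lemma su_in_SU2: "a * cnj a + b * cnj b = 1 \<Longrightarrow> su a b \<in> SU2"
  by (simp add: SU2_eq mult.commute add.commute)

lemma SU2_cases:
  assumes "g \<in> SU2"
  obtains a b where "g = su a b" "a * cnj a + b * cnj b = 1"
proof -
  define a b c d where abcd: "a = g$1$1" "b = g$1$2" "c = g$2$1" "d = g$2$2"
  have e: "cnj a * a + cnj c * c = 1" "cnj a * b + cnj c * d = 0" "cnj b * a + cnj d * c = 0"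
     "cnj b * b + cnj d * d = 1" "a * d - b * c = 1"
    using assms unfolding SU2_eq abcd by auto
  have "d = cnj a" using e(1,2,5) by algebra
  have "c = - cnj b" using e(3,4,5) by algebra
  have "g = su a b" using \<open>d = cnj a\<close> \<open>c = - cnj b\<close> by (simp add: vec_eq_iff forall_2 abcd)
  moreover have "a * cnj a + b * cnj b = 1" using e(5) \<open>d = cnj a\<close> \<open>c = - cnj b\<close> by simp
  ultimately show ?thesis by (rule that)
qed

lemma SU2_S3: assumes "g \<in> SU2" "p \<in> S3" shows "g *v p \<in> S3"
proof -
  obtain a b where g: "g = su a b" "a * cnj a + b * cnj b = 1" using SU2_cases[OF assms(1)] .
  have "(a * x + b * y) * (cnj a * x' + cnj b * y') + (- cnj b * x + cnj a * y) * (- b * x' + a * y')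
      = (a * cnj a + b * cnj b) * (x * x' + y * y')" for x y x' y'
    by algebra
  then show ?thesis using assms(2) g unfolding S3_iff by (simp add: su_vec)
qed

lemma SU2_matrix_inv:
  assumes "g \<in> SU2"
  shows "matrix_inv g *v (g *v p) = p" "g *v (matrix_inv g *v p) = p" "matrix_inv g \<in> SU2"
proof -
  let ?h = "(\<chi> i j. cnj (g$j$i)) :: mat2"
  have 1: "?h ** g = mat 1" using assms by (simp add: SU2_def)
  then have 2: "g ** ?h = mat 1" by (simp add: matrix_left_right_inverse)
  have "g ** matrix_inv g = mat 1 \<and> matrix_inv g ** g = mat 1"
    unfolding matrix_inv_def by (rule someI[of _ ?h]) (use 1 2 in simp)
  then have 3: "g ** matrix_inv g = mat 1" "matrix_inv g ** g = mat 1" by auto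
  show "matrix_inv g *v (g *v p) = p" "g *v (matrix_inv g *v p) = p"
    using 3 by (simp_all add: matrix_vector_mul_assoc)
  have "matrix_inv g = ?h"
  proof -
    have "matrix_inv g = (?h ** g) ** matrix_inv g" unfolding 1 by simp
    also have "\<dots> = ?h ** (g ** matrix_inv g)" by (simp only: matrix_mul_assoc)
    finally show ?thesis unfolding 3 by simp
  qed
  moreover obtain a b where g: "g = su a b" "a * cnj a + b * cnj b = 1" using SU2_cases[OF assms(1)] .
  moreover have "?h = su (cnj a) (- b)" unfolding g(1) by (simp add: vec_eq_iff forall_2)
  ultimately have "matrix_inv g = su (cnj a) (- b)" by (simp only:)
  then show "matrix_inv g \<in> SU2" using g by (simp add: su_in_SU2 mult.commute)
qed

lemma Rg_invariant_iff:
  assumes "g \<in> SU2"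
  shows "(\<forall>p\<in>S3. Rg g F p = F p) \<longleftrightarrow> (\<forall>p\<in>S3. F (g *v p) = F p)"
  unfolding Rg_def using SU2_matrix_inv[OF assms] SU2_S3[OF assms] SU2_S3[of "matrix_inv g"] by metis

text \<open>Multiplication by the quaternion j; it commutes with SU(2), hence so does the twist.\<close>
definition quat :: "pt \<Rightarrow> pt" where "quat p = vec2 (- cnj (p$2)) (cnj (p$1))"

lemma poly_gen_sum:
  "poly (\<Sum>a\<le>k. smult (c a) (gen a (k-a) p)) t = form k c (p + t *s quat p)"
  by (simp add: poly_sum form_def gen_def quat_def mult.assoc)

lemma SU2_quat: assumes "g \<in> SU2" shows "g *v (p + t *s quat p) = g *v p + t *s quat (g *v p)"
proof -
  obtain a b where g: "g = su a b" "a * cnj a + b * cnj b = 1" using SU2_cases[OF assms(1)] .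
  show ?thesis by (simp add: g(1) su_vec vec_eq_iff forall_2 quat_def algebra_simps)
qed

text \<open>By \<open>poly_gen_sum\<close> the hypothesis says that two polynomials in t agree
  everywhere, so an identity between forms passes to every sibling index j at once.\<close>

lemma sib_sum_eqI:
  assumes "\<And>t. form k c (q + t *s quat q) = form k d (p + t *s quat p)"
  shows "(\<Sum>a\<le>k. c a * sib a (k-a) j q) = (\<Sum>a\<le>k. d a * sib a (k-a) j p)"
proof -
  have "(\<Sum>a\<le>k. smult (c a) (gen a (k-a) q)) = (\<Sum>a\<le>k. smult (d a) (gen a (k-a) p))"
    by (rule poly_ext) (simp add: poly_gen_sum assms)
  from arg_cong[OF this, of "\<lambda>r. coeff r j"] show ?thesis by (simp add: coeff_sum sib_def)
qed

lemma sib_sum_compose: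
  assumes "g \<in> SU2" "\<And>p. form k c (g *v p) = form k d p"
  shows "(\<Sum>a\<le>k. c a * sib a (k-a) j (g *v p)) = (\<Sum>a\<le>k. d a * sib a (k-a) j p)"
  by (rule sib_sum_eqI) (simp add: SU2_quat[OF assms(1), symmetric] assms(2))

section \<open>Generators and explicit elements of the binary octahedral group\<close>

definition eps :: complex where "eps = cis (pi/4)"
definition rt :: complex where "rt = of_real (1 / sqrt 2)"

lemma rt_simps: "rt\<^sup>2 = 1/2" "rt * rt = 1/2" "cnj rt = rt" "rt \<noteq> 0"
proof -
  show "rt\<^sup>2 = 1/2" unfolding rt_def by (simp add: power_divide flip: of_real_power)
  then show "rt * rt = 1/2" by (simp add: power2_eq_square)
qed (auto simp: rt_def)

lemma eps_simps: "eps\<^sup>2 = \<i>" "eps * eps = \<i>" "eps * cnj eps = 1" "cnj eps * eps = 1" "eps \<noteq> 0" "eps ^ 8 = 1"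
proof -
  show 1: "eps\<^sup>2 = \<i>" 
  proof -
    have "eps\<^sup>2 = cis (pi/4 + pi/4)" by (simp only: eps_def power2_eq_square cis_mult)
    also have "pi/4 + pi/4 = pi/2" by simp
    finally show ?thesis by simp
  qed
  then show "eps * eps = \<i>" by (simp add: power2_eq_square)
  show "eps * cnj eps = 1" "cnj eps * eps = 1" "eps \<noteq> 0" by (simp_all add: eps_def cis_cnj cis_mult)
  have "eps ^ 8 = (eps\<^sup>2)^4" by (simp flip: power_mult)
  then show "eps ^ 8 = 1" by (simp add: 1)
qed

text \<open>\<open>Dg\<close> induces z -> i z, the quarter turn about the axis through 0 and
  infinity; \<open>Hg\<close> induces z -> (1 + z)/(1 - z), the quarter turn about the axis through
  i and -i.\<close>

definition Dg :: mat2 where "Dg = su eps 0"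
definition Hg :: mat2 where "Hg = su rt rt"

lemma Dg_Ostar: "Dg \<in> Ostar"
proof -
  have "Dg \<in> SU2" unfolding Dg_def by (rule su_in_SU2) (simp add: eps_simps)
  have c: "cnj eps \<noteq> 0" using eps_simps(5) by simp
  have q: "eps / cnj eps = \<i>" using eps_simps by (simp add: divide_eq_eq c) (metis mult.assoc mult.left_neutral mult.commute)
  have "mobius Dg (Some w) = Some (\<i> * w)" for w
    using c arg_cong[OF q, of "\<lambda>z. z * w"] by (simp add: mobius_def Dg_def)
  moreover have "mobius Dg None = None" by (simp add: mobius_def Dg_def)
  ultimately have "mobius Dg ` V_O = V_O"
    unfolding V_O_def by (simp add: insert_commute)
  with \<open>Dg \<in> SU2\<close> show ?thesis by (simp add: Ostar_def)
qed

lemma Hg_Ostar: "Hg \<in> Ostar"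
proof -
  have "Hg \<in> SU2" unfolding Hg_def by (rule su_in_SU2) (simp add: rt_simps)
  have S: "mobius Hg (Some w) = (if w = 1 then None else Some ((1 + w) / (1 - w)))" for w
  proof -
    have "- rt * w + rt = rt * (1 - w)" "rt * w + rt = rt * (1 + w)" by (simp_all add: algebra_simps)
    then show ?thesis using rt_simps(4) by (simp add: mobius_def Hg_def rt_simps(3) flip: minus_mult_left)
  qed
  have N: "mobius Hg None = Some (-1)" using rt_simps(4) by (simp add: mobius_def Hg_def rt_simps(3))
  have i: "(1 + \<i>) / (1 - \<i>) = \<i>" "(1 - \<i>) / (1 + \<i>) = - \<i>"
    by (simp_all add: complex_eq_iff Re_divide Im_divide)
  have n1: "\<i> \<noteq> 1" "- \<i> \<noteq> 1" by (simp_all add: complex_eq_iff)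
  have "mobius Hg ` V_O = V_O"
    unfolding V_O_def by (simp add: S N i n1 insert_commute)
  with \<open>Hg \<in> SU2\<close> show ?thesis by (simp add: Ostar_def)
qed

text \<open>If a and b are nonzero, the image s = b / cnj a of 0 is a vertex with |s| = 1, so |a|^2
  = 1/2, and the image of 1 leaves four values for a^2. The three shapes account for 8 + 8 + 32
  elements, as (x, y) and (-x, -y) give the same matrix.\<close>

lemma Ostar_cases:
  assumes "g \<in> Ostar"
  obtains x where "x ^ 8 = 1" "x * cnj x = 1" "g = su x 0"
  | x where "x ^ 8 = 1" "x * cnj x = 1" "g = su 0 x"
  | x y where "x ^ 8 = 1" "x * cnj x = 1" "y ^ 8 = 1" "y * cnj y = 1" "g = su (x * y * rt) (x * cnj y * rt)"
proof -
  obtain a b where g: "g = su a b" "a * cnj a + b * cnj b = 1"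
    using assms SU2_cases unfolding Ostar_def by blast
  have V: "mobius g z \<in> V_O" if "z \<in> V_O" for z
    using assms that unfolding Ostar_def by blast
  have V4: "w ^ 4 = 1" if "Some w \<in> V_O" "w \<noteq> 0" for w
    using that by (auto simp: V_O_def)
  have z1: "Some 1 \<in> V_O" "Some 0 \<in> V_O" by (auto simp: V_O_def)
  consider "b = 0" | "a = 0" | "a \<noteq> 0" "b \<noteq> 0" by blast
  then show ?thesis
  proof cases
    case 1
    then have aa: "a * cnj a = 1" "cnj a \<noteq> 0" using g(2) by auto
    have "mobius g (Some 1) = Some (a / cnj a)" using aa by (simp add: mobius_def g 1)
    then have "(a / cnj a) ^ 4 = 1" using V[OF z1(1)] V4 aa by fastforce
    moreover have "a / cnj a = a\<^sup>2" using aa by (simp add: divide_eq_eq power2_eq_square mult.assoc)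
    ultimately have "a ^ 8 = 1" by (simp flip: power_mult)
    then show ?thesis using that(1) aa(1) g(1) 1 by blast
  next
    case 2
    then have bb: "b * cnj b = 1" "cnj b \<noteq> 0" using g(2) by auto
    have "mobius g (Some 1) = Some (- (b / cnj b))" using bb by (simp add: mobius_def g 2)
    then have "(- (b / cnj b)) ^ 4 = 1" using V[OF z1(1)] V4[of "- (b / cnj b)"] bb by fastforce
    moreover have "b / cnj b = b\<^sup>2" using bb by (simp add: divide_eq_eq power2_eq_square mult.assoc)
    ultimately have "b ^ 8 = 1" by (simp flip: power_mult)
    then show ?thesis using that(2) bb(1) g(1) 2 by blast
  next
    case 3
    define s where "s = b / cnj a"
    have "mobius g (Some 0) = Some s" using 3 by (simp add: mobius_def g s_def)
    then have s4: "s ^ 4 = 1" using V[OF z1(2)] V4[of s] 3 by (auto simp: s_def)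
    have bs: "b = s * cnj a" using 3 by (simp add: s_def)
    have "cmod s ^ 4 = 1" using s4 by (metis norm_one norm_power)
    then have "cmod s = 1" using power_eq_imp_eq_base[of "cmod s" 4 1] by simp
    then have ss: "s * cnj s = 1" using complex_norm_square[of s] by simp
    have aa: "2 * (a * cnj a) = 1" using g(2) ss unfolding bs by (simp add: mult_ac) (algebra)
    \<comment> \<open>Since 2 a cnj a = 1, this is a / cnj a. The image of 1 determines it: infinity
      gives w = s, 0 gives w = -s, and r = i s or r = -i s gives w = i s or w = -i s; the other two
      vertices are impossible.\<close>
    define w where "w = 2 * a\<^sup>2"
    have w0: "w \<noteq> 0" using 3 by (simp add: w_def)
    have w4: "w ^ 4 = 1"
    proof (cases "cnj a = cnj b")
      case True
      then have "a = s * cnj a" using bs by (metis complex_cnj_cnj)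
      then have "w = s" using aa unfolding w_def by algebra
      then show ?thesis using s4 by simp
    next
      case False
      define r where "r = (a + b) / (cnj a - cnj b)"
      have r: "a + b = r * (cnj a - cnj b)" using False by (simp add: r_def)
      have "mobius g (Some 1) = Some r" using False by (simp add: mobius_def g r_def)
      then have rV: "Some r \<in> V_O" using V[OF z1(1)] by simp
      have cb: "cnj b = cnj s * a" using bs by simp
      have eq: "w + s = r * (1 - cnj s * w)" using r aa bs cb unfolding w_def by algebra
      show ?thesis
      proof (cases "r = 0")
        case True
        then have "w = - s" using eq by (simp add: add_eq_0_iff)
        then show ?thesis using s4 by simp
      next
        case False
        define q where "q = r * cnj s"
        have rq: "r = q * s" using ss by (simp add: q_def mult_ac)
        have "q ^ 4 = r ^ 4 * cnj (s ^ 4)" by (simp add: q_def power_mult_distrib)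
        then have q4: "q ^ 4 = 1" using V4[OF rV False] s4 by simp
        have "(q - 1) * (q + 1) * (q - \<i>) * (q + \<i>) = q ^ 4 - 1"
          by (simp add: algebra_simps power4_eq_xxxx)
        then have "q = 1 \<or> q = -1 \<or> q = \<i> \<or> q = - \<i>"
          using q4 by (auto simp: add_eq_0_iff2)
        moreover have eq2: "w * (1 + q) = s * (q - 1)" using eq ss unfolding rq by algebra
        ultimately consider "q = \<i>" | "q = - \<i>" using w0 ss by auto
        then show ?thesis
        proof cases
          case 1
          have "(1 + \<i>) * (w - \<i> * s) = 0" using eq2 unfolding 1 by (simp add: algebra_simps)
          then have "w = \<i> * s" by (simp add: complex_eq_iff)
          then show ?thesis using s4 by (simp add: power_mult_distrib)
        next
          case 2
          have "(1 - \<i>) * (w + \<i> * s) = 0" using eq2 unfolding 2 by (simp add: algebra_simps)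
          then have "w = - (\<i> * s)" by (auto simp: add_eq_0_iff2 complex_eq_iff)
          then show ?thesis using s4 by (simp add: power_mult_distrib)
        qed
      qed
    qed
    \<comment> \<open>x is a square root of b / cnj a, and y below is sqrt 2 * a * cnj x, the only
      choice with x y / sqrt 2 = a.\<close>
    define x where "x = csqrt s"
    have x2: "x\<^sup>2 = s" by (simp add: x_def)
    have x8: "x ^ 8 = 1" using s4 unfolding x2[symmetric] by (simp flip: power_mult)
    have "cmod x = 1" using \<open>cmod s = 1\<close> by (simp add: x_def)
    then have xx: "x * cnj x = 1" using complex_norm_square[of x] by simp
    define y where "y = 2 * rt * a * cnj x"
    have y2: "y\<^sup>2 = w * cnj s" unfolding y_def w_def x2[symmetric] by (simp add: power_mult_distrib rt_simps)
    have "y ^ 8 = (y\<^sup>2) ^ 4" by (simp flip: power_mult)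
    also have "\<dots> = w ^ 4 * cnj (s ^ 4)" by (simp add: y2 power_mult_distrib)
    finally have y8: "y ^ 8 = 1" by (simp add: w4 s4)
    have yy: "y * cnj y = 1"
    proof -
      have "y * cnj y = 4 * (rt * rt) * (a * cnj a) * (x * cnj x)" by (simp add: y_def rt_simps(3) mult_ac)
      then show ?thesis using aa xx by (simp add: rt_simps)
    qed
    have "x * y * rt = 2 * (rt * rt) * a * (x * cnj x)" by (simp add: y_def mult_ac)
    then have 1: "x * y * rt = a" by (simp add: rt_simps xx)
    have "x * cnj y * rt = 2 * (rt * rt) * cnj a * x\<^sup>2" by (simp add: y_def rt_simps(3) power2_eq_square mult_ac)
    then have 2: "x * cnj y * rt = b" using x2 bs by (simp add: rt_simps mult.commute)
    show ?thesis using that(3)[OF x8 xx y8 yy] g(1) 1 2 by simp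
  qed
qed

text \<open>Antidiagonal elements are diag(x, cnj x) * Hg^2, and those of the third shape are
  diag(x, cnj x) * Hg * diag(y, cnj y).\<close>

lemma Ostar_invariant:
  assumes D: "\<And>x p. x ^ 8 = 1 \<Longrightarrow> x * cnj x = 1 \<Longrightarrow> f (su x 0 *v p) = f p"
    and H: "\<And>p. f (Hg *v p) = f p" and g: "g \<in> Ostar"
  shows "f (g *v p) = f p"
  using Ostar_cases[OF g]
proof cases
  case (1 x) then show ?thesis using D by simp
next
  case (2 x)
  have "su 0 x *v p = su x 0 *v (Hg *v (Hg *v p))"
  proof -
    have "rt * (rt * z) = z / 2" for z using rt_simps(2) by (simp flip: mult.assoc)
    then show ?thesis by (simp add: su_vec Hg_def vec_eq_iff forall_2 rt_simps(3) algebra_simps)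
  qed
  then show ?thesis using 2 D H by simp
next
  case (3 x y)
  have "su (x * y * rt) (x * cnj y * rt) *v p = su x 0 *v (Hg *v (su y 0 *v p))"
    by (simp add: su_vec Hg_def vec_eq_iff forall_2 rt_simps(3) algebra_simps)
  then show ?thesis using 3 D H by simp
qed

section \<open>Invariant binary forms\<close>

text \<open>Klein's octahedral forms: \<open>f6\<close>, \<open>f8\<close> and \<open>f12\<close>
  vanish at the 6 vertices, the 8 face centres and the 12 edge midpoints of the octahedron.\<close>

definition f6 :: "pt \<Rightarrow> complex" where "f6 p = p$1 * p$2 * ((p$1)^4 - (p$2)^4)"
definition f8 :: "pt \<Rightarrow> complex" where "f8 p = (p$1)^8 + 14 * (p$1)^4 * (p$2)^4 + (p$2)^8"
definition f12 :: "pt \<Rightarrow> complex" where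
  "f12 p = (p$1)^12 - 33 * (p$1)^8 * (p$2)^4 - 33 * (p$1)^4 * (p$2)^8 + (p$2)^12"

lemma isform_f6: "isform 6 f6" and isform_f8: "isform 8 f8" and isform_f12: "isform 12 f12"
proof -
  note m = isform_monom
  have "isform 6 (\<lambda>p. (p$1)^5 * (p$2)^1 - (p$1)^1 * (p$2)^5)"
    using m[of 5 1] m[of 1 5] by (intro isform_diff) simp_all
  moreover have "(\<lambda>p. (p$1)^5 * (p$2)^1 - (p$1)^1 * (p$2)^5) = f6"
    by (auto simp: f6_def fun_eq_iff algebra_simps eval_nat_numeral)
  ultimately show "isform 6 f6" by simp
  have "isform 8 (\<lambda>p. (p$1)^8 * (p$2)^0 + 14 * ((p$1)^4 * (p$2)^4) + (p$1)^0 * (p$2)^8)"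
    using m[of 8 0] m[of 4 4] m[of 0 8] by (intro isform_add isform_cmult) simp_all
  moreover have "(\<lambda>p. (p$1)^8 * (p$2)^0 + 14 * ((p$1)^4 * (p$2)^4) + (p$1)^0 * (p$2)^8) = f8"
    by (auto simp: f8_def fun_eq_iff)
  ultimately show "isform 8 f8" by simp
  have "isform 12 (\<lambda>p. (p$1)^12 * (p$2)^0 - 33 * ((p$1)^8 * (p$2)^4) - 33 * ((p$1)^4 * (p$2)^8) + (p$1)^0 * (p$2)^12)"
    using m[of 12 0] m[of 8 4] m[of 4 8] m[of 0 12] by (intro isform_add isform_diff isform_cmult) simp_all
  moreover have "(\<lambda>p. (p$1)^12 * (p$2)^0 - 33 * ((p$1)^8 * (p$2)^4) - 33 * ((p$1)^4 * (p$2)^8) + (p$1)^0 * (p$2)^12) = f12"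
    by (auto simp: f12_def fun_eq_iff)
  ultimately show "isform 12 f12" by simp
qed

lemma cnj_eps_i: "cnj eps * \<i> = eps"
proof -
  have "cnj eps * (eps * eps) = eps" by (simp only: mult.assoc[symmetric] eps_simps(4) mult_1)
  then show ?thesis by (simp only: eps_simps(2))
qed

lemma Dg_vec: "Dg *v p = vec2 (eps * p$1) (cnj eps * p$2)"
  by (simp add: Dg_def su_vec)

lemma Dg_vec2: "Dg *v vec2 x y = cnj eps *s vec2 (\<i> * x) y"
  using cnj_eps_i by (simp add: Dg_vec vec_eq_iff forall_2 flip: mult.assoc)

lemma Hg_vec: "Hg *v p = rt *s vec2 (p$1 + p$2) (p$2 - p$1)"
  by (simp add: Hg_def su_vec rt_simps(3) vec_eq_iff forall_2 algebra_simps)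

lemma f6_diag: "x * x' = 1 \<Longrightarrow> x ^ 8 = 1 \<Longrightarrow> f6 (vec2 (x * p$1) (x' * p$2)) = x ^ 4 * f6 p"
  and f8_diag: "x * x' = 1 \<Longrightarrow> x ^ 8 = 1 \<Longrightarrow> f8 (vec2 (x * p$1) (x' * p$2)) = f8 p"
  and f12_diag: "x * x' = 1 \<Longrightarrow> x ^ 8 = 1 \<Longrightarrow> f12 (vec2 (x * p$1) (x' * p$2)) = x ^ 4 * f12 p"
proof -
  assume a: "x * x' = 1" "x ^ 8 = 1"
  have x4: "x' ^ 4 = x ^ 4" "x' ^ 8 = 1" "x ^ 12 = x ^ 4" "x' ^ 12 = x ^ 4"
    "x ^ 8 * x' ^ 4 = x ^ 4" "x ^ 4 * x' ^ 8 = x ^ 4" "x ^ 4 * x' ^ 4 = 1"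
    using a by algebra+
  show "f6 (vec2 (x * p$1) (x' * p$2)) = x ^ 4 * f6 p"
  proof -
    have "f6 (vec2 (x * p$1) (x' * p$2)) = (x * x') * (p$1 * p$2) * (x^4 * (p$1)^4 - x'^4 * (p$2)^4)"
      by (simp add: f6_def power_mult_distrib mult_ac)
    then show ?thesis by (simp add: a x4 f6_def algebra_simps)
  qed
  show "f8 (vec2 (x * p$1) (x' * p$2)) = f8 p"
  proof -
    have "f8 (vec2 (x * p$1) (x' * p$2)) = x^8 * (p$1)^8 + 14 * (x^4 * x'^4) * (p$1)^4 * (p$2)^4 + x'^8 * (p$2)^8"
      by (simp add: f8_def power_mult_distrib mult_ac)
    then show ?thesis unfolding a(2) x4(2,7) by (simp add: f8_def)
  qed
  show "f12 (vec2 (x * p$1) (x' * p$2)) = x ^ 4 * f12 p"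
  proof -
    have "f12 (vec2 (x * p$1) (x' * p$2)) = x^12 * (p$1)^12 - 33 * (x^8 * x'^4) * (p$1)^8 * (p$2)^4
       - 33 * (x^4 * x'^8) * (p$1)^4 * (p$2)^8 + x'^12 * (p$2)^12"
      by (simp add: f12_def power_mult_distrib mult_ac)
    then show ?thesis unfolding x4(3-6) by (simp add: f12_def algebra_simps)
  qed
qed

lemma f6_H: "f6 (Hg *v p) = - f6 p" and f8_H: "f8 (Hg *v p) = f8 p" and f12_H: "f12 (Hg *v p) = - f12 p"
proof -
  define x y where "x = p$1" "y = p$2"
  have r: "rt ^ 6 = 1/8" "rt ^ 8 = 1/16" "rt ^ 12 = 1/64" using rt_simps(1) by algebra+
  have 6: "f6 (vec2 (x+y) (y-x)) = - 8 * f6 p" unfolding f6_def vec2_simps x_y_def[symmetric] by algebra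
  have 8: "f8 (vec2 (x+y) (y-x)) = 16 * f8 p" unfolding f8_def vec2_simps x_y_def[symmetric] by algebra
  have 12: "f12 (vec2 (x+y) (y-x)) = - 64 * f12 p" unfolding f12_def vec2_simps x_y_def[symmetric] by algebra
  show "f6 (Hg *v p) = - f6 p" "f8 (Hg *v p) = f8 p" "f12 (Hg *v p) = - f12 p"
    unfolding Hg_vec isform_homog[OF isform_f6] isform_homog[OF isform_f8] isform_homog[OF isform_f12] r
      x_y_def[symmetric] 6 8 12 by simp_all
qed

section \<open>Division of binary forms by linear forms\<close>

definition line_form :: "pt \<Rightarrow> pt \<Rightarrow> complex" where "line_form q p = p$1 * q$2 - q$1 * p$2"

text \<open>Homogeneous division with remainder: a remainder free of p$1 can only be a multiple of
  (p$2)^(k+1). Each monomial is divided separately, by induction on its exponent of p$1.\<close>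

lemma isform_div_affine:
  assumes "isform (Suc k) f"
  shows "\<exists>g c. isform k g \<and> (\<forall>p. f p = (p$1 - x * p$2) * g p + c * (p$2) ^ Suc k)"
proof -
  obtain d where d: "f = form (Suc k) d" using assms unfolding isform_def by blast
  have mono: "\<exists>g. isform k g \<and> (\<forall>p. (p$1)^a * (p$2)^(Suc k - a) = (p$1 - x * p$2) * g p + x^a * (p$2) ^ Suc k)"
    if "a \<le> Suc k" for a
    using that
  proof (induction a)
    case 0
    show ?case by (intro exI[of _ "\<lambda>p. 0"]) (simp add: isform_0)
  next
    case (Suc a)
    then obtain g where g: "isform k g" "\<And>p. (p$1)^a * (p$2)^(Suc k - a) = (p$1 - x * p$2) * g p + x^a * (p$2) ^ Suc k"
      by auto
    have "isform k (\<lambda>p. (p$1)^a * (p$2)^(k - a) + x * g p)"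
      using Suc.prems g(1) isform_monom[of a "k-a"] by (intro isform_add isform_cmult) simp_all
    moreover have "(p$1)^Suc a * (p$2)^(Suc k - Suc a) = (p$1 - x * p$2) * ((p$1)^a * (p$2)^(k - a) + x * g p) + x^Suc a * (p$2) ^ Suc k" for p
    proof -
      have "Suc k - a = Suc (k - a)" using Suc.prems by simp
      then have "(p$1)^a * (p$2 * (p$2)^(k - a)) = (p$1 - x * p$2) * g p + x^a * (p$2) ^ Suc k" using g(2)[of p] by simp
      moreover have "X * A * B = (X - x * y) * (A * B + x * G) + x * W * Z"
        if "A * (y * B) = (X - x * y) * G + W * Z" for A B G W X Z y :: complex
        using that by algebra
      ultimately show ?thesis by (simp only: diff_Suc_Suc power_Suc)
    qed
    ultimately show ?case by blast
  qed
  then have "\<forall>a. \<exists>g. a \<le> Suc k \<longrightarrow> isform k g \<and> (\<forall>p. (p$1)^a * (p$2)^(Suc k - a) = (p$1 - x * p$2) * g p + x^a * (p$2) ^ Suc k)"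
    by blast
  then obtain g where g: "\<And>a. a \<le> Suc k \<Longrightarrow> isform k (g a)"
    "\<And>a p. a \<le> Suc k \<Longrightarrow> (p$1)^a * (p$2)^(Suc k - a) = (p$1 - x * p$2) * g a p + x^a * (p$2) ^ Suc k"
    unfolding choice_iff by blast
  have "f p = (p$1 - x * p$2) * (\<Sum>a\<le>Suc k. d a * g a p) + (\<Sum>a\<le>Suc k. d a * x^a) * (p$2) ^ Suc k" for p
  proof -
    have "f p = (\<Sum>a\<le>Suc k. d a * ((p$1 - x * p$2) * g a p + x^a * (p$2) ^ Suc k))"
      unfolding d form_def by (intro sum.cong refl) (simp add: mult.assoc g(2) del: power_Suc)
    then show ?thesis
      by (simp only: distrib_left sum.distrib sum_distrib_left sum_distrib_right mult_ac)
  qed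
  moreover have "isform k (\<lambda>p. \<Sum>a\<le>Suc k. d a * g a p)"
    using g(1) by (intro isform_sum isform_cmult) auto
  ultimately show ?thesis by blast
qed

lemma isform_div:
  assumes f: "isform k f" and q: "f q = 0" "q$2 = 1 \<or> q = vec2 1 0"
  shows "(\<forall>p. f p = 0) \<or> (\<exists>l g. k = Suc l \<and> isform l g \<and> (\<forall>p. f p = line_form q p * g p))"
proof (cases k)
  case 0
  obtain d where "f = form 0 d" using f 0 unfolding isform_def by blast
  then have "f p = f q" for p by (simp add: form_def)
  then show ?thesis using q(1) by metis
next
  case (Suc l)
  show ?thesis
  proof (cases "q$2 = 1")
    case True
    obtain g c where g: "isform l g" "\<And>p. f p = (p$1 - q$1 * p$2) * g p + c * (p$2) ^ Suc l"
      using isform_div_affine f unfolding Suc by metis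
    have "c = 0" using g(2)[of q] q(1) True by simp
    then have "f p = line_form q p * g p" for p using g(2)[of p] True by (simp add: line_form_def)
    then show ?thesis using g(1) Suc by blast
  next
    case False
    then have q': "q = vec2 1 0" using q by blast
    obtain d where d: "f = form (Suc l) d" using f Suc unfolding isform_def by blast
    have "f (vec2 1 0) = d (Suc l)"
      unfolding d form_def by (simp add: power_0_left)
    then have d0: "d (Suc l) = 0" using q(1) q' by simp
    \<comment> \<open>\<open>line_form (vec2 1 0) p\<close> is -p$2, which accounts for the sign of
      the coefficients.\<close>
    have "f p = line_form q p * form l (\<lambda>a. - d a) p" for p
      unfolding d form_def line_form_def q'
      by (simp add: d0 sum_distrib_left sum_negf Suc_diff_le mult_ac)
    then show ?thesis using isform_form Suc by blast
  qed
qed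

text \<open>The condition \<open>sorted_wrt\<close> says that the points are pairwise distinct on
  the projective line, so the linear forms already divided out do not vanish at the next point and
  the quotient inherits its zero.\<close>

lemma isform_div_list:
  assumes f: "isform k f" and z: "\<And>q. q \<in> set qs \<Longrightarrow> f q = 0"
    and n: "\<And>q. q \<in> set qs \<Longrightarrow> q$2 = 1 \<or> q = vec2 1 0"
    and d: "sorted_wrt (\<lambda>q q'. line_form q' q \<noteq> 0) qs"
  shows "(\<forall>p. f p = 0) \<or> (\<exists>l g. k = length qs + l \<and> isform l g \<and> (\<forall>p. f p = (\<Prod>q\<leftarrow>qs. line_form q p) * g p))"
  using z n d
proof (induction qs)
  case Nil
  then show ?case using f by auto
next
  case (Cons q qs)
  have "(\<forall>p. f p = 0) \<or> (\<exists>l g. k = length qs + l \<and> isform l g \<and> (\<forall>p. f p = (\<Prod>q\<leftarrow>qs. line_form q p) * g p))"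
    using Cons.prems by (intro Cons.IH) auto
  then show ?case
  proof
    assume "\<exists>l g. k = length qs + l \<and> isform l g \<and> (\<forall>p. f p = (\<Prod>q\<leftarrow>qs. line_form q p) * g p)"
    then obtain l g where g: "k = length qs + l" "isform l g" "\<And>p. f p = (\<Prod>q\<leftarrow>qs. line_form q p) * g p" by blast
    have "(\<Prod>q'\<leftarrow>qs. line_form q' q) \<noteq> 0" using Cons.prems(3) by (auto simp: prod_list_zero_iff)
    then have "g q = 0" using g(3)[of q] Cons.prems(1)[of q] by simp
    from isform_div[OF g(2) this] Cons.prems(2)
    have "(\<forall>p. g p = 0) \<or> (\<exists>l' h. l = Suc l' \<and> isform l' h \<and> (\<forall>p. g p = line_form q p * h p))" by simp
    then show ?thesis
    proof
      assume "\<exists>l' h. l = Suc l' \<and> isform l' h \<and> (\<forall>p. g p = line_form q p * h p)"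
      then obtain l' h where h: "l = Suc l'" "isform l' h" "\<And>p. g p = line_form q p * h p" by blast
      have "k = length (q # qs) + l'" "\<And>p. f p = (\<Prod>q\<leftarrow>q # qs. line_form q p) * h p"
        using g h by (auto simp: mult_ac)
      then show ?thesis using h(2) by blast
    qed (use g(3) in simp)
  qed simp
qed

text \<open>Forms are functions here, so cancelling \<open>f6\<close> needs an argument:
  \<open>f6\<close> has no zero at (x, 1) with x > 1 real, and the values there determine q.\<close>

lemma isform_zero_if_f6_mult:
  assumes "isform k q" "\<And>p. f6 p * q p = 0"
  shows "q p = 0"
proof -
  obtain d where d: "q = form k d" using assms(1) unfolding isform_def by blast
  define Q where "Q = (\<Sum>a\<le>k. monom (d a) a)"
  have Qp: "poly Q z = q (vec2 z 1)" for z
    by (simp add: Q_def d form_def poly_sum poly_monom)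
  have "Q = 0"
  proof (rule poly_zero_on_reals[OF infinite_Ioi[of 1]])
    fix x :: real assume "x \<in> {1<..}"
    then have x: "x > 1" by simp
    then have "1 < x ^ 4" by (intro one_less_power) auto
    then have "complex_of_real (x ^ 4) \<noteq> 1" by (simp only: of_real_eq_1_iff)
    then have "f6 (vec2 (of_real x) 1) \<noteq> 0" using x by (simp add: f6_def)
    then show "poly Q (of_real x) = 0" using assms(2)[of "vec2 (of_real x) 1"] by (simp add: Qp)
  qed
  moreover have "coeff Q a = d a" if "a \<le> k" for a using that by (simp add: Q_def coeff_sum sum.delta')
  ultimately have "d a = 0" if "a \<le> k" for a using that by simp
  then show ?thesis by (simp add: d form_def)
qed

text \<open>Dg and Hg generate the group, and s is the value of the character on both generators.\<close>
definition Inv :: "nat \<Rightarrow> complex \<Rightarrow> (pt \<Rightarrow> complex) \<Rightarrow> bool" where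
  "Inv k s f \<longleftrightarrow> isform k f \<and> (\<forall>p. f (Dg *v p) = s * f p) \<and> (\<forall>p. f (Hg *v p) = s * f p)"

lemma eps4: "eps ^ 4 = -1"
proof -
  have "eps ^ 4 = (eps\<^sup>2)\<^sup>2" by (simp flip: power_mult)
  then show ?thesis by (simp add: eps_simps)
qed

lemma Inv_f6: "Inv 6 (-1) f6" and Inv_f8: "Inv 8 1 f8" and Inv_f12: "Inv 12 (-1) f12"
  using f6_diag[OF eps_simps(3,6)] f8_diag[OF eps_simps(3,6)] f12_diag[OF eps_simps(3,6)]
  by (auto simp: Inv_def isform_f6 isform_f8 isform_f12 f6_H f8_H f12_H Dg_vec eps4)

lemma Inv_mult: "Inv k s f \<Longrightarrow> Inv l t g \<Longrightarrow> Inv (k + l) (s * t) (\<lambda>p. f p * g p)"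
  by (simp add: Inv_def isform_mult)

lemma Inv_power: "Inv k s f \<Longrightarrow> Inv (n * k) (s ^ n) (\<lambda>p. f p ^ n)"
  by (simp add: Inv_def isform_power power_mult_distrib)

lemma Inv_diff: "Inv k s f \<Longrightarrow> Inv k s g \<Longrightarrow> Inv k s (\<lambda>p. f p - c * g p)"
  by (simp add: Inv_def isform_diff isform_cmult algebra_simps)

lemma Inv_vertex:
  assumes "Inv k s f" "eps ^ k \<noteq> s" shows "f (vec2 1 0) = 0"
proof -
  have "Dg *v vec2 1 0 = eps *s vec2 1 0" by (simp add: Dg_vec vec_eq_iff forall_2)
  then have "s * f (vec2 1 0) = eps ^ k * f (vec2 1 0)"
    using assms(1) unfolding Inv_def by (metis isform_homog)
  then show ?thesis using assms(2) by simp
qed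

lemma Inv_step:
  assumes f: "Inv k s f" and v: "f (vec2 1 0) = 0"
  shows "(\<forall>p. f p = 0) \<or> (\<exists>l g. k = 6 + l \<and> Inv l (-s) g \<and> (\<forall>p. f p = f6 p * g p))"
proof -
  have fk: "isform k f" and fD: "\<And>p. f (Dg *v p) = s * f p" and fH: "\<And>p. f (Hg *v p) = s * f p"
    using f by (auto simp: Inv_def)
  have hom: "f q = 0" if "f (t *s q) = 0" "t \<noteq> 0" for t q
    using that isform_homog[OF fk, of t q] by simp
  have hH: "f (vec2 (x+y) (y-x)) = 0" if "f (vec2 x y) = 0" for x y
    using fH[of "vec2 x y"] that hom rt_simps(4) by (simp add: Hg_vec)
  have hD: "f (vec2 (\<i> * x) y) = 0" if "f (vec2 x y) = 0" for x y
  proof -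
    have "f (cnj eps *s vec2 (\<i> * x) y) = 0" using fD[of "vec2 x y"] that by (simp add: Dg_vec2)
    then show ?thesis using hom eps_simps(5) by simp
  qed
  have sc: "f (vec2 x y) = 0" if "f (vec2 (t * x) (t * y)) = 0" "t \<noteq> 0" for t x y
  proof (rule hom[OF _ that(2)])
    have "t *s vec2 x y = vec2 (t * x) (t * y)" by (simp add: vec_eq_iff forall_2)
    then show "f (t *s vec2 x y) = 0" using that(1) by simp
  qed
  \<comment> \<open>\<open>Hg\<close> carries the vertices infinity -> -1 -> 0 -> 1, and
    \<open>Dg\<close> carries 1 -> i and -1 -> -i; \<open>sc\<close> rescales to the representatives
    required by \<open>isform_div_list\<close>.\<close>
  have p1: "f (vec2 1 (-1)) = 0" using hH[OF v] by simp
  have p2: "f (vec2 (-1) 1) = 0" using sc[of "-1" "-1" 1] p1 by simp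
  have p3: "f (vec2 0 1) = 0" using sc[of "-2" 0 1] hH[OF p1] by simp
  have p4: "f (vec2 1 1) = 0" using hH[OF p3] by simp
  have p5: "f (vec2 \<i> 1) = 0" "f (vec2 (-\<i>) 1) = 0" using hD[OF p4] hD[OF p2] by simp_all
  let ?qs = "[vec2 1 0, vec2 0 1, vec2 1 1, vec2 (-1) 1, vec2 \<i> 1, vec2 (-\<i>) 1]"
  have sw: "sorted_wrt (\<lambda>q q'. line_form q' q \<noteq> 0) ?qs"
    by (simp add: line_form_def complex_eq_iff)
  have z: "f q = 0" if "q \<in> set ?qs" for q using that v p2 p3 p4 p5 by auto
  have n: "q$2 = 1 \<or> q = vec2 1 0" if "q \<in> set ?qs" for q using that by auto
  have pr: "(\<Prod>q\<leftarrow>?qs. line_form q p) = - f6 p" for p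
  proof -
    have "(\<Prod>q\<leftarrow>?qs. line_form q p) = - p$1 * p$2 * ((p$1 - p$2) * (p$1 + p$2)) * ((p$1 - \<i> * p$2) * (p$1 + \<i> * p$2))"
      by (simp add: line_form_def algebra_simps)
    also have "(p$1 - \<i> * p$2) * (p$1 + \<i> * p$2) = (p$1)\<^sup>2 + (p$2)\<^sup>2"
      by (simp add: algebra_simps power2_eq_square)
    finally show ?thesis by (simp add: f6_def algebra_simps eval_nat_numeral)
  qed
  have "(\<forall>p. f p = 0) \<or> (\<exists>l g. k = length ?qs + l \<and> isform l g \<and> (\<forall>p. f p = (\<Prod>q\<leftarrow>?qs. line_form q p) * g p))"
    using isform_div_list[OF fk _ _ sw] z n by blast
  then show ?thesis
  proof
    assume "\<exists>l g. k = length ?qs + l \<and> isform l g \<and> (\<forall>p. f p = (\<Prod>q\<leftarrow>?qs. line_form q p) * g p)"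
    then obtain l g where g: "k = 6 + l" "isform l g" "\<And>p. f p = - f6 p * g p" unfolding pr by auto
    \<comment> \<open>The product of the six linear forms is -f6 because of the factor for (1, 0);
      the sign moves into the quotient.\<close>
    define h where "h p = - 1 * g p" for p
    have h: "isform l h" "\<And>p. f p = f6 p * h p"
      using g(2,3) unfolding h_def[abs_def] by (auto intro!: isform_cmult[of _ _ "-1", simplified] simp: h_def)
    \<comment> \<open>\<open>f6\<close> changes sign under A, so f6 p * (h (A p) + s * h p) = 0 and
      \<open>f6\<close> cancels.\<close>
    have semi: "h (A *v p) = - s * h p" if fA: "\<And>p. f (A *v p) = s * f p" and f6A: "\<And>p. f6 (A *v p) = - f6 p" for A p
    proof -
      have "isform l (\<lambda>p. h (A *v p) + s * h p)"
        by (intro isform_add isform_cmult isform_compose h)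
      moreover have "f6 p * (h (A *v p) + s * h p) = 0" for p
        using fA[of p] unfolding h(2) f6A by algebra
      ultimately have "h (A *v p) + s * h p = 0" by (rule isform_zero_if_f6_mult)
      then show ?thesis by (simp add: add_eq_0_iff2)
    qed
    have "Inv l (-s) h"
      using h(1) semi[OF fD] semi[OF fH] Inv_f6 unfolding Inv_def by simp
    then show ?thesis using g(1) h(2) by blast
  qed blast
qed

lemma Inv_zero_step:
  assumes "Inv k s f" "eps ^ k \<noteq> s"
  shows "(\<forall>p. f p = 0) \<or> (\<exists>l g. k = 6 + l \<and> Inv l (-s) g \<and> (\<forall>p. f p = f6 p * g p))"
  by (rule Inv_step[OF assms(1) Inv_vertex[OF assms]])

text \<open>The ratio eps^k / s is multiplied by -eps^(-6) = -i at each division by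
  \<open>f6\<close>. Starting from 1 it becomes -i, -1, i, so the first three quotients vanish at
  the vertex again, and only the fourth may be nonzero there.\<close>

lemma Inv_step4:
  assumes f: "Inv k s f" and v: "f (vec2 1 0) = 0" and s: "eps ^ k = s"
  shows "(\<forall>p. f p = 0) \<or> (\<exists>l g. k = 24 + l \<and> Inv l s g \<and> (\<forall>p. f p = f6 p ^ 4 * g p))"
proof -
  have e6: "eps ^ 6 = - \<i>" using eps4 eps_simps(1) by algebra
  have e12: "eps ^ 12 = -1" using eps4 by algebra
  have e18: "eps ^ 18 = \<i>" using eps4 eps_simps(1) by algebra
  have nz: "eps ^ l \<noteq> 0" for l using eps_simps(5) by simp
  have im: "\<i> \<noteq> 1" "- \<i> \<noteq> 1" "\<i> \<noteq> -1" by (simp_all add: complex_eq_iff)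
  show ?thesis
  proof (cases "\<forall>p. f p = 0")
    case False
    then obtain l1 g1 where 1: "k = 6 + l1" "Inv l1 (-s) g1" "\<And>p. f p = f6 p * g1 p"
      using Inv_step[OF f v] by blast
    have "eps ^ l1 \<noteq> - s"
    proof
      assume "eps ^ l1 = - s"
      then have "eps ^ 6 * eps ^ l1 = - (eps ^ l1)" using s unfolding 1 by (simp add: power_add)
      then have "eps ^ 6 = -1" using nz[of l1] by (metis mult_cancel_right mult_minus1)
      then show False using e6 im by simp
    qed
    with Inv_zero_step[OF 1(2)] False 1(3) obtain l2 g2 where 2: "l1 = 6 + l2" "Inv l2 s g2" "\<And>p. g1 p = f6 p * g2 p"
      by auto
    have "eps ^ l2 \<noteq> s"
    proof
      assume "eps ^ l2 = s"
      then have "eps ^ 12 * eps ^ l2 = eps ^ l2" using s unfolding 1 2 by (simp add: power_add flip: mult.assoc)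
      then have "eps ^ 12 = 1" using eps_simps(5) by simp
      then show False using e12 by simp
    qed
    with Inv_zero_step[OF 2(2)] False 1(3) 2(3) obtain l3 g3 where 3: "l2 = 6 + l3" "Inv l3 (-s) g3" "\<And>p. g2 p = f6 p * g3 p"
      by auto
    have "eps ^ l3 \<noteq> - s"
    proof
      assume "eps ^ l3 = - s"
      then have "eps ^ 18 * eps ^ l3 = - (eps ^ l3)" using s unfolding 1 2 3 by (simp add: power_add flip: mult.assoc)
      then have "eps ^ 18 = -1" using nz[of l3] by (metis mult_cancel_right mult_minus1)
      then show False using e18 im by simp
    qed
    with Inv_zero_step[OF 3(2)] False 1(3) 2(3) 3(3) obtain l4 g4 where 4: "l3 = 6 + l4" "Inv l4 s g4" "\<And>p. g3 p = f6 p * g4 p"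
      by auto
    have "k = 24 + l4" "\<And>p. f p = f6 p ^ 4 * g4 p"
      using 1 2 3 4 by (auto simp: power4_eq_xxxx)
    then show ?thesis using 4(2) by blast
  qed simp
qed

text \<open>To be applied with E = 1 and E = \<open>f12\<close>. Both E and \<open>f8\<close> are 1
  at (1, 0), so a multiple of E f8^n removes the vertex value of f. Dividing by f6^4, of degree 24 =
  3 * 8, then lowers n by 3; for n < 3 the quotient has degree below e and vanishes by
  \<open>base\<close>.\<close>

lemma Inv_structure:
  assumes E: "Inv e s E" "E (vec2 1 0) = 1" "eps ^ e = s"
    and base: "\<And>k f p. Inv k s f \<Longrightarrow> k < e \<Longrightarrow> k mod 8 = e mod 8 \<Longrightarrow> f p = 0"
    and f: "Inv (e + 8 * n) s f"
  shows "\<exists>c. \<forall>p. f p = E p * (\<Sum>i\<le>n div 3. c i * f8 p ^ (n - 3 * i) * f6 p ^ (4 * i))"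
  using f
proof (induction n arbitrary: f rule: less_induct)
  case (less n)
  define c0 where "c0 = f (vec2 1 0)"
  define f1 where "f1 p = f p - c0 * (E p * f8 p ^ n)" for p
  have "Inv (e + 8 * n) s (\<lambda>p. E p * f8 p ^ n)"
    using Inv_mult[OF E(1) Inv_power[OF Inv_f8, of n]] by (simp add: mult.commute)
  then have f1: "Inv (e + 8 * n) s f1"
    unfolding f1_def[abs_def] by (rule Inv_diff[OF less.prems])
  have "f1 (vec2 1 0) = 0" by (simp add: f1_def c0_def E f8_def)
  moreover have "eps ^ (e + 8 * n) = s" by (simp add: power_add power_mult E eps_simps)
  ultimately have "(\<forall>p. f1 p = 0) \<or> (\<exists>l g. e + 8 * n = 24 + l \<and> Inv l s g \<and> (\<forall>p. f1 p = f6 p ^ 4 * g p))"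
    using Inv_step4[OF f1] by blast
  moreover have zero: "?case" if z: "\<forall>p. f1 p = 0"
  proof -
    have "f p = E p * (\<Sum>i\<le>n div 3. (if i = 0 then c0 else 0) * f8 p ^ (n - 3 * i) * f6 p ^ (4 * i))" for p
      using z[rule_format, of p] by (simp add: f1_def if_distrib[of "\<lambda>x. x * _"] sum.delta' cong: if_cong)
    then show ?thesis by (intro exI[of _ "\<lambda>i. if i = 0 then c0 else 0"] allI)
  qed
  ultimately show ?case
  proof
    assume "\<exists>l g. e + 8 * n = 24 + l \<and> Inv l s g \<and> (\<forall>p. f1 p = f6 p ^ 4 * g p)"
    then obtain l g where g: "e + 8 * n = 24 + l" "Inv l s g" "\<And>p. f1 p = f6 p ^ 4 * g p" by blast
    show ?case
    proof (cases "n \<ge> 3")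
      case True
      then have l: "l = e + 8 * (n - 3)" using g(1) by simp
      obtain c where c: "\<And>p. g p = E p * (\<Sum>i\<le>(n-3) div 3. c i * f8 p ^ (n - 3 - 3 * i) * f6 p ^ (4 * i))"
        using less.IH[of "n-3" g] g(2) True unfolding l by auto
      have n3: "n div 3 = Suc ((n-3) div 3)" using True by (simp add: le_div_geq)
      have "f p = E p * (\<Sum>i\<le>n div 3. (if i = 0 then c0 else c (i-1)) * f8 p ^ (n - 3 * i) * f6 p ^ (4 * i))" for p
      proof -
        have "f p = c0 * (E p * f8 p ^ n) + f6 p ^ 4 * g p" using g(3)[of p] by (simp add: f1_def algebra_simps)
        also have "f6 p ^ 4 * g p = E p * (\<Sum>i\<le>(n-3) div 3. c i * f8 p ^ (n - 3 * Suc i) * f6 p ^ (4 * Suc i))"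
          unfolding c sum_distrib_left by (intro sum.cong refl) (simp add: power_add mult_ac)
        finally show ?thesis
          unfolding n3 sum.atMost_Suc_shift by (simp add: algebra_simps)
      qed
      then show ?thesis by (intro exI[of _ "\<lambda>i. if i = 0 then c0 else c (i-1)"] allI)
    next
      case False
      have "l mod 8 = e mod 8"
      proof -
        have "e mod 8 = (e + 8 * n) mod 8" by simp
        also have "\<dots> = (l + 8 * 3) mod 8" using g(1) by (simp only: add.commute[of 24 l]) simp
        finally show ?thesis by (simp only: mod_mult_self2)
      qed
      then have "g p = 0" for p using base[OF g(2)] g(1) False by simp
      then show ?thesis using zero g(3) by simp
    qed
  qed
qed

text \<open>The case that the vertex eigenvalue cannot decide, since eps^4 = -1 = s. The symmetries
  express the values at all six vertices through \<open>d 0\<close>, and these values determine the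
  five coefficients.\<close>

lemma Inv_4_zero: assumes "Inv 4 (-1) f" shows "f p = 0"
proof -
  obtain d where d: "f = form 4 d" using assms unfolding Inv_def isform_def by blast
  have e: "f q = d 0 * (q$2)^4 + d 1 * (q$1 * (q$2)^3) + d 2 * ((q$1)\<^sup>2 * (q$2)\<^sup>2) + d 3 * ((q$1)^3 * q$2) + d 4 * (q$1)^4" for q
    unfolding d form_def by (simp add: eval_nat_numeral mult_ac)
  have fH: "f (Hg *v q) = - f q" and fD: "f (Dg *v q) = - f q" for q using assms by (auto simp: Inv_def)
  have hom: "f (t *s q) = t ^ 4 * f q" for t q using isform_homog[of 4 f t q] assms by (simp add: Inv_def)
  have r4: "rt ^ 4 = 1/4" using rt_simps(1) by algebra
  \<comment> \<open>Clearing the factor rt^4 = 1/4 turns the sign -1 into -4.\<close>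
  have H: "f (vec2 (x+y) (y-x)) = - 4 * f (vec2 x y)" for x y
    using fH[of "vec2 x y"] unfolding Hg_vec hom r4 by simp
  have D: "f (vec2 (\<i> * x) y) = f (vec2 x y)" for x y
  proof -
    have "cnj eps ^ 4 = -1" using arg_cong[OF eps4, of cnj] by simp
    then show ?thesis using fD[of "vec2 x y"] hom by (simp add: Dg_vec2)
  qed
  have a: "f (vec2 1 0) = d 4" "f (vec2 0 1) = d 0" by (simp_all add: e)
  have s1: "f (vec2 1 (-1)) = - 4 * d 4" using H[of 1 0] a by simp
  have s2: "f (vec2 1 1) = - 4 * d 0" using H[of 0 1] a by simp
  have s3: "f (vec2 2 0) = - 4 * f (vec2 1 1)" using H[of 1 1] by simp
  have "f (vec2 2 0) = 16 * d 4" by (simp add: e)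
  then have d40: "d 4 = d 0" using s2 s3 by simp
  have t: "f (vec2 \<i> 1) = f (vec2 1 1)" "f (vec2 (-1) 1) = f (vec2 \<i> 1)" "f (vec2 (-\<i>) 1) = f (vec2 (-1) 1)"
    using D[of 1 1] D[of \<i> 1] D[of "-1" 1] by simp_all
  have l1: "d 0 + d 1 + d 2 + d 3 + d 4 = - 4 * d 0" using s2 by (simp add: e)
  have t': "f (vec2 (-1) 1) = - 4 * d 0" "f (vec2 \<i> 1) = - 4 * d 0" "f (vec2 (-\<i>) 1) = - 4 * d 0"
    using t s2 by (simp_all only:)
  have l2: "d 0 - d 1 + d 2 - d 3 + d 4 = - 4 * d 0" using t'(1) by (simp add: e)
  have l3: "d 0 + \<i> * d 1 - d 2 - \<i> * d 3 + d 4 = - 4 * d 0" using t'(2) by (simp add: e algebra_simps power3_eq_cube)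
  have l4: "d 0 - \<i> * d 1 - d 2 + \<i> * d 3 + d 4 = - 4 * d 0" using t'(3) by (simp add: e algebra_simps power3_eq_cube)
  have "d 2 = 0" using l1 l2 l3 l4 by algebra
  moreover have "d 0 = 0" using l1 l2 l3 l4 d40 by algebra
  moreover have "d 1 + d 3 = 0" using l1 l2 by algebra
  moreover have "\<i> * (d 1 - d 3) = 0" using l3 l4 by algebra
  ultimately have "d 0 = 0 \<and> d 1 = 0 \<and> d 2 = 0 \<and> d 3 = 0 \<and> d 4 = 0"
    using d40 by auto
  then show ?thesis by (simp add: e)
qed

section \<open>The invariants as monomials in the basic forms\<close>

text \<open>The factor common to all invariant forms of degree 2m with r = m mod 4: r forced
  divisions by \<open>f6\<close>, and \<open>f12\<close> when they leave the character -1. Higher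
  powers of \<open>f12\<close> are redundant in view of f12^2 = f8^3 - 108 f6^4.\<close>

definition prefactor :: "nat \<Rightarrow> pt \<Rightarrow> complex" where
  "prefactor r p = f6 p ^ r * f12 p ^ (r mod 2)"

text \<open>Half the degree of \<open>prefactor r\<close>: 0, 9, 6, 15 for r = 0, 1, 2, 3.\<close>

definition offset :: "nat \<Rightarrow> nat" where "offset r = 3 * r + 6 * (r mod 2)"

definition inv_monom :: "nat \<Rightarrow> nat \<Rightarrow> nat \<Rightarrow> pt \<Rightarrow> complex" where
  "inv_monom r n i p = prefactor r p * f8 p ^ (n - 3 * i) * f6 p ^ (4 * i)"

lemma Inv_structure_0:
  assumes "Inv (8 * n) 1 f"
  shows "\<exists>c. \<forall>p. f p = (\<Sum>i\<le>n div 3. c i * f8 p ^ (n - 3 * i) * f6 p ^ (4 * i))"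
proof -
  have "Inv 0 1 (\<lambda>p. 1)" using isform_monom[of 0 0] by (simp add: Inv_def)
  from Inv_structure[OF this, of n f] assms show ?thesis by simp
qed

text \<open>The only degree below 12 congruent to 4 modulo 8 is 4, so \<open>Inv_4_zero\<close> is
  all that the descent from E = \<open>f12\<close> requires.\<close>

lemma Inv_structure_12:
  assumes "Inv k (-1) f" "k mod 8 = 4"
  shows "(\<forall>p. f p = 0) \<or> (\<exists>n c. k = 12 + 8 * n \<and> (\<forall>p. f p = f12 p * (\<Sum>i\<le>n div 3. c i * f8 p ^ (n - 3 * i) * f6 p ^ (4 * i))))"
proof (cases "k = 4")
  case True
  then show ?thesis using Inv_4_zero assms by blast
next
  case False
  have k8: "k = 8 * (k div 8) + 4" using mult_div_mod_eq[of 8 k] assms(2) by simp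
  with False have "k div 8 \<noteq> 0" by auto
  then obtain n where "k div 8 = Suc n" using not0_implies_Suc by blast
  then have n: "k = 12 + 8 * n" using k8 by simp
  have e12: "eps ^ 12 = -1" using eps4 by algebra
  have "f12 (vec2 1 0) = 1" by (simp add: f12_def)
  moreover have "h p = 0" if "Inv l (-1) h" "l < 12" "l mod 8 = 12 mod 8" for l h p
  proof -
    have "l = 8 * (l div 8) + 4" using mult_div_mod_eq[of 8 l] that(3) by simp
    then obtain u where u: "l = 8 * u + 4" by blast
    then have "u = 0" using that(2) by simp
    then have "l = 4" using u by simp
    then show ?thesis using Inv_4_zero that(1) by blast
  qed
  ultimately show ?thesis
    using Inv_structure[OF Inv_f12 _ e12, of n f] assms(1) n by blast
qed

lemma eps_even_power: "eps ^ (2 * m) = \<i> ^ m"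
  by (simp add: power_mult eps_simps)

lemma i_power_mod: "\<i> ^ m = \<i> ^ (m mod 4)"
proof -
  have "\<i> ^ m = \<i> ^ (4 * (m div 4) + m mod 4)" by simp
  also have "\<dots> = \<i> ^ (m mod 4)" by (simp only: power_add power_mult) simp
  finally show ?thesis .
qed

lemma mod_4_shift: assumes "m = 3 + l" shows "l mod 4 = Suc (m mod 4) mod 4"
proof -
  have "l mod 4 = (l + 4) mod 4" by simp
  also have "l + 4 = Suc m" using assms by simp
  finally show ?thesis by (simp only: mod_Suc_eq)
qed

lemma double_mod_8: "2 * l mod 8 = 2 * (l mod 4)" for l :: nat
  by (simp add: mult_mod_right)

text \<open>Exactly m mod 4 divisions by \<open>f6\<close> are forced, because i^l differs from the
  current sign at each of them. Each lowers the half degree l by 3 and so raises its class modulo 4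
  by 1; the process ends in class 0 with sign 1 or in class 2 with sign -1.\<close>

lemma Inv_expansion:
  assumes f: "Inv (2 * m) 1 f"
  shows "(\<forall>p. f p = 0) \<or> (\<exists>n c. m = 4 * n + offset (m mod 4) \<and> (\<forall>p. f p = (\<Sum>i\<le>n div 3. c i * inv_monom (m mod 4) n i p)))"
proof (cases "\<forall>p. f p = 0")
  case nz: False
  have step: "\<exists>l' g. l = 3 + l' \<and> Inv (2 * l') (-s) g \<and> (\<forall>p. h p = f6 p * g p)"
    if h: "Inv (2 * l) s h" "\<i> ^ (l mod 4) \<noteq> s" "\<not> (\<forall>p. h p = 0)" for l s h
  proof -
    have "eps ^ (2 * l) \<noteq> s" using h(2) by (simp only: eps_even_power i_power_mod[of l]) simp
    from Inv_zero_step[OF h(1) this] h(3) obtain l2 g where g: "2 * l = 6 + l2" "Inv l2 (-s) g" "\<And>p. h p = f6 p * g p"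
      by blast
    have "l2 = 2 * (l - 3)" "l = 3 + (l - 3)" using g(1) by simp_all
    then show ?thesis using g(2,3) by metis
  qed
  have im: "\<i> \<noteq> 1" "- \<i> \<noteq> 1" "\<i> \<noteq> -1" "- \<i> \<noteq> -1" by (simp_all add: complex_eq_iff)
  have i3: "\<i> ^ 3 = - \<i>" by (simp add: power3_eq_cube)
  have "m mod 4 < 4" by simp
  then consider "m mod 4 = 0" | "m mod 4 = 1" | "m mod 4 = 2" | "m mod 4 = 3" by linarith
  then show ?thesis
  proof cases
    case 1
    define n where "n = m div 4"
    have m: "m = 4 * n" using 1 mult_div_mod_eq[of 4 m] by (simp add: n_def)
    then have "Inv (8 * n) 1 f" using f by simp
    from Inv_structure_0[OF this] obtain c where
      "\<And>p. f p = (\<Sum>i\<le>n div 3. c i * f8 p ^ (n - 3 * i) * f6 p ^ (4 * i))" by blast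
    then have "\<And>p. f p = (\<Sum>i\<le>n div 3. c i * inv_monom (m mod 4) n i p)"
      by (simp add: inv_monom_def prefactor_def 1 mult_ac)
    then show ?thesis using m 1 by (intro disjI2 exI[of _ n] exI[of _ c]) (simp add: offset_def)
  next
    case 2
    obtain l g where g: "m = 3 + l" "Inv (2 * l) (-1) g" "\<And>p. f p = f6 p * g p"
      using step[OF f _ nz] 2 im by auto
    have "2 * l mod 8 = 4" using double_mod_8[of l] mod_4_shift[OF g(1)] 2 by simp
    from Inv_structure_12[OF g(2) this] nz g(3) obtain n c where n: "2 * l = 12 + 8 * n"
      "\<And>p. g p = f12 p * (\<Sum>i\<le>n div 3. c i * f8 p ^ (n - 3 * i) * f6 p ^ (4 * i))" by auto
    have "\<And>p. f p = (\<Sum>i\<le>n div 3. c i * inv_monom (m mod 4) n i p)"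
      unfolding g(3) n(2) by (simp add: inv_monom_def prefactor_def 2 mult_ac sum_distrib_left)
    moreover have "m = 4 * n + offset (m mod 4)" using n(1) g(1) 2 by (simp add: offset_def)
    ultimately show ?thesis by blast
  next
    case 3
    obtain l g where g: "m = 3 + l" "Inv (2 * l) (-1) g" "\<And>p. f p = f6 p * g p"
      using step[OF f _ nz] 3 by auto
    have l4: "l mod 4 = 3" using mod_4_shift[OF g(1)] 3 by simp
    then obtain l2 h where h: "l = 3 + l2" "Inv (2 * l2) 1 h" "\<And>p. g p = f6 p * h p"
      using step[OF g(2)] nz g(3) im i3 by auto
    define n where "n = l2 div 4"
    have "l2 mod 4 = 0" using mod_4_shift[OF h(1)] l4 by simp
    then have l2: "l2 = 4 * n" using mult_div_mod_eq[of 4 l2] by (simp add: n_def)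
    have "Inv (8 * n) 1 h" using h(2) l2 by simp
    from Inv_structure_0[OF this] obtain c where c:
      "\<And>p. h p = (\<Sum>i\<le>n div 3. c i * f8 p ^ (n - 3 * i) * f6 p ^ (4 * i))" by blast
    have "\<And>p. f p = (\<Sum>i\<le>n div 3. c i * inv_monom (m mod 4) n i p)"
      unfolding g(3) h(3) c by (simp add: inv_monom_def prefactor_def 3 mult_ac sum_distrib_left power2_eq_square)
    moreover have "m = 4 * n + offset (m mod 4)" using l2 g(1) h(1) 3 by (simp add: offset_def)
    ultimately show ?thesis by blast
  next
    case 4
    obtain l g where g: "m = 3 + l" "Inv (2 * l) (-1) g" "\<And>p. f p = f6 p * g p"
      using step[OF f _ nz] 4 im i3 by auto
    have l4: "l mod 4 = 0" using mod_4_shift[OF g(1)] 4 by simp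
    then obtain l2 h where h: "l = 3 + l2" "Inv (2 * l2) 1 h" "\<And>p. g p = f6 p * h p"
      using step[OF g(2)] nz g(3) by auto
    have l24: "l2 mod 4 = 1" using mod_4_shift[OF h(1)] l4 by simp
    then obtain l3 q where q: "l2 = 3 + l3" "Inv (2 * l3) (-1) q" "\<And>p. h p = f6 p * q p"
      using step[OF h(2)] nz g(3) h(3) im by auto
    have "2 * l3 mod 8 = 4" using double_mod_8[of l3] mod_4_shift[OF q(1)] l24 by simp
    from Inv_structure_12[OF q(2) this] nz g(3) h(3) q(3) obtain n c where n: "2 * l3 = 12 + 8 * n"
      "\<And>p. q p = f12 p * (\<Sum>i\<le>n div 3. c i * f8 p ^ (n - 3 * i) * f6 p ^ (4 * i))" by auto
    have "\<And>p. f p = (\<Sum>i\<le>n div 3. c i * inv_monom (m mod 4) n i p)"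
      unfolding g(3) h(3) q(3) n(2) by (simp add: inv_monom_def prefactor_def 4 mult_ac sum_distrib_left power3_eq_cube)
    moreover have "m = 4 * n + offset (m mod 4)" using n(1) g(1) h(1) q(1) 4 by (simp add: offset_def)
    ultimately show ?thesis by blast
  qed
qed simp

section \<open>Arithmetic of \<open>ktilde\<close> and the exponents of the basis\<close>

lemma div_sum_12:
  fixes Q C :: int
  shows "(12 * Q + C) div 2 + (12 * Q + C) div 3 + (12 * Q + C) div 4 - (12 * Q + C)
    = Q + (C div 2 + C div 3 + C div 4 - C)"
proof -
  have "(2 * (6 * Q) + C) div 2 = 6 * Q + C div 2" "(3 * (4 * Q) + C) div 3 = 4 * Q + C div 3" "(4 * (3 * Q) + C) div 4 = 3 * Q + C div 4"
    by (rule div_mult_self4, simp)+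
  then have d: "(12 * Q + C) div 2 = 6 * Q + C div 2" "(12 * Q + C) div 3 = 4 * Q + C div 3" "(12 * Q + C) div 4 = 3 * Q + C div 4"
    by (simp_all only: mult.assoc[symmetric] mult_numeral_left_semiring_numeral numeral_times_numeral semiring_norm)
  \<comment> \<open>6 + 4 + 3 - 12 = 1: raising k/2 by 12 raises \<open>ktilde\<close> by exactly
    1.\<close>
  have "(6 * q + a) + (4 * q + b) + (3 * q + d) - (12 * q + e) = q + (a + b + d - e)" for q a b d e :: int
    by simp
  then show ?thesis unfolding d .
qed

text \<open>By the period 12 it suffices to treat m = 4t + d with t < 3 and d one of the four
  offsets. In these twelve cases \<open>ktilde\<close> is 0, and m has residue t modulo 3 because
  every offset is divisible by 3.\<close>

lemma ktilde_offset:
  assumes "m = 4 * n + offset (m mod 4)"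
  shows "ktilde (2 * m) = int (n div 3)" "m mod 3 = n mod 3"
proof -
  have "m mod 4 < 4" by simp
  then consider "m mod 4 = 0" | "m mod 4 = 1" | "m mod 4 = 2" | "m mod 4 = 3" by linarith
  then obtain d where d: "m = 4 * n + d" "d = 0 \<or> d = 9 \<or> d = 6 \<or> d = 15"
    using assms by cases (simp_all add: offset_def)
  define q t where qt: "q = n div 3" "t = n mod 3"
  have "t < 3" unfolding qt by simp
  then have t: "t = 0 \<or> t = 1 \<or> t = 2" by linarith
  have n: "n = 3 * q + t" unfolding qt by simp
  define c where "c = 4 * t + d"
  have c: "int c div 2 + int c div 3 + int c div 4 - int c = 0 \<and> c mod 3 = t"
    using t d(2) unfolding c_def by (elim disjE) simp_all
  have m: "m = 12 * q + c" using d(1) n by (simp add: c_def)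
  have im: "int m = 12 * int q + int c" using m by simp
  have "int m div 2 + int m div 3 + int m div 4 - int m = int q"
    unfolding im div_sum_12 using c by simp
  then show "ktilde (2 * m) = int (n div 3)" by (simp add: ktilde_def Let_def qt)
  have "m = c + 3 * (4 * q)" using m by simp
  then have "m mod 3 = c mod 3" by (simp only: mod_mult_self2)
  then show "m mod 3 = n mod 3" using c qt by simp
qed

text \<open>Needed for the dimension formula on an empty index range: kt + 1 is the number of
  indices only if kt is at least -1.\<close>

lemma ktilde_ge: "ktilde k \<ge> -1"
proof -
  define m x y z where d: "m = int (k div 2)" "x = m div 2" "y = m div 3" "z = m div 4"
  have "2 * x = m - m mod 2" "3 * y = m - m mod 3" "4 * z = m - m mod 4"
    unfolding d(2-4) by (simp_all only: minus_mod_eq_mult_div)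
  moreover have "m mod 2 < 2" "m mod 3 < 3" "m mod 4 < 4" by simp_all
  ultimately have "2 * x \<ge> m - 1" "3 * y \<ge> m - 2" "4 * z \<ge> m - 3" by linarith+
  moreover have "m \<ge> 0" by (simp add: d)
  ultimately have "x + y + z - m \<ge> -1" by linarith
  then show ?thesis by (simp add: ktilde_def Let_def d)
qed

text \<open>The offsets 9, 6, 15 are 1 + 8, 2 + 4, 3 + 12, which lowers m div 4 by 2, 1, 3. The
  values of m too small for this are 1, 5, then 2, then 3, 7, 11, and all of them have
  \<open>ktilde\<close> equal to -1.\<close>

lemma ktilde_nonneg_offset:
  assumes "ktilde (2 * m) \<ge> 0"
  obtains n where "m = 4 * n + offset (m mod 4)"
proof -
  have k: "int m div 2 + int m div 3 + int m div 4 - int m \<ge> 0" using assms by (simp add: ktilde_def Let_def)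
  define q where "q = m div 4"
  have m: "m = 4 * q + m mod 4" unfolding q_def by (simp only: mult_div_mod_eq)
  have "m mod 4 < 4" by simp
  then consider "m mod 4 = 0" | "m mod 4 = 1" | "m mod 4 = 2" | "m mod 4 = 3" by linarith
  then show ?thesis
  proof cases
    case 1 then show ?thesis using that[of q] m by (simp add: offset_def)
  next
    case 2
    have "q \<noteq> 0" "q \<noteq> 1" using k m 2 by auto
    then show ?thesis using that[of "q - 2"] m 2 by (simp add: offset_def)
  next
    case 3
    have "q \<noteq> 0" using k m 3 by auto
    then show ?thesis using that[of "q - 1"] m 3 by (simp add: offset_def)
  next
    case 4
    have "q \<noteq> 0" "q \<noteq> 1" "q \<noteq> 2" using k m 4 by auto
    then show ?thesis using that[of "q - 3"] m 4 by (simp add: offset_def)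
  qed
qed

text \<open>The last two factors of \<open>Bfun\<close> are powers of f6^2 and of f6 f12. The index
  is reversed because the exponent of \<open>f8\<close> grows with the index of \<open>Bfun\<close>,
  whereas \<open>inv_monom\<close> counts the powers of f6^4.\<close>

lemma Bfun_eq_inv_monom:
  assumes m: "m = 4 * n + offset (m mod 4)" and i: "i \<le> n div 3"
  shows "Bfun (2 * m) (int (n div 3) - int i) p = inv_monom (m mod 4) n i p"
proof -
  have kt: "ktilde (2 * m) = int (n div 3)" and m3: "m mod 3 = n mod 3" using ktilde_offset[OF m] by auto
  let ?r = "m mod 4"
  have e8: "nat (3 * (int (n div 3) - int i) + int m mod 3) = n - 3 * i"
  proof -
    have "int m mod 3 = int (n mod 3)" using m3 by (metis of_nat_mod of_nat_numeral)
    moreover have "int n = 3 * int (n div 3) + int (n mod 3)"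
      using arg_cong[OF mult_div_mod_eq[of 3 n], of int] by (simp only: of_nat_add of_nat_mult of_nat_numeral)
    moreover have "3 * i \<le> n" using i by simp
    then have "int (n - 3 * i) = int n - 3 * int i" by (simp add: of_nat_diff)
    ultimately have "3 * (int (n div 3) - int i) + int m mod 3 = int (n - 3 * i)" by (simp only: right_diff_distrib)
    then show ?thesis by (simp only: nat_int)
  qed
  have "?r < 4" by simp
  then have r: "?r = 0 \<or> ?r = 1 \<or> ?r = 2 \<or> ?r = 3" by linarith
  have im4: "int m mod 4 = int ?r" by (simp add: zmod_int)
  have im2: "int m mod 2 = int (?r mod 2)" by (simp add: zmod_int mod_mod_cancel)
  have e6: "nat (2 * int i + (int m mod 4 - int m mod 2) div 2) = 2 * i + (?r - ?r mod 2) div 2"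
    unfolding im4 im2 using r by (elim disjE) simp_all
  have e2: "nat (int m mod 2) = ?r mod 2" unfolding im2 by (rule nat_int)
  \<comment> \<open>\<open>f6\<close> occurs twice in the second factor of \<open>Bfun\<close> and
    once in the third; together the exponent is r + 4 i.\<close>
  have exp: "2 * (2 * i + (?r - ?r mod 2) div 2) + ?r mod 2 = ?r + 4 * i"
    using r by (elim disjE) simp_all
  have int_m: "2 * m div 2 = m" by simp
  have ii: "int (n div 3) - (int (n div 3) - int i) = int i" by simp
  define a b where ab: "a = p$1" "b = p$2"
  have g6: "a^10 * b^2 - 2 * a^6 * b^6 + a^2 * b^10 = f6 p ^ 2" unfolding f6_def ab[symmetric] by algebra
  have g12: "a^17 * b - 34 * a^13 * b^5 + 34 * a^5 * b^13 - a * b^17 = f6 p * f12 p" unfolding f6_def f12_def ab[symmetric] by algebra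
  have g8: "a^8 + 14 * a^4 * b^4 + b^8 = f8 p" unfolding f8_def ab[symmetric] ..
  have "Bfun (2 * m) (int (n div 3) - int i) p =
     f8 p ^ (n - 3 * i) * (f6 p ^ 2) ^ (2 * i + (?r - ?r mod 2) div 2) * (f6 p * f12 p) ^ (?r mod 2)"
    unfolding Bfun_def Let_def int_m kt ab[symmetric] g6 g12 g8 ii e8 e6 e2 ..
  also have "\<dots> = f8 p ^ (n - 3 * i) * f6 p ^ (2 * (2 * i + (?r - ?r mod 2) div 2) + ?r mod 2) * f12 p ^ (?r mod 2)"
    by (simp only: power_mult power_add power_mult_distrib mult_ac)
  also have "\<dots> = inv_monom ?r n i p"
    unfolding exp inv_monom_def prefactor_def by (simp add: power_add mult_ac)
  finally show ?thesis .
qed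

lemma power_mod_2: "(y::complex)\<^sup>2 = 1 \<Longrightarrow> y ^ r = y ^ (r mod 2)"
  by (subst mult_div_mod_eq[of 2 r, symmetric]) (simp only: power_add power_mult, simp)

lemma Inv_inv_monom:
  assumes "3 * i \<le> n" "r < 4"
  shows "Inv (2 * (4 * n + offset r)) 1 (inv_monom r n i)"
proof -
  have "Inv (r * 6 + (r mod 2) * 12 + (n - 3 * i) * 8 + (4 * i) * 6) ((-1)^r * (-1)^(r mod 2) * 1^(n - 3*i) * (-1)^(4*i)) (inv_monom r n i)"
    unfolding inv_monom_def[abs_def] prefactor_def
    by (intro Inv_mult Inv_power Inv_f6 Inv_f8 Inv_f12)
  moreover have "(-1)^r * (-1)^(r mod 2) * 1^(n - 3*i) * (-1)^(4*i) = (1::complex)"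
    by (simp add: power_mod_2[of "-1", symmetric] power_mult flip: power_mult_distrib)
  moreover have "r * 6 + (r mod 2) * 12 + (n - 3 * i) * 8 + (4 * i) * 6 = 2 * (4 * n + offset r)"
    using assms by (simp add: offset_def)
  ultimately show ?thesis by simp
qed

text \<open>\<open>f6\<close> and \<open>f12\<close> are both multiplied by x^4, which is 1 or -1,
  and their joint exponent r + (r mod 2) + 4 i is even.\<close>

lemma inv_monom_diag:
  assumes "x ^ 8 = 1" "x * cnj x = 1" shows "inv_monom r n i (su x 0 *v p) = inv_monom r n i p"
proof -
  have v: "su x 0 *v p = vec2 (x * p$1) (cnj x * p$2)" by (simp add: su_vec)
  have x4: "(x ^ 4)\<^sup>2 = 1" using assms(1) by (simp flip: power_mult)
  have "(x ^ 4 * a) ^ r * (x ^ 4 * b) ^ (r mod 2) = a ^ r * b ^ (r mod 2)" for a b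
  proof -
    have "(x ^ 4) ^ r * (x ^ 4) ^ (r mod 2) = ((x ^ 4)\<^sup>2) ^ (r mod 2)"
      unfolding power_mod_2[OF x4, of r] by (simp only: power2_eq_square power_mult_distrib)
    then have "(x ^ 4) ^ r * (x ^ 4) ^ (r mod 2) = 1" by (simp only: x4 power_one)
    then show ?thesis by (simp only: power_mult_distrib) (metis mult.assoc mult.commute mult_1)
  qed
  moreover have "(x ^ 4 * a) ^ (4 * i) = a ^ (4 * i)" for a
    using power_mod_2[OF x4, of "4 * i"] by (simp add: power_mult_distrib del: power_mult)
  ultimately show ?thesis
    unfolding inv_monom_def prefactor_def v f6_diag[OF assms(2,1)] f8_diag[OF assms(2,1)] f12_diag[OF assms(2,1)] by simp
qed

lemma inv_monom_Ostar:
  assumes "3 * i \<le> n" "r < 4" "g \<in> Ostar" shows "inv_monom r n i (g *v p) = inv_monom r n i p"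
  using Ostar_invariant[of "inv_monom r n i", OF inv_monom_diag _ assms(3)] Inv_inv_monom[OF assms(1,2)] by (auto simp: Inv_def)

text \<open>Dividing by prefactor * f8^n leaves a polynomial in the degree 0 quotient s = f6^4 /
  f8^3. Along (y, 1) with y real, s takes all values of an interval by the intermediate value
  theorem, so the polynomial is 0.\<close>

lemma inv_monom_independent:
  assumes z: "\<And>p. (\<Sum>i\<le>n div 3. c i * inv_monom r n i p) = 0" and i: "i \<le> n div 3"
  shows "c i = 0"
proof -
  define r6 r8 r12 :: "real \<Rightarrow> real" where
    rd: "r6 = (\<lambda>y. y * (y^4 - 1))" "r8 = (\<lambda>y. y^8 + 14 * y^4 + 1)" "r12 = (\<lambda>y. y^12 - 33 * y^8 - 33 * y^4 + 1)"
  have f: "f6 (vec2 (of_real y) 1) = of_real (r6 y)" "f8 (vec2 (of_real y) 1) = of_real (r8 y)"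
    "f12 (vec2 (of_real y) 1) = of_real (r12 y)" for y
    by (simp_all add: f6_def f8_def f12_def rd)
  have r8: "r8 y > 0" for y by (simp add: rd add_nonneg_pos)
  \<comment> \<open>Any small bound would do in place of 1/10; this one makes 33 y^8 + 33 y^4 < 1
    and so keeps \<open>r12\<close> positive.\<close>
  have nz: "r6 y \<noteq> 0" "r12 y \<noteq> 0" if y: "0 < y" "y \<le> 1/10" for y
  proof -
    have y4: "y^4 \<le> (1/10)^4" using y by (intro power_mono) auto
    moreover have y8: "y^8 \<le> (1/10)^8" using y by (intro power_mono) auto
    moreover have "(1/10::real)^4 = 1/10000" "(1/10::real)^8 = 1/100000000" by (simp_all add: power_divide)
    ultimately have "33 * y^8 + 33 * y^4 < 1" by linarith
    moreover have "y^12 \<ge> 0" using y by simp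
    ultimately have "r12 y > 0" unfolding rd by linarith
    then show "r12 y \<noteq> 0" by simp
    have "y^4 < 1" using power_strict_mono[of y 1 4] y by simp
    then show "r6 y \<noteq> 0" using y by (auto simp: rd)
  qed
  define s where "s y = r6 y ^ 4 / r8 y ^ 3" for y
  define Q where "Q = (\<Sum>i\<le>n div 3. monom (c i) i)"
  have Qs: "poly Q (of_real (s y)) = 0" if y: "0 < y" "y \<le> 1/10" for y
  proof -
    let ?p = "vec2 (of_real y) 1"
    have p8: "f8 ?p \<noteq> 0" using r8[of y] by (simp add: f)
    have pp: "prefactor r ?p \<noteq> 0" using nz[OF y] by (simp add: prefactor_def f)
    have "0 = (\<Sum>i\<le>n div 3. c i * inv_monom r n i ?p)" using z by simp
    also have "\<dots> = (\<Sum>i\<le>n div 3. prefactor r ?p * f8 ?p ^ n * (c i * of_real (s y) ^ i))"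
    proof (rule sum.cong[OF refl])
      fix i assume "i \<in> {..n div 3}"
      then have "f8 ?p ^ (n - 3 * i) = f8 ?p ^ n / f8 ?p ^ (3 * i)" using p8 by (intro power_diff) auto
      moreover have "complex_of_real (s y) ^ i = f6 ?p ^ (4 * i) / f8 ?p ^ (3 * i)"
        by (simp add: s_def f power_divide power_mult)
      ultimately show "c i * inv_monom r n i ?p = prefactor r ?p * f8 ?p ^ n * (c i * of_real (s y) ^ i)"
        by (simp add: inv_monom_def)
    qed
    also have "\<dots> = prefactor r ?p * f8 ?p ^ n * poly Q (of_real (s y))"
      by (simp add: Q_def poly_sum poly_monom sum_distrib_left)
    finally show ?thesis using p8 pp by simp
  qed
  define b where "b = s (1/10)"
  have b: "b > 0" using nz[of "1/10"] r8[of "1/10"] by (simp add: b_def s_def zero_less_power_eq)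
  have cont: "continuous_on {0..1/10} s"
    unfolding s_def[abs_def] rd by (intro continuous_intros) (use r8 in \<open>auto simp: rd less_le\<close>)
  have s0: "s 0 = 0" by (simp add: s_def rd)
  have "Q = 0"
  proof (rule poly_zero_on_reals[OF infinite_Ioo[OF b]])
    fix t assume t: "t \<in> {0<..<b}"
    obtain y where y: "0 \<le> y" "y \<le> 1/10" "s y = t"
      using IVT'[of s 0 t "1/10"] t s0 cont by (auto simp: b_def)
    then have "y > 0" using t s0 by (cases "y = 0") auto
    then show "poly Q (of_real t) = 0" using Qs[of y] y by simp
  qed
  moreover have "coeff Q i = c i" using i by (simp add: Q_def coeff_sum sum.delta')
  ultimately show ?thesis by simp
qed

section \<open>The modes of the quotient\<close>

lemma sum_fun_apply: "(\<Sum>a\<in>A. f a) x = (\<Sum>a\<in>A. (f a x :: complex))"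
  by (induction A rule: infinite_finite_induct) auto

interpretation CV: vector_space cscale
  by unfold_locales (auto simp: cscale_def fun_eq_iff algebra_simps)

definition wave_space :: "nat \<Rightarrow> (pt \<Rightarrow> complex) set" where
  "wave_space k = {F. (\<forall>p. p \<notin> S3 \<longrightarrow> F p = 0) \<and> C2_S3 F \<and>
      (\<forall>p\<in>S3. lapS3 F p = - of_nat (k * (k + 2)) * F p)}"

lemma wave_space_sib: "a \<le> k \<Longrightarrow> restrS3 (sib a (k - a) j) \<in> wave_space k"
  using C2_S3_sib[of a "k-a" j] lapS3_sib[of _ a "k-a" j]
  by (auto simp: wave_space_def) (auto simp: restrS3_def)

lemma subspace_wave_space: "CV.subspace (wave_space k)"
proof (rule CV.subspaceI)
  have ext: "ext0 (F + G) = (\<lambda>x. ext0 F x + ext0 G x)" "ext0 (cscale c F) = (\<lambda>x. c * ext0 F x)" for F G c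
    by (auto simp: ext0_def cscale_def fun_eq_iff)
  show sc: "cscale c F \<in> wave_space k" if F: "F \<in> wave_space k" for c F
  proof -
    obtain U where U: "open U" "S3 \<subseteq> U" "C2_on U (ext0 F)"
      using F unfolding wave_space_def C2_S3_def by blast
    obtain f' f'' where f: "C2d U (ext0 F) f' f''" using C2_on_imp_C2d[OF U(3)] .
    have "lapS3 (cscale c F) p = c * lapS3 F p" if "p \<in> S3" for p
    proof -
      have pU: "p \<in> U" using U that by blast
      show ?thesis unfolding lapS3_def ext lap4_C2d[OF C2d_cmult[OF f] U(1) pU] lap4_C2d[OF f U(1) pU]
        by (simp add: algebra_simps)
    qed
    moreover have "C2_S3 (cscale c F)"
      unfolding C2_S3_def ext using U C2d_imp_C2_on[OF C2d_cmult[OF f]] by blast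
    ultimately show ?thesis using F by (auto simp: wave_space_def cscale_def)
  qed
  show "F + G \<in> wave_space k" if F: "F \<in> wave_space k" and G: "G \<in> wave_space k" for F G
  proof -
    obtain U V where U: "open U" "S3 \<subseteq> U" "C2_on U (ext0 F)" and V: "open V" "S3 \<subseteq> V" "C2_on V (ext0 G)"
      using F G unfolding wave_space_def C2_S3_def by blast
    obtain f' f'' where f: "C2d U (ext0 F) f' f''" using C2_on_imp_C2d[OF U(3)] .
    obtain g' g'' where g: "C2d V (ext0 G) g' g''" using C2_on_imp_C2d[OF V(3)] .
    have UV: "open (U \<inter> V)" "S3 \<subseteq> U \<inter> V" using U V by auto
    note fg = C2d_add[OF C2d_subset[OF f, of "U \<inter> V"] C2d_subset[OF g, of "U \<inter> V"]]
    have "lapS3 (F + G) p = lapS3 F p + lapS3 G p" if "p \<in> S3" for p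
    proof -
      have p: "p \<in> U" "p \<in> V" "p \<in> U \<inter> V" using U V that by auto
      have "lap4 (\<lambda>x. ext0 F x + ext0 G x) p = (\<Sum>v\<leftarrow>real_basis. f'' v v p + g'' v v p)"
        by (rule lap4_C2d[OF fg UV(1) p(3)]) auto
      then show ?thesis unfolding lapS3_def ext lap4_C2d[OF f U(1) p(1)] lap4_C2d[OF g V(1) p(2)]
        by (simp add: algebra_simps)
    qed
    moreover have "C2_on (U \<inter> V) (\<lambda>x. ext0 F x + ext0 G x)"
      by (rule C2d_imp_C2_on[OF fg]) auto
    then have "C2_S3 (F + G)"
      unfolding C2_S3_def ext using UV by blast
    moreover have "lapS3 F p + lapS3 G p = - of_nat (k * (k + 2)) * (F + G) p" if "p \<in> S3" for p
      using F G that by (simp only: wave_space_def mem_Collect_eq plus_fun_apply distrib_left)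
    ultimately show ?thesis using F G by (simp add: wave_space_def)
  qed
  have "cscale 0 (restrS3 (sib 0 (k - 0) 0)) \<in> wave_space k" by (intro sc wave_space_sib) simp
  then show "0 \<in> wave_space k" by (simp add: cscale_def zero_fun_def)
qed

lemma modes_eq:
  assumes "G \<subseteq> SU2"
  shows "modes G k = {F \<in> wave_space k. \<forall>g\<in>G. \<forall>p\<in>S3. F (g *v p) = F p}"
  using Rg_invariant_iff assms unfolding modes_def wave_space_def by blast

lemma Ostar_SU2: "Ostar \<subseteq> SU2" by (auto simp: Ostar_def)

lemma subspace_modes: "CV.subspace (modes Ostar k)"
  using subspace_wave_space[of k] unfolding modes_eq[OF Ostar_SU2] CV.subspace_def
  by (auto simp: cscale_def)

lemma modes_expansion:
  assumes "F \<in> modes Ostar k"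
  obtains c where "\<And>p. p \<in> S3 \<Longrightarrow> F p = (\<Sum>j\<le>k. \<Sum>a\<le>k. c j a * sib a (k-a) j p)"
    and "\<And>j. j \<le> k \<Longrightarrow> Inv k 1 (form k (c j))"
proof -
  have F: "C2_S3 F" "\<And>p. p \<in> S3 \<Longrightarrow> lapS3 F p = - of_nat (k * (k + 2)) * F p"
    and inv: "\<And>g p. g \<in> Ostar \<Longrightarrow> p \<in> S3 \<Longrightarrow> F (g *v p) = F p"
    using assms unfolding modes_eq[OF Ostar_SU2] wave_space_def by auto
  obtain c where c: "\<And>p. p \<in> S3 \<Longrightarrow> F p = (\<Sum>j\<le>k. \<Sum>a\<le>k. c j a * sib a (k-a) j p)"
    using eigenfunction_eq_sib_sum[OF F] by blast
  have "form k (c j) (g *v p) = form k (c j) p" if g: "g \<in> Ostar" and j: "j \<le> k" for g j p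
  proof -
    have gS: "g \<in> SU2" using g Ostar_SU2 by blast
    have "\<forall>j. \<exists>d. \<forall>p. form k (c j) (g *v p) = form k d p"
    proof
      fix j
      have "isform k (\<lambda>p. form k (c j) (g *v p))" by (intro isform_compose isform_form)
      then show "\<exists>d. \<forall>p. form k (c j) (g *v p) = form k d p" unfolding isform_def by metis
    qed
    then obtain d where d: "\<And>j p. form k (c j) (g *v p) = form k (d j) p" unfolding choice_iff by blast
    have "d j a - c j a = 0" if "a \<le> k" for a
    proof (rule sib_independent[OF _ j that])
      fix p assume p: "p \<in> S3"
      have "(\<Sum>j\<le>k. \<Sum>a\<le>k. d j a * sib a (k-a) j p) = F (g *v p)"
        unfolding c[OF SU2_S3[OF gS p]] using sib_sum_compose[OF gS d] by simp
      also have "\<dots> = (\<Sum>j\<le>k. \<Sum>a\<le>k. c j a * sib a (k-a) j p)"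
        using inv[OF g p] c[OF p] by simp
      finally show "(\<Sum>j\<le>k. \<Sum>a\<le>k. (d j a - c j a) * sib a (k-a) j p) = 0"
        by (simp add: left_diff_distrib sum_subtractf)
    qed
    then have "\<And>a. a \<le> k \<Longrightarrow> d j a = c j a" by simp
    then show ?thesis unfolding d by (simp add: form_def)
  qed
  then have "Inv k 1 (form k (c j))" if "j \<le> k" for j
    using that Dg_Ostar Hg_Ostar by (simp add: Inv_def)
  then show ?thesis using that c by blast
qed

text \<open>The fourth power of \<open>Dg\<close> is -1, under which a form of odd degree changes
  sign.\<close>

lemma Inv_odd_zero:
  assumes "Inv k 1 f" "odd k" shows "f p = 0"
proof -
  have D: "f (Dg *v q) = f q" for q using assms(1) by (simp add: Inv_def)
  have "Dg *v (Dg *v (Dg *v (Dg *v p))) = (-1) *s p"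
  proof -
    have "eps * (eps * (eps * (eps * z))) = - z" for z
      using eps4 by (simp add: power4_eq_xxxx mult.assoc[symmetric])
    moreover have "cnj eps ^ 4 = -1" using arg_cong[OF eps4, of cnj] by simp
    then have "cnj eps * (cnj eps * (cnj eps * (cnj eps * z))) = - z" for z
      by (simp add: power4_eq_xxxx mult.assoc[symmetric])
    ultimately show ?thesis by (simp add: Dg_vec vec_eq_iff forall_2)
  qed
  then have "f ((-1) *s p) = f p" using D by metis
  moreover have "f ((-1) *s p) = (-1) ^ k * f p" using assms(1) isform_homog unfolding Inv_def by blast
  ultimately show ?thesis using assms(2) by simp
qed

lemma modes_odd: assumes "odd k" shows "modes Ostar k = {\<lambda>_. 0}"
proof -
  have "F = (\<lambda>_. 0)" if F: "F \<in> modes Ostar k" for F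
  proof
    fix p
    obtain c where c: "\<And>p. p \<in> S3 \<Longrightarrow> F p = (\<Sum>j\<le>k. \<Sum>a\<le>k. c j a * sib a (k-a) j p)"
      "\<And>j. j \<le> k \<Longrightarrow> Inv k 1 (form k (c j))" using modes_expansion[OF F] by blast
    have "(\<Sum>a\<le>k. c j a * sib a (k-a) j p) = 0" if "j \<le> k" for j
    proof -
      have "form k (c j) q = form k (\<lambda>a. 0) q" for q
        using Inv_odd_zero[OF c(2)[OF that] assms] by (simp add: form_def)
      from sib_sum_eqI[OF this] show ?thesis by simp
    qed
    then show "F p = 0"
      using c(1)[of p] F by (cases "p \<in> S3") (auto simp: modes_def)
  qed
  moreover have "(\<lambda>_. 0) \<in> modes Ostar k"
    using CV.subspace_0[OF subspace_modes] by (simp add: zero_fun_def)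
  ultimately show ?thesis by blast
qed

text \<open>Relations over the index set control repetitions too: two indices with the same value
  would give a relation with coefficients 1 and -1.\<close>

lemma inj_independent_family:
  assumes "finite I" and z: "\<And>c. (\<And>p. (\<Sum>x\<in>I. c x * fam x p) = 0) \<Longrightarrow> \<forall>x\<in>I. c x = (0::complex)"
  shows "inj_on fam I" "CV.independent (fam ` I)"
proof -
  show inj: "inj_on fam I"
  proof (rule inj_onI, rule ccontr)
    fix x y assume xy: "x \<in> I" "y \<in> I" "fam x = fam y" "x \<noteq> y"
    define c :: "'a \<Rightarrow> complex" where "c = (\<lambda>_. 0)(x := 1, y := -1)"
    have "(\<Sum>i\<in>I. c i * fam i p) = 0" for p
    proof -
      have "(\<Sum>i\<in>I. c i * fam i p) = (\<Sum>i\<in>{x,y}. c i * fam i p)"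
        using xy assms(1) by (intro sum.mono_neutral_right) (auto simp: c_def)
      then show ?thesis using xy by (simp add: c_def)
    qed
    from z[OF this] xy have "c x = 0" by blast
    then show False using xy by (simp add: c_def)
  qed
  show "CV.independent (fam ` I)"
  proof
    assume "CV.dependent (fam ` I)"
    then obtain u v where u: "v \<in> fam ` I" "u v \<noteq> 0" "(\<Sum>v\<in>fam ` I. cscale (u v) v) = 0"
      using CV.dependent_finite[of "fam ` I"] assms(1) by auto
    have "(\<Sum>x\<in>I. u (fam x) * fam x p) = 0" for p
    proof -
      have "0 = (\<Sum>v\<in>fam ` I. cscale (u v) v) p" using u(3) by simp
      also have "\<dots> = (\<Sum>x\<in>I. u (fam x) * fam x p)"
        unfolding sum.reindex[OF inj] by (simp add: sum_fun_apply cscale_def)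
      finally show ?thesis by simp
    qed
    from z[OF this] u show False by auto
  qed
qed

lemma Bfun_basis:
  assumes "even k" "ktilde k \<ge> 0"
  obtains n r where "\<And>i. i \<in> {0..ktilde k} \<Longrightarrow> Bfun k i = inv_monom r n (nat (ktilde k - i))"
    "ktilde k = int (n div 3)" "k = 2 * (4 * n + offset r)" "r < 4"
proof -
  define m where "m = k div 2"
  have k: "k = 2 * m" using assms(1) by (simp add: m_def)
  obtain n where n: "m = 4 * n + offset (m mod 4)" using ktilde_nonneg_offset assms(2) unfolding k by blast
  have kt: "ktilde k = int (n div 3)" using ktilde_offset[OF n] unfolding k by blast
  have "Bfun k i = inv_monom (m mod 4) n (nat (ktilde k - i))" if "i \<in> {0..ktilde k}" for i
  proof
    fix p
    have "nat (ktilde k - i) \<le> n div 3" "int (n div 3) - int (nat (ktilde k - i)) = i" using that kt by auto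
    then show "Bfun k i p = inv_monom (m mod 4) n (nat (ktilde k - i)) p"
      using Bfun_eq_inv_monom[OF n, of "nat (ktilde k - i)" p] unfolding k by simp
  qed
  moreover have "k = 2 * (4 * n + offset (m mod 4))" by (simp only: k n[symmetric])
  ultimately show ?thesis using that[of "m mod 4" n] kt by simp
qed

theorem theorem11p1:
  fixes k :: nat
  shows "(odd k \<longrightarrow> modes Ostar k = {(\<lambda>_. 0)}) \<and>
    (even k \<longrightarrow>
      (let kt = ktilde k;
           I = {0..kt} \<times> {0..k};
           fam = (\<lambda>(i, j). restrS3 ((twist_minus ^^ j) (Bfun k i)))
       in (\<forall>i\<in>{0..kt}. homog k (Bfun k i)) \<and>
          inj_on fam I \<and>
          cindependent (fam ` I) \<and>
          cspan (fam ` I) = modes Ostar k \<and>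
          int (cdim (modes Ostar k)) = (kt + 1) * (int k + 1)))"
proof (intro conjI impI)
  assume "odd k" then show "modes Ostar k = {\<lambda>_. 0}" by (rule modes_odd)
next
  assume ev: "even k"
  define kt where "kt = ktilde k"
  \<comment> \<open>K is empty when \<open>ktilde k\<close> is -1, so the argument below covers the
    zero space without a case distinction.\<close>
  define K where "K = {0..kt}"
  define I where "I = K \<times> {0..k}"
  define fam where "fam = (\<lambda>(i, j). restrS3 ((twist_minus ^^ j) (Bfun k i)))"
  have finK: "finite K" and finI: "finite I" by (simp_all add: K_def I_def)
  have Bform: "isform k (Bfun k i)" and Binv: "g \<in> Ostar \<Longrightarrow> Bfun k i (g *v p) = Bfun k i p" if i: "i \<in> K" for i g p
  proof -
    have "ktilde k \<ge> 0" using i by (auto simp: K_def kt_def)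
    from Bfun_basis[OF ev this] obtain n r where B: "\<And>i. i \<in> {0..ktilde k} \<Longrightarrow> Bfun k i = inv_monom r n (nat (ktilde k - i))"
      "ktilde k = int (n div 3)" "k = 2 * (4 * n + offset r)" "r < 4" by blast
    let ?i = "nat (ktilde k - i)"
    have "?i \<le> n div 3" using i B(2) by (auto simp: K_def kt_def)
    then have "3 * ?i \<le> n" by simp
    moreover have "Bfun k i = inv_monom r n ?i" using B(1) i by (auto simp: K_def kt_def)
    ultimately show "isform k (Bfun k i)" "g \<in> Ostar \<Longrightarrow> Bfun k i (g *v p) = Bfun k i p"
      using Inv_inv_monom[of ?i n r] inv_monom_Ostar[of ?i n r g p] B(3,4) by (auto simp: Inv_def)
  qed
  have Bind: "c i = 0" if c: "\<And>p. (\<Sum>i\<in>K. c i * Bfun k i p) = 0" and i: "i \<in> K" for c i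
  proof -
    have "ktilde k \<ge> 0" using i by (auto simp: K_def kt_def)
    from Bfun_basis[OF ev this] obtain n r where B: "\<And>i. i \<in> {0..ktilde k} \<Longrightarrow> Bfun k i = inv_monom r n (nat (ktilde k - i))"
      "ktilde k = int (n div 3)" by blast
    have bij: "bij_betw (\<lambda>j. kt - int j) {..n div 3} K"
      by (rule bij_betw_byWitness[of _ "\<lambda>i. nat (kt - i)"]) (auto simp: K_def kt_def B(2))
    have "(\<Sum>j\<le>n div 3. c (kt - int j) * inv_monom r n j p) = 0" for p
    proof -
      have "(\<Sum>i\<in>K. c i * Bfun k i p) = (\<Sum>j\<le>n div 3. c (kt - int j) * Bfun k (kt - int j) p)"
        by (rule sum.reindex_bij_betw[OF bij, symmetric])
      also have "\<dots> = (\<Sum>j\<le>n div 3. c (kt - int j) * inv_monom r n j p)"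
        by (intro sum.cong refl) (auto simp: B(1) kt_def B(2))
      finally show ?thesis using c by simp
    qed
    from inv_monom_independent[OF this, of "nat (kt - i)"] i B(2) show ?thesis by (auto simp: K_def kt_def)
  qed
  have "\<forall>i. \<exists>d. i \<in> K \<longrightarrow> Bfun k i = form k d" using Bform unfolding isform_def by blast
  then obtain b where b: "\<And>i. i \<in> K \<Longrightarrow> Bfun k i = form k (b i)" unfolding choice_iff by blast
  have fam_eq: "fam (i, j) p = (if p \<in> S3 then fact j * (\<Sum>a\<le>k. b i a * sib a (k-a) j p) else 0)" if "i \<in> K" for i j p
    using that by (simp add: fam_def b twist_form restrS3_def)
  have form_sum: "form k (\<lambda>a. \<Sum>i\<in>K. e i * b i a) p = (\<Sum>i\<in>K. e i * Bfun k i p)" for e p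
  proof -
    have "form k (\<lambda>a. \<Sum>i\<in>K. e i * b i a) p = (\<Sum>a\<le>k. \<Sum>i\<in>K. e i * (b i a * (p$1)^a * (p$2)^(k-a)))"
      by (simp add: form_def sum_distrib_right mult.assoc)
    also have "\<dots> = (\<Sum>i\<in>K. \<Sum>a\<le>k. e i * (b i a * (p$1)^a * (p$2)^(k-a)))" by (rule sum.swap)
    also have "\<dots> = (\<Sum>i\<in>K. e i * Bfun k i p)" by (intro sum.cong refl) (simp add: b form_def sum_distrib_left)
    finally show ?thesis .
  qed
  \<comment> \<open>For each j the inner coefficients are those of a single form, the combination of
    the \<open>Bfun k i\<close> with weights c (i, j) * j!. Independence and spanning thereby reduce
    to statements about forms.\<close>
  have sum_I: "(\<Sum>x\<in>I. c x * fam x p) = (\<Sum>j\<le>k. \<Sum>a\<le>k. (\<Sum>i\<in>K. c (i, j) * fact j * b i a) * sib a (k-a) j p)" if p: "p \<in> S3" for c p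
  proof -
    have "(\<Sum>x\<in>I. c x * fam x p) = (\<Sum>i\<in>K. \<Sum>j\<le>k. c (i, j) * fam (i, j) p)"
      unfolding I_def atLeast0AtMost by (subst sum.cartesian_product) (simp add: case_prod_unfold)
    also have "\<dots> = (\<Sum>j\<le>k. \<Sum>i\<in>K. c (i, j) * fam (i, j) p)" by (rule sum.swap)
    also have "\<dots> = (\<Sum>j\<le>k. \<Sum>a\<le>k. (\<Sum>i\<in>K. c (i, j) * fact j * b i a) * sib a (k-a) j p)"
    proof (rule sum.cong[OF refl])
      fix j
      have "(\<Sum>i\<in>K. c (i, j) * fam (i, j) p) = (\<Sum>i\<in>K. \<Sum>a\<le>k. c (i, j) * fact j * b i a * sib a (k-a) j p)"
        using p by (intro sum.cong refl) (simp add: fam_eq sum_distrib_left mult_ac)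
      also have "\<dots> = (\<Sum>a\<le>k. \<Sum>i\<in>K. c (i, j) * fact j * b i a * sib a (k-a) j p)" by (rule sum.swap)
      finally show "(\<Sum>i\<in>K. c (i, j) * fam (i, j) p) = (\<Sum>a\<le>k. (\<Sum>i\<in>K. c (i, j) * fact j * b i a) * sib a (k-a) j p)"
        by (simp add: sum_distrib_right)
    qed
    finally show ?thesis .
  qed
  have indep: "\<forall>x\<in>I. c x = 0" if c: "\<And>p. (\<Sum>x\<in>I. c x * fam x p) = 0" for c :: "int \<times> nat \<Rightarrow> complex"
  proof
    fix x assume x: "x \<in> I"
    obtain i j where ij: "x = (i, j)" "i \<in> K" "j \<le> k" using x by (auto simp: I_def)
    have "(\<Sum>i\<in>K. c (i, j) * fact j * b i a) = 0" if a: "a \<le> k" for a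
    proof (rule sib_independent[OF _ ij(3) a, where c = "\<lambda>j a. \<Sum>i\<in>K. c (i, j) * fact j * b i a"])
      fix p assume "p \<in> S3"
      from sum_I[OF this, of c] c[of p]
      show "(\<Sum>j\<le>k. \<Sum>a\<le>k. (\<Sum>i\<in>K. c (i, j) * fact j * b i a) * sib a (k-a) j p) = 0" by (simp only:)
    qed
    then have "(\<Sum>i\<in>K. (c (i, j) * fact j) * Bfun k i p) = 0" for p
      unfolding form_sum[symmetric] by (simp add: form_def)
    from Bind[OF this ij(2)] show "c x = 0" by (simp add: ij)
  qed
  have inj: "inj_on fam I" and ind: "CV.independent (fam ` I)"
    using inj_independent_family[of I fam] finI indep by blast+
  have fam_modes: "fam x \<in> modes Ostar k" if x: "x \<in> I" for x
  proof -
    obtain i j where ij: "x = (i, j)" "i \<in> K" using x by (auto simp: I_def)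
    have "fam x = cscale (fact j) (\<Sum>a\<le>k. cscale (b i a) (restrS3 (sib a (k-a) j)))"
      using ij by (auto simp: fam_eq cscale_def sum_fun_apply restrS3_def fun_eq_iff)
    also have "\<dots> \<in> wave_space k"
      by (intro CV.subspace_scale[OF subspace_wave_space] CV.subspace_sum[OF subspace_wave_space] wave_space_sib) simp
    finally have "fam x \<in> wave_space k" .
    moreover have "fam x (g *v p) = fam x p" if g: "g \<in> Ostar" and p: "p \<in> S3" for g p
    proof -
      have gS: "g \<in> SU2" using g Ostar_SU2 by blast
      have "form k (b i) (g *v q) = form k (b i) q" for q using Binv[OF ij(2) g] b[OF ij(2)] by simp
      then show ?thesis using SU2_S3[OF gS p] p sib_sum_compose[OF gS, of k "b i" "b i"] by (simp add: ij fam_eq)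
    qed
    ultimately show ?thesis unfolding modes_eq[OF Ostar_SU2] by blast
  qed
  have span: "CV.span (fam ` I) = modes Ostar k"
  proof
    show "CV.span (fam ` I) \<subseteq> modes Ostar k"
      by (rule CV.span_minimal[OF _ subspace_modes]) (use fam_modes in auto)
    show "modes Ostar k \<subseteq> CV.span (fam ` I)"
    proof
      fix F assume F: "F \<in> modes Ostar k"
      obtain c where c: "\<And>p. p \<in> S3 \<Longrightarrow> F p = (\<Sum>j\<le>k. \<Sum>a\<le>k. c j a * sib a (k-a) j p)"
        "\<And>j. j \<le> k \<Longrightarrow> Inv k 1 (form k (c j))" using modes_expansion[OF F] by blast
      have "\<exists>e. \<forall>p. form k (c j) p = (\<Sum>i\<in>K. e i * Bfun k i p)" if j: "j \<le> k" for j
      proof -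
        define m where "m = k div 2"
        have km: "k = 2 * m" using ev by (simp add: m_def)
        have "(\<forall>p. form k (c j) p = 0) \<or> (\<exists>n e. m = 4 * n + offset (m mod 4) \<and> (\<forall>p. form k (c j) p = (\<Sum>i\<le>n div 3. e i * inv_monom (m mod 4) n i p)))"
          using Inv_expansion[of m "form k (c j)"] c(2)[OF j] km by simp
        then show ?thesis
        proof
          assume "\<forall>p. form k (c j) p = 0"
          then show ?thesis by (intro exI[of _ "\<lambda>i. 0"]) simp
        next
          assume "\<exists>n e. m = 4 * n + offset (m mod 4) \<and> (\<forall>p. form k (c j) p = (\<Sum>i\<le>n div 3. e i * inv_monom (m mod 4) n i p))"
          then obtain n e where n: "m = 4 * n + offset (m mod 4)" and e: "\<And>p. form k (c j) p = (\<Sum>i\<le>n div 3. e i * inv_monom (m mod 4) n i p)" by blast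
          have ktn: "kt = int (n div 3)" using ktilde_offset(1)[OF n] km by (simp add: kt_def)
          have bij: "bij_betw (\<lambda>j. kt - int j) {..n div 3} K"
            by (rule bij_betw_byWitness[of _ "\<lambda>i. nat (kt - i)"]) (auto simp: K_def ktn)
          have "form k (c j) p = (\<Sum>i\<in>K. e (nat (kt - i)) * Bfun k i p)" for p
          proof -
            have "(\<Sum>i\<in>K. e (nat (kt - i)) * Bfun k i p) = (\<Sum>i\<le>n div 3. e (nat (kt - (kt - int i))) * Bfun k (kt - int i) p)"
              by (rule sum.reindex_bij_betw[OF bij, symmetric])
            also have "\<dots> = (\<Sum>i\<le>n div 3. e i * inv_monom (m mod 4) n i p)"
              using Bfun_eq_inv_monom[OF n] by (intro sum.cong refl) (simp add: ktn km)
            finally show ?thesis using e by simp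
          qed
          then show ?thesis by (intro exI[of _ "\<lambda>i. e (nat (kt - i))"] allI)
        qed
      qed
      then have "\<forall>j. \<exists>e. j \<le> k \<longrightarrow> (\<forall>p. form k (c j) p = (\<Sum>i\<in>K. e i * Bfun k i p))" by blast
      then obtain e where e: "\<And>j p. j \<le> k \<Longrightarrow> form k (c j) p = (\<Sum>i\<in>K. e j i * Bfun k i p)"
        unfolding choice_iff by blast
      \<comment> \<open>The division cancels the j! that the j-fold twist contributes through
        \<open>twist_form\<close>.\<close>
      define u where "u = (\<lambda>(i::int, j). e j i / fact j)"
      have "F = (\<Sum>x\<in>I. cscale (u x) (fam x))"
      proof
        fix p
        show "F p = (\<Sum>x\<in>I. cscale (u x) (fam x)) p"
        proof (cases "p \<in> S3")
          case True
          have "(\<Sum>x\<in>I. cscale (u x) (fam x)) p = (\<Sum>x\<in>I. u x * fam x p)"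
            by (simp add: sum_fun_apply cscale_def)
          also have "\<dots> = (\<Sum>j\<le>k. \<Sum>a\<le>k. (\<Sum>i\<in>K. e j i * b i a) * sib a (k-a) j p)"
            unfolding sum_I[OF True] by (simp add: u_def)
          also have "\<dots> = (\<Sum>j\<le>k. \<Sum>a\<le>k. c j a * sib a (k-a) j p)"
          proof (rule sum.cong[OF refl])
            fix j assume "j \<in> {..k}"
            then show "(\<Sum>a\<le>k. (\<Sum>i\<in>K. e j i * b i a) * sib a (k-a) j p) = (\<Sum>a\<le>k. c j a * sib a (k-a) j p)"
              using e form_sum by (intro sib_sum_eqI) simp
          qed
          finally show ?thesis using c(1)[OF True] by simp
        next
          case False
          then have "fam x p = 0" if "x \<in> I" for x using that fam_eq by (auto simp: I_def)
          moreover have "F p = 0" using F False by (simp add: modes_def)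
          ultimately show ?thesis by (simp add: sum_fun_apply cscale_def)
        qed
      qed
      also have "\<dots> \<in> CV.span (fam ` I)"
        by (intro CV.span_sum CV.span_scale CV.span_base imageI)
      finally show "F \<in> CV.span (fam ` I)" .
    qed
  qed
  have dim: "int (CV.dim (modes Ostar k)) = (kt + 1) * (int k + 1)"
  proof -
    have "CV.dim (modes Ostar k) = card (fam ` I)"
      unfolding span[symmetric] by (rule CV.dim_span_eq_card_independent[OF ind])
    also have "\<dots> = card I" by (rule card_image[OF inj])
    \<comment> \<open>The number of integers from 0 to kt is kt + 1 also for kt = -1, and
      \<open>ktilde_ge\<close> excludes smaller values.\<close>
    also have "int \<dots> = (kt + 1) * (int k + 1)"
      using ktilde_ge[of k] by (simp add: I_def K_def kt_def card_cartesian_product algebra_simps)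
    finally show ?thesis .
  qed
  have hom: "\<forall>i\<in>K. homog k (Bfun k i)"
    using Bform isform_homog unfolding homog_def by blast
  show "let kt = ktilde k;
           I = {0..kt} \<times> {0..k};
           fam = (\<lambda>(i, j). restrS3 ((twist_minus ^^ j) (Bfun k i)))
       in (\<forall>i\<in>{0..kt}. homog k (Bfun k i)) \<and>
          inj_on fam I \<and>
          cindependent (fam ` I) \<and>
          cspan (fam ` I) = modes Ostar k \<and>
          int (cdim (modes Ostar k)) = (kt + 1) * (int k + 1)"
    using hom inj ind span dim unfolding Let_def fam_def I_def K_def kt_def by (intro conjI)
qed

end
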